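(* Let $\mathscr{W} : \mathcal{P}(\mathbb{R}^d) \to [0,+\infty]$ be an energy functional which is translation invariant, $\sigma$-finite, lower semicontinuous, satisfies growth control with some index $\ell \geq 1$, and is subhomogeneous and chaos compatible (all six properties being defined in the context). Then the sequence of probability measures $\overline{\mathbb{P}}_n$, $n \geq 2$, satisfies a large deviation principle (with speed $n$) on $\overline{\mathcal{P}}(\mathbb{R}^d)$ with good rate function \[ \overline{\mathscr{I}}[\overline{\mu}] := \overline{\mathscr{F}}[\overline{\mu}] - \mathscr{F}_\star, \qquad \overline\mu \in \overline{\mathcal{P}}(\mathbb{R}^d). \]
   Context: Throughout, $d \geq 1$ is an integer and $\sigma^2>0$ is fixed. Spaces. $\mathcal{P}(\mathbb{R}^d)$ is the set of Borel probability measures on $\mathbb{R}^d$ with the topology of weak convergence. For $p \geq 1$, $\mathcal{P}_p(\mathbb{R}^d)$ is the set of those with finite $p$-th moment and $\widetilde{\mathcal{P}}_p(\mathbb{R}^d)$ the subset of centered ones ($\int x\,\mathrm{d}\mu(x)=0$). For $y \in \mathbb{R}^d$, $\tau_y\mu$ is the pushforward of $\mu$ by $x \mapsto x+y$. $\overline{\mathcal{P}}(\mathbb{R}^d)$ is the orbit space of the action $(y,\mu)\mapsto\tau_y\mu$ of $\mathbb{R}^d$ on $\mathcal{P}(\mathbb{R}^d)$, $\rho:\mathcal{P}(\mathbb{R}^d)\to\overline{\mathcal{P}}(\mathbb{R}^d)$, $\rho(\mu)=\{\tau_y\mu : y\in\mathbb{R}^d\}$, is the orbit map, and $\overline{\mathcal{P}}(\mathbb{R}^d)$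 carries the quotient topology (the strongest topology making $\rho$ continuous), which is metrisable. Energy. For $n \geq 2$ and $\mathbf{x}=(x_1,\ldots,x_n) \in (\mathbb{R}^d)^n$, $\pi_n(\mathbf{x}) := \frac1n\sum_{i=1}^n \delta_{x_i}$ and $W_n(\mathbf{x}) := \mathscr{W}[\pi_n(\mathbf{x})]$. The properties of $\mathscr{W}$ are: - translation invariant: $\mathscr{W}[\tau_y\mu]=\mathscr{W}[\mu]$ for all $y \in \mathbb{R}^d$, $\mu \in \mathcal{P}(\mathbb{R}^d)$; - $\sigma$-finite: $\mathscr{W}[\mu]<+\infty$ if $\mu$ has compact support; - lower semicontinuous: $\mathscr{W}$ is lower semicontinuous on $\mathcal{P}(\mathbb{R}^d)$; - growth control with index $\ell \geq 1$: there is $\kappa_\ell>0$ such that $\mathscr{W}[\mu]=+\infty$ if $\mu \notin \mathcal{P}_\ell(\mathbb{R}^d)$, and $\mathscr{W}[\widetilde\mu] \geq \kappa_\ell \int |x|^\ell \,\mathrm{d}\widetilde\mu(x)$ for all $\widetilde\mu \in \widetilde{\mathcal{P}}_\ell(\mathbb{R}^d)$; - subhomogeneous: for all $\epsilon\in(0,1)$, all $n\ge 2$ and all $\mathbf{x}\in(\mathbb{R}^d)^n$, $(1-\epsilon)W_n(\mathbf{x}) \geq W_n((1-\epsilon)\mathbf{x})$; - chaos compatible: for all $\mu \in \mathcal{P}(\mathbb{R}^d)$, if $(Y_n)_{n\ge1}$ are i.i.d. with law $\mu$, then $\lim_{n\to\infty} \mathbf{E}[W_n(Y_1,\ldots,Y_n)]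 = \mathscr{W}[\mu]$. Gibbs measure. $M_{d,n} := \{\widetilde{\mathbf{x}} \in (\mathbb{R}^d)^n : \widetilde x_1+\cdots+\widetilde x_n=0\}$, with Lebesgue measure $\mathrm{d}\widetilde{\mathbf{x}}$. $\widetilde{P}_n$ is the probability measure on $(\mathbb{R}^d)^n$, concentrated on $M_{d,n}$, with density $\widetilde{Z}_n^{-1}\exp(-\frac{2n}{\sigma^2}W_n(\widetilde{\mathbf{x}}))$ with respect to $\mathrm{d}\widetilde{\mathbf{x}}$, where $\widetilde Z_n := \int_{M_{d,n}} \exp(-\frac{2n}{\sigma^2}W_n(\widetilde{\mathbf{x}}))\,\mathrm{d}\widetilde{\mathbf{x}} \in (0,+\infty)$. Set $\widetilde{\mathbb{P}}_n := \widetilde{P}_n \circ \pi_n^{-1}$ (a Borel probability measure on $\mathcal{P}(\mathbb{R}^d)$) and $\overline{\mathbb{P}}_n := \widetilde{\mathbb{P}}_n\circ\rho^{-1}$. Free energy. The entropy is $\mathscr{S}[\mu] := \int p\log p\,\mathrm{d}x \in (-\infty,+\infty]$ if $\mu \in \mathcal{P}_1(\mathbb{R}^d)$ has Lebesgue density $p$, and $\mathscr{S}[\mu]:=+\infty$ otherwise. $\mathscr{F}[\mu] := \mathscr{S}[\mu]+\frac{2}{\sigma^2}\mathscr{W}[\mu]$ and $\mathscr{F}_\star := \inf_{\mu\in\mathcal{P}(\mathbb{R}^d)}\mathscr{F}[\mu]$, which is finite. Since $\mathscr{F}$ is translation invariant, $\overline{\mathscr{F}}[\rho(\mu)]:=\mathscr{F}[\mu]$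 is well defined on $\overline{\mathcal{P}}(\mathbb{R}^d)$. A good rate function on a metric space is a proper function with compact level sets. *)

theory Defs
  imports "HOL-Probability.Probability"
begin

section \<open>Spaces of probability measures\<close>

definition borel_probs :: "'a::topological_space measure set" where
  "borel_probs = {\<mu>. sets \<mu> = sets borel \<and> prob_space \<mu>}"

definition probs_moment :: "real \<Rightarrow> 'a::euclidean_space measure set" where
  "probs_moment p = {\<mu> \<in> borel_probs. (\<integral>\<^sup>+x. ennreal (norm x powr p) \<partial>\<mu>) < \<infinity>}"

definition centred_probs :: "real \<Rightarrow> 'a::euclidean_space measure set" where
  "centred_probs p = {\<mu> \<in> probs_moment p. (\<integral>x. x \<partial>\<mu>) = 0}"

text \<open>The coarsest topology on the Borel probability measures that makes
  \<open>\<mu> \<mapsto> \<integral>f d\<mu>\<close> continuous for every bounded continuous \<open>f\<close>.\<close>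

definition weak_topology :: "'a::topological_space measure topology" where
  "weak_topology = topology_generated_by
     {{\<mu> \<in> borel_probs. (\<integral>x. f x \<partial>\<mu>) \<in> U} | (f :: 'a \<Rightarrow> real) U.
        continuous_on UNIV f \<and> bounded (range f) \<and> open U}"

lemma topspace_weak_topology [simp]:
  "topspace (weak_topology :: 'a::topological_space measure topology) = borel_probs"
proof -
  have "borel_probs \<in> {{\<mu> \<in> borel_probs. (\<integral>x. f x \<partial>\<mu>) \<in> U} | (f :: 'a \<Rightarrow> real) U.
        continuous_on UNIV f \<and> bounded (range f) \<and> open U}"
    by (rule CollectI, rule exI[of _ "\<lambda>_. 0"], rule exI[of _ UNIV]) auto
  then show ?thesis
    unfolding weak_topology_def topology_generated_by_topspace by blast
qed

definition translate :: "'a::euclidean_space \<Rightarrow> 'a measure \<Rightarrow> 'a measure" where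
  "translate y \<mu> = distr \<mu> borel (\<lambda>x. x + y)"

definition orbit :: "'a::euclidean_space measure \<Rightarrow> 'a measure set" where
  "orbit \<mu> = range (\<lambda>y. translate y \<mu>)"

definition quotient_topology :: "'a topology \<Rightarrow> ('a \<Rightarrow> 'b) \<Rightarrow> 'b topology" where
  "quotient_topology X f =
     topology (\<lambda>U. U \<subseteq> f ` topspace X \<and> openin X {x \<in> topspace X. f x \<in> U})"

lemma openin_quotient_topology:
  "openin (quotient_topology X f) U \<longleftrightarrow>
     U \<subseteq> f ` topspace X \<and> openin X {x \<in> topspace X. f x \<in> U}"
proof -
  have "istopology (\<lambda>U. U \<subseteq> f ` topspace X \<and> openin X {x \<in> topspace X. f x \<in> U})"
    unfolding istopology_def
  proof (intro conjI allI impI)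
    fix S T
    assume S: "S \<subseteq> f ` topspace X \<and> openin X {x \<in> topspace X. f x \<in> S}"
      and T: "T \<subseteq> f ` topspace X \<and> openin X {x \<in> topspace X. f x \<in> T}"
    have eq: "{x \<in> topspace X. f x \<in> S \<inter> T} =
        {x \<in> topspace X. f x \<in> S} \<inter> {x \<in> topspace X. f x \<in> T}" by auto
    show "S \<inter> T \<subseteq> f ` topspace X" using S by blast
    show "openin X {x \<in> topspace X. f x \<in> S \<inter> T}"
      unfolding eq using S T by (intro openin_Int) auto
  next
    fix \<K>
    assume K: "\<forall>S\<in>\<K>. S \<subseteq> f ` topspace X \<and> openin X {x \<in> topspace X. f x \<in> S}"
    have eq: "{x \<in> topspace X. f x \<in> \<Union>\<K>} = (\<Union>S\<in>\<K>. {x \<in> topspace X. f x \<in> S})" by auto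
    show "\<Union>\<K> \<subseteq> f ` topspace X" using K by blast
    show "openin X {x \<in> topspace X. f x \<in> \<Union>\<K>}"
      unfolding eq using K by (intro openin_Union) auto
  qed
  then show ?thesis
    unfolding quotient_topology_def by (simp add: topology_inverse')
qed

lemma topspace_quotient_topology [simp]:
  "topspace (quotient_topology X f) = f ` topspace X"
proof -
  have "{x \<in> topspace X. f x \<in> f ` topspace X} = topspace X" by auto
  then have "openin (quotient_topology X f) (f ` topspace X)"
    by (simp add: openin_quotient_topology)
  then show ?thesis
    by (metis openin_quotient_topology openin_subset openin_topspace subset_antisym)
qed

lemma quotient_map_quotient_topology: "quotient_map X (quotient_topology X f) f"
  by (simp add: quotient_map_def openin_quotient_topology)

definition orbit_topology :: "'a::euclidean_space measure set topology" where
  "orbit_topology = quotient_topology weak_topology orbit"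

definition borel_of :: "'a topology \<Rightarrow> 'a measure" where
  "borel_of X = sigma (topspace X) {U. openin X U}"

section \<open>Energy functionals\<close>

text \<open>The configuration \<open>(x\<^sub>1, \<dots>, x\<^sub>n)\<close> is a function on \<open>nat\<close> of which only
  the values at \<open>0, \<dots>, n - 1\<close> matter.\<close>

definition empirical :: "nat \<Rightarrow> (nat \<Rightarrow> 'a::topological_space) \<Rightarrow> 'a measure" where
  "empirical n x =
     measure_of UNIV (sets borel) (\<lambda>A. (\<Sum>i<n. emeasure (return borel (x i)) A) / of_nat n)"

lemma empirical_eq_distr:
  fixes x :: "nat \<Rightarrow> 'a::topological_space"
  assumes "n > 0"
  shows "empirical n x = distr (uniform_count_measure {..<n}) borel x"
proof -
  let ?D = "distr (uniform_count_measure {..<n}) borel x"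
  have m: "x \<in> measurable (uniform_count_measure {..<n}) borel"
    by (auto simp: measurable_def sets_uniform_count_measure space_uniform_count_measure)
  have "emeasure ?D A = (\<Sum>i<n. emeasure (return borel (x i)) A) / of_nat n"
    if A: "A \<in> sets borel" for A
  proof -
    have "emeasure ?D A = of_nat (card {i. i < n \<and> x i \<in> A}) / of_nat n"
    proof -
      have eq: "x -` A \<inter> {..<n} = {i. i < n \<and> x i \<in> A}" by auto
      have sub: "{i. i < n \<and> x i \<in> A} \<subseteq> {..<n}" by auto
      show ?thesis
        using A assms
        by (simp add: emeasure_distr[OF m] emeasure_uniform_count_measure[OF _ sub] eq
              space_uniform_count_measure
              ennreal_of_nat_eq_real_of_nat divide_ennreal)
    qed
    also have "of_nat (card {i. i < n \<and> x i \<in> A}) = (\<Sum>i<n. emeasure (return borel (x i)) A)"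
    proof -
      have "(\<Sum>i<n. indicator A (x i) :: ennreal) = (\<Sum>i\<in>{i. i < n \<and> x i \<in> A}. 1)"
        by (intro sum.mono_neutral_cong_right) (auto simp: indicator_def)
      then show ?thesis using A by simp
    qed
    finally show ?thesis .
  qed
  then have "empirical n x = measure_of UNIV (sets borel) (emeasure ?D)"
    unfolding empirical_def
    by (intro measure_of_eq) (simp_all add: sets.sigma_sets_eq[of borel, simplified])
  also have "\<dots> = ?D"
    using measure_of_of_measure[of ?D] by simp
  finally show ?thesis .
qed

definition energy_n :: "('a::topological_space measure \<Rightarrow> ennreal) \<Rightarrow> nat \<Rightarrow> (nat \<Rightarrow> 'a) \<Rightarrow> ennreal" where
  "energy_n W n x = W (empirical n x)"

definition measure_support :: "'a::topological_space measure \<Rightarrow> 'a set" where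
  "measure_support \<mu> = {x. \<forall>U. open U \<and> x \<in> U \<longrightarrow> emeasure \<mu> U > 0}"

definition translation_invariant :: "('a::euclidean_space measure \<Rightarrow> ennreal) \<Rightarrow> bool" where
  "translation_invariant W \<longleftrightarrow> (\<forall>y. \<forall>\<mu>\<in>borel_probs. W (translate y \<mu>) = W \<mu>)"

definition sigma_finite_energy :: "('a::euclidean_space measure \<Rightarrow> ennreal) \<Rightarrow> bool" where
  "sigma_finite_energy W \<longleftrightarrow> (\<forall>\<mu>\<in>borel_probs. compact (measure_support \<mu>) \<longrightarrow> W \<mu> < \<infinity>)"

definition lsc_energy :: "('a::euclidean_space measure \<Rightarrow> ennreal) \<Rightarrow> bool" where
  "lsc_energy W \<longleftrightarrow> (\<forall>a. openin weak_topology {\<mu> \<in> borel_probs. a < W \<mu>})"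

definition growth_control :: "('a::euclidean_space measure \<Rightarrow> ennreal) \<Rightarrow> real \<Rightarrow> bool" where
  "growth_control W l \<longleftrightarrow>
     (\<exists>\<kappa>::real. \<kappa> > 0 \<and>
        (\<forall>\<mu>\<in>borel_probs. \<mu> \<notin> probs_moment l \<longrightarrow> W \<mu> = \<infinity>) \<and>
        (\<forall>\<mu>\<in>centred_probs l. W \<mu> \<ge> ennreal \<kappa> * (\<integral>\<^sup>+x. ennreal (norm x powr l) \<partial>\<mu>)))"

definition subhomogeneous :: "('a::euclidean_space measure \<Rightarrow> ennreal) \<Rightarrow> bool" where
  "subhomogeneous W \<longleftrightarrow>
     (\<forall>\<epsilon>\<in>{0<..<1::real}. \<forall>n\<ge>2. \<forall>x.
        ennreal (1 - \<epsilon>) * energy_n W n x \<ge> energy_n W n (\<lambda>i. (1 - \<epsilon>) *\<^sub>R x i))"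

text \<open>The sample space of the i.i.d. sequence ranges over all probability measures on the
  type of sequences. This type carries the infinite product of \<open>\<mu>\<close> with itself, so it
  realises every law \<open>\<mu>\<close>; and the expectations involved only depend on the law of \<open>Y\<close>.\<close>

definition chaos_compatible :: "('a::euclidean_space measure \<Rightarrow> ennreal) \<Rightarrow> bool" where
  "chaos_compatible W \<longleftrightarrow>
     (\<forall>\<mu>\<in>borel_probs. \<forall>(\<Omega> :: (nat \<Rightarrow> 'a) measure) (Y :: nat \<Rightarrow> (nat \<Rightarrow> 'a) \<Rightarrow> 'a).
        prob_space \<Omega> \<and> prob_space.indep_vars \<Omega> (\<lambda>_. borel) Y UNIV \<and>
        (\<forall>i. distr \<Omega> borel (Y i) = \<mu>) \<longrightarrow>
        (\<lambda>n. \<integral>\<^sup>+\<omega>. energy_n W n (\<lambda>i. Y i \<omega>) \<partial>\<Omega>) \<longlonglongrightarrow> W \<mu>)"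

section \<open>The Gibbs measure\<close>

definition centred_configs :: "nat \<Rightarrow> (nat \<Rightarrow> 'a::euclidean_space) set" where
  "centred_configs n = {x \<in> {..<n} \<rightarrow>\<^sub>E UNIV. (\<Sum>i<n. x i) = 0}"

definition centring :: "nat \<Rightarrow> (nat \<Rightarrow> 'a::euclidean_space) \<Rightarrow> nat \<Rightarrow> 'a" where
  "centring n x = (\<lambda>i\<in>{..<n}. x i - (1 / real n) *\<^sub>R (\<Sum>j<n. x j))"

text \<open>Lebesgue measure on the subspace \<open>M = centred_configs n\<close>, as a measure on the ambient
  space: by Fubini along \<open>M \<oplus> M\<^sup>\<bottom>\<close>, the volume of \<open>A \<subseteq> M\<close> is the ambient Lebesgue measure of
  \<open>A + Q\<close>, where \<open>Q\<close> is a unit cube of \<open>M\<^sup>\<bottom>\<close>. The map \<open>centring n\<close> is the orthogonal projection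
  onto \<open>M\<close>; the orthogonal complement consists of the constant configurations, and the vectors
  \<open>(b, \<dots>, b) / sqrt n\<close> with \<open>b \<in> Basis\<close> form an orthonormal basis of it, in which \<open>x\<close> has the
  coordinates of \<open>(x\<^sub>1 + \<dots> + x\<^sub>n) / sqrt n\<close>.\<close>

definition lebesgue_centred :: "nat \<Rightarrow> (nat \<Rightarrow> 'a::euclidean_space) measure" where
  "lebesgue_centred n =
     distr
       (density (\<Pi>\<^sub>M i\<in>{..<n}. lborel)
          (indicator {x. (1 / sqrt (real n)) *\<^sub>R (\<Sum>i<n. x i) \<in> cbox 0 One}))
       (\<Pi>\<^sub>M i\<in>{..<n}. borel) (centring n)"

lemma measurable_centring:
  "centring n \<in> measurable (\<Pi>\<^sub>M i\<in>{..<n}. lborel)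
     (\<Pi>\<^sub>M i\<in>{..<n}. borel :: 'a::euclidean_space measure)"
  unfolding centring_def by measurable

lemma AE_lebesgue_centred:
  assumes "n > 0"
  shows "AE x in lebesgue_centred n. x \<in> (centred_configs n :: (nat \<Rightarrow> 'a::euclidean_space) set)"
proof -
  have c: "centring n x \<in> centred_configs n" for x :: "nat \<Rightarrow> 'a"
    using assms
    by (simp add: centring_def centred_configs_def sum_subtractf scaleR_sum_right[symmetric]
          sum_constant_scaleR del: sum_constant)
  have eq: "{x \<in> space (\<Pi>\<^sub>M i\<in>{..<n}. borel). x \<in> centred_configs n} =
      {x \<in> space (\<Pi>\<^sub>M i\<in>{..<n}. borel :: 'a measure). (\<Sum>i<n. x i) = 0}"
    by (auto simp: centred_configs_def space_PiM)
  have "{x \<in> space (\<Pi>\<^sub>M i\<in>{..<n}. borel :: 'a measure). (\<Sum>i<n. x i) = 0}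
      \<in> sets (\<Pi>\<^sub>M i\<in>{..<n}. borel)"
    by measurable
  then show ?thesis
    unfolding lebesgue_centred_def
    by (subst AE_distr_iff) (use measurable_centring c eq in auto)
qed

definition exp_neg :: "ennreal \<Rightarrow> ennreal" where
  "exp_neg t = (if t = \<infinity> then 0 else ennreal (exp (- enn2real t)))"

definition gibbs_weight ::
    "('a::euclidean_space measure \<Rightarrow> ennreal) \<Rightarrow> real \<Rightarrow> nat \<Rightarrow> (nat \<Rightarrow> 'a) \<Rightarrow> ennreal" where
  "gibbs_weight W \<sigma>2 n x = exp_neg (ennreal (2 * real n / \<sigma>2) * energy_n W n x)"

definition partition_const ::
    "('a::euclidean_space measure \<Rightarrow> ennreal) \<Rightarrow> real \<Rightarrow> nat \<Rightarrow> ennreal" where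
  "partition_const W \<sigma>2 n = (\<integral>\<^sup>+x. gibbs_weight W \<sigma>2 n x \<partial>lebesgue_centred n)"

definition gibbs ::
    "('a::euclidean_space measure \<Rightarrow> ennreal) \<Rightarrow> real \<Rightarrow> nat \<Rightarrow> (nat \<Rightarrow> 'a) measure" where
  "gibbs W \<sigma>2 n =
     density (lebesgue_centred n) (\<lambda>x. gibbs_weight W \<sigma>2 n x / partition_const W \<sigma>2 n)"

definition gibbs_empirical ::
    "('a::euclidean_space measure \<Rightarrow> ennreal) \<Rightarrow> real \<Rightarrow> nat \<Rightarrow> 'a measure measure" where
  "gibbs_empirical W \<sigma>2 n = distr (gibbs W \<sigma>2 n) (borel_of weak_topology) (empirical n)"

definition gibbs_orbit ::
    "('a::euclidean_space measure \<Rightarrow> ennreal) \<Rightarrow> real \<Rightarrow> nat \<Rightarrow> 'a measure set measure" where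
  "gibbs_orbit W \<sigma>2 n = distr (gibbs_empirical W \<sigma>2 n) (borel_of orbit_topology) orbit"

section \<open>Free energy\<close>

text \<open>The value \<open>\<integral>p log p\<close> is the integral of the positive part minus that of the negative part;
  the latter is finite as soon as \<open>p\<close> has a finite first moment.\<close>

definition entropy_fun :: "'a::euclidean_space measure \<Rightarrow> ereal" where
  "entropy_fun \<mu> =
     (if \<mu> \<in> probs_moment 1 \<and> (\<exists>f \<in> borel_measurable lborel. density lborel f = \<mu>)
      then let p = (\<lambda>x. enn2real (RN_deriv lborel \<mu> x)) in
        enn2ereal (\<integral>\<^sup>+x. ennreal (p x * ln (p x)) \<partial>lborel)
        - enn2ereal (\<integral>\<^sup>+x. ennreal (- (p x * ln (p x))) \<partial>lborel)
      else \<infinity>)"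

definition free_energy ::
    "('a::euclidean_space measure \<Rightarrow> ennreal) \<Rightarrow> real \<Rightarrow> 'a measure \<Rightarrow> ereal" where
  "free_energy W \<sigma>2 \<mu> = entropy_fun \<mu> + ereal (2 / \<sigma>2) * enn2ereal (W \<mu>)"

definition free_energy_inf :: "('a::euclidean_space measure \<Rightarrow> ennreal) \<Rightarrow> real \<Rightarrow> ereal" where
  "free_energy_inf W \<sigma>2 = (INF \<mu>\<in>borel_probs. free_energy W \<sigma>2 \<mu>)"

text \<open>The common value of the free energy on an orbit.\<close>

definition free_energy_orbit ::
    "('a::euclidean_space measure \<Rightarrow> ennreal) \<Rightarrow> real \<Rightarrow> 'a measure set \<Rightarrow> ereal" where
  "free_energy_orbit W \<sigma>2 A = the_elem (free_energy W \<sigma>2 ` A)"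

definition rate_orbit ::
    "('a::euclidean_space measure \<Rightarrow> ennreal) \<Rightarrow> real \<Rightarrow> 'a measure set \<Rightarrow> ereal" where
  "rate_orbit W \<sigma>2 A = free_energy_orbit W \<sigma>2 A - free_energy_inf W \<sigma>2"

section \<open>Large deviations\<close>

definition good_rate_function :: "'b topology \<Rightarrow> ('b \<Rightarrow> ereal) \<Rightarrow> bool" where
  "good_rate_function X I \<longleftrightarrow>
     (\<forall>x\<in>topspace X. I x \<noteq> -\<infinity>) \<and> (\<exists>x\<in>topspace X. I x \<noteq> \<infinity>) \<and>
     (\<forall>a::real. compactin X {x \<in> topspace X. I x \<le> ereal a})"

definition log_prob :: "real \<Rightarrow> ereal" where
  "log_prob t = (if t = 0 then -\<infinity> else ereal (ln t))"

definition ldp :: "'b topology \<Rightarrow> (nat \<Rightarrow> 'b measure) \<Rightarrow> ('b \<Rightarrow> ereal) \<Rightarrow> bool" where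
  "ldp X P I \<longleftrightarrow>
     (\<forall>G. openin X G \<longrightarrow>
        - (INF x\<in>G. I x) \<le> liminf (\<lambda>n. ereal (1 / real n) * log_prob (measure (P n) G))) \<and>
     (\<forall>C. closedin X C \<longrightarrow>
        limsup (\<lambda>n. ereal (1 / real n) * log_prob (measure (P n) C)) \<le> - (INF x\<in>C. I x))"

end

theory Submission
  imports Defs
begin

text \<open>Up to a factor that does not depend on the event, integrating a translation-invariant
  function over centred configurations amounts to integrating it over all configurations with any
  weight on the barycentre. So the law of the orbits is \<open>mass n A / mass n borel_probs\<close> for an
  integral \<open>mass n A\<close> over the product Lebesgue space, and it suffices to show that \<open>mass n A\<close> decays
  like \<open>exp (- n inf\<^sub>A F)\<close>, where \<open>F\<close> is the free energy; the partition function is the case where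
  \<open>A\<close> is everything.

  Upper bound: near a given \<open>\<mu>\<close>, spend a small fraction \<open>\<epsilon>\<close> of the energy, through growth control,
  to produce the integrable weight \<open>exp (- r |x|)\<close>, bound the rest below by lower semicontinuity, and
  apply the exponential Chebyshev inequality with the test function of the Donsker-Varadhan formula for
  the entropy. Finitely many such neighbourhoods suffice, because growth control confines the
  empirical measures to a set of bounded first moment, which is weakly compact, up to
  superexponentially small mass. The same local estimate, with Gibbs' variational inequality, makes the
  free energy lower semicontinuous on sets of bounded first moment.

  Lower bound: change the reference measure to \<open>\<mu>\<^sup>n\<close> and apply Jensen's inequality on the event that
  the empirical measure lies in the given neighbourhood of \<open>\<mu>\<close>, which has probability close to 1;
  chaos compatibility gives the limit of the mean energy. The barycentre weight \<open>exp (- |y|)\<close> is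
  chosen so that its contribution is controlled by the first moment of \<open>\<mu>\<close> alone.\<close>

section \<open>Tight sets of probability measures\<close>

text \<open>Lebesgue measure is infinite, so there is no reference law for Sanov's theorem, and the
  entropy alone is not bounded below. The share \<epsilon> of the energy repairs both; it must be
  fixed before the test function, because the dual formula depends on
  \<open>r = \<beta> * \<epsilon> * \<kappa>\<close>. Growth control bounds moments only around the
  mean, so each use of it pays for the size of the mean, and this decides the barycentre weights.
  The unit cube keeps the mean bounded, which puts all configurations of bounded energy into one
  compact set. A sample of \<mu> need not stay in the cube, so the lower bound wants a weight that
  is positive everywhere; as \<open>bary\<close> is the sum divided by \<open>sqrt n\<close>, its
  expected norm is of order at most \<open>sqrt n\<close> and costs nothing at speed n. The weak
  topology is used through its subbasis: compactness comes from a product of unit intervals, the law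
  of large numbers from an induction on the generation of open sets. On orbits, events are pulled
  back to translation-invariant sets of measures, and sublevel sets, unbounded before the quotient,
  become compact through centred representatives.\<close>

lemma compact_subset_Un_split:
  fixes K :: "'a::metric_space set"
  assumes "compact K" "open U" "open V" "K \<subseteq> U \<union> V"
  obtains K1 K2 where "compact K1" "compact K2" "K1 \<subseteq> U" "K2 \<subseteq> V" "K = K1 \<union> K2"
\<comment> \<open>\<open>infdist\<close> to the empty set is 0 by convention, so a full U or V would
  spoil the comparison of distances below.\<close>
proof (cases "U = UNIV \<or> V = UNIV")
  case True
  then show thesis
    using that[of K "{}"] that[of "{}" K] assms by auto
next
  case False
  \<comment> \<open>K is cut where the distances to the two complements agree: a point of
    \<open>K1\<close> outside U has distance 0 to both closed complements, hence lies outside V as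
    well.\<close>
  define K1 where "K1 = K \<inter> {x. infdist x (- V) \<le> infdist x (- U)}"
  define K2 where "K2 = K \<inter> {x. infdist x (- U) \<le> infdist x (- V)}"
  have "compact K1" "compact K2"
    unfolding K1_def K2_def
    by (intro compact_Int_closed closed_Collect_le continuous_intros assms(1))+
  moreover have "K1 \<subseteq> U"
  proof
    fix x assume x: "x \<in> K1"
    show "x \<in> U"
    proof (rule ccontr)
      assume "x \<notin> U"
      then have "infdist x (- U) = 0" by (simp add: infdist_zero)
      then have "infdist x (- V) = 0"
        using x by (simp add: K1_def order_antisym infdist_nonneg)
      then have "x \<in> - V"
        using in_closed_iff_infdist_zero[of "- V" x] False assms(3) by (auto simp: closed_Compl)
      with \<open>x \<notin> U\<close> x assms(4) show False by (auto simp: K1_def)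
    qed
  qed
  moreover have "K2 \<subseteq> V"
  proof
    fix x assume x: "x \<in> K2"
    show "x \<in> V"
    proof (rule ccontr)
      assume "x \<notin> V"
      then have "infdist x (- V) = 0" by (simp add: infdist_zero)
      then have "infdist x (- U) = 0"
        using x by (simp add: K2_def order_antisym infdist_nonneg)
      then have "x \<in> - U"
        using in_closed_iff_infdist_zero[of "- U" x] False assms(2) by (auto simp: closed_Compl)
      with \<open>x \<notin> V\<close> x assms(4) show False by (auto simp: K2_def)
    qed
  qed
  moreover have "K = K1 \<union> K2" by (auto simp: K1_def K2_def)
  ultimately show thesis using that by blast
qed

text \<open>Prokhorov's theorem by way of Tychonoff's: the finitely additive set functions with prescribed
  tails form a compact set for the product topology, and the regular Borel measure generated by such
  a set function depends continuously on it.\<close>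

definition tight_contents :: "(nat \<Rightarrow> real) \<Rightarrow> ('a::euclidean_space set \<Rightarrow> real) set" where
  "tight_contents b = {m. (\<forall>A. m A \<in> {0..1}) \<and> m UNIV = 1 \<and>
     (\<forall>A\<in>sets borel. \<forall>B\<in>sets borel. A \<inter> B = {} \<longrightarrow> m (A \<union> B) = m A + m B) \<and>
     (\<forall>k. m (- cball 0 (real k)) \<le> b k)}"

text \<open>Tychonoff: each condition compares finitely many values of m and is therefore closed in
  the product topology. Countable additivity would not be, which is why contents are only finitely
  additive.\<close>

lemma compact_tight_contents: "compact (tight_contents b :: ('a::euclidean_space set \<Rightarrow> real) set)"
proof -
  have "compactin (product_topology (\<lambda>_. euclidean) UNIV) (PiE UNIV (\<lambda>_::'a set. {0..1::real}))"
    by (subst compactin_PiE) auto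
  then have c: "compact (PiE UNIV (\<lambda>_::'a set. {0..1::real}))"
    by (simp add: euclidean_product_topology)
  have cont: "continuous_on UNIV (\<lambda>m::'a set \<Rightarrow> real. m A)" for A by simp
  have "closed {m::'a set \<Rightarrow> real. m UNIV = 1}"
    by (intro closed_Collect_eq cont continuous_intros)
  moreover have "closed {m::'a set \<Rightarrow> real. \<forall>A B. A \<in> sets borel \<and> B \<in> sets borel \<and> A \<inter> B = {} \<longrightarrow> m (A \<union> B) = m A + m B}"
    by (intro closed_Collect_all closed_Collect_imp closed_Collect_eq cont continuous_intros open_Collect_const)
  moreover have "closed {m::'a set \<Rightarrow> real. \<forall>k. m (- cball 0 (real k)) \<le> b k}"
    by (intro closed_Collect_all closed_Collect_le cont continuous_intros)
  ultimately have "compact (PiE UNIV (\<lambda>_::'a set. {0..1::real}) \<inter> ({m. m UNIV = 1} \<inter> 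
    ({m. \<forall>A B. A \<in> sets borel \<and> B \<in> sets borel \<and> A \<inter> B = {} \<longrightarrow> m (A \<union> B) = m A + m B} \<inter>
    {m. \<forall>k. m (- cball 0 (real k)) \<le> b k})))"
    by (intro compact_Int_closed c closed_Int)
  also have "(PiE UNIV (\<lambda>_::'a set. {0..1::real}) \<inter> ({m. m UNIV = 1} \<inter> 
    ({m. \<forall>A B. A \<in> sets borel \<and> B \<in> sets borel \<and> A \<inter> B = {} \<longrightarrow> m (A \<union> B) = m A + m B} \<inter>
    {m. \<forall>k. m (- cball 0 (real k)) \<le> b k}))) = tight_contents b"
    by (auto simp: tight_contents_def PiE_iff)
  finally show ?thesis .
qed

section \<open>The Radon measure generated by a content\<close>

definition open_content :: "('a::euclidean_space set \<Rightarrow> real) \<Rightarrow> 'a set \<Rightarrow> ennreal" where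
  "open_content m U = (SUP K\<in>{K. compact K \<and> K \<subseteq> U}. ennreal (m K))"

text \<open>Inner regularisation on open sets followed by outer regularisation: the classical
  passage from a content on compact sets to a Radon measure. Since m itself may fail to be countably
  additive, only its values on compact sets enter.\<close>

definition content_outer :: "('a::euclidean_space set \<Rightarrow> real) \<Rightarrow> 'a set \<Rightarrow> ennreal" where
  "content_outer m A = (INF U\<in>{U. open U \<and> A \<subseteq> U}. open_content m U)"

definition content_measure :: "('a::euclidean_space set \<Rightarrow> real) \<Rightarrow> 'a measure" where
  "content_measure m = measure_of UNIV (sets borel) (content_outer m)"

text \<open>The limit of b is the tightness: it keeps content from escaping to infinity, where
  compact sets cannot see it.\<close>

locale tight_content =
  fixes b :: "nat \<Rightarrow> real" and m :: "'a::euclidean_space set \<Rightarrow> real"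
  assumes m: "m \<in> tight_contents b" and b: "b \<longlonglongrightarrow> 0"
begin

lemma m_nonneg [simp]: "0 \<le> m A" and m_le_1 [simp]: "m A \<le> 1" and m_UNIV [simp]: "m UNIV = 1"
  and m_add: "A \<in> sets borel \<Longrightarrow> B \<in> sets borel \<Longrightarrow> A \<inter> B = {} \<Longrightarrow> m (A \<union> B) = m A + m B"
  and m_tail: "m (- cball 0 (real k)) \<le> b k"
  using m by (auto simp: tight_contents_def)

lemma m_empty [simp]: "m {} = 0"
  using m_add[of "{}" "{}"] by simp

lemma m_mono: "A \<in> sets borel \<Longrightarrow> B \<in> sets borel \<Longrightarrow> A \<subseteq> B \<Longrightarrow> m A \<le> m B"
  using m_add[of A "B - A"] m_nonneg[of "B - A"] by (auto simp: Un_absorb1)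

lemma m_subadd:
  assumes "A \<in> sets borel" "B \<in> sets borel"
  shows "m (A \<union> B) \<le> m A + m B"
proof -
  have "m (A \<union> (B - A)) = m A + m (B - A)"
    using assms by (intro m_add) auto
  moreover have "m (B - A) \<le> m B" using assms by (intro m_mono) auto
  ultimately show ?thesis by simp
qed

lemma m_Compl: "A \<in> sets borel \<Longrightarrow> m (- A) = 1 - m A"
  using m_add[of A "- A"] by auto

lemma open_content_upper: "compact K \<Longrightarrow> K \<subseteq> U \<Longrightarrow> ennreal (m K) \<le> open_content m U"
  unfolding open_content_def by (intro SUP_upper) auto

lemma open_content_mono: "U \<subseteq> V \<Longrightarrow> open_content m U \<le> open_content m V"
  unfolding open_content_def by (intro SUP_subset_mono) auto

lemma open_content_le_1: "open_content m U \<le> 1"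
  unfolding open_content_def by (intro SUP_least) (simp add: ennreal_le_1)

lemma open_content_empty [simp]: "open_content m {} = 0"
  unfolding open_content_def by (auto simp: bot_ennreal)

text \<open>A compact subset of the union splits into compact subsets of the two open sets, so
  finite subadditivity of m suffices. Compactness later lifts this to countable unions.\<close>

lemma open_content_Un:
  assumes "open U" "open V"
  shows "open_content m (U \<union> V) \<le> open_content m U + open_content m V"
  unfolding open_content_def[of m "U \<union> V"]
proof (intro SUP_least, clarify)
  fix K assume K: "compact K" "K \<subseteq> U \<union> V"
  from compact_subset_Un_split[OF K(1) assms K(2)]
  obtain K1 K2 where K12: "compact K1" "compact K2" "K1 \<subseteq> U" "K2 \<subseteq> V" "K = K1 \<union> K2" .
  have "m K \<le> m K1 + m K2"
    unfolding K12(5) using K12 by (intro m_subadd) (auto intro: borel_compact)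
  then have "ennreal (m K) \<le> ennreal (m K1) + ennreal (m K2)"
    by (simp flip: ennreal_plus)
  also have "\<dots> \<le> open_content m U + open_content m V"
    using K12 by (intro add_mono open_content_upper)
  finally show "ennreal (m K) \<le> open_content m U + open_content m V" .
qed

lemma open_content_UN_finite:
  fixes U :: "nat \<Rightarrow> 'a set"
  assumes "\<And>i. open (U i)"
  shows "open_content m (\<Union>i<n. U i) \<le> (\<Sum>i<n. open_content m (U i))"
proof (induction n)
  case (Suc n)
  have "open_content m ((\<Union>i<n. U i) \<union> U n) \<le> open_content m (\<Union>i<n. U i) + open_content m (U n)"
    using assms by (intro open_content_Un) auto
  also have "\<dots> \<le> (\<Sum>i<Suc n. open_content m (U i))"
    using Suc by (simp add: add_right_mono)
  also have "(\<Union>i<n. U i) \<union> U n = (\<Union>i<Suc n. U i)"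
    by (auto simp: lessThan_Suc)
  finally show ?case .
qed simp

lemma open_content_UN:
  fixes U :: "nat \<Rightarrow> 'a set"
  assumes "\<And>i. open (U i)"
  shows "open_content m (\<Union>i. U i) \<le> (\<Sum>i. open_content m (U i))"
  unfolding open_content_def[of m "\<Union>i. U i"]
proof (intro SUP_least, clarify)
  fix K assume K: "compact K" "K \<subseteq> (\<Union>i. U i)"
  obtain C where C: "finite C" "K \<subseteq> (\<Union>i\<in>C. U i)"
    by (rule compactE_image[OF K(1), of UNIV U]) (use K assms in auto)
  obtain n where n: "C \<subseteq> {..<n}" using C(1) finite_nat_iff_bounded by auto
  have "ennreal (m K) \<le> open_content m (\<Union>i<n. U i)"
    using C n K by (intro open_content_upper) blast+
  also have "\<dots> \<le> (\<Sum>i<n. open_content m (U i))" by (intro open_content_UN_finite assms)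
  also have "\<dots> \<le> (\<Sum>i. open_content m (U i))" by (intro sum_le_suminf) auto
  finally show "ennreal (m K) \<le> (\<Sum>i. open_content m (U i))" .
qed

lemma content_outer_lower: "open U \<Longrightarrow> A \<subseteq> U \<Longrightarrow> content_outer m A \<le> open_content m U"
  unfolding content_outer_def by (intro INF_lower) auto

lemma content_outer_open: "open U \<Longrightarrow> content_outer m U = open_content m U"
  unfolding content_outer_def
  by (intro antisym INF_lower INF_greatest open_content_mono) auto

lemma content_outer_mono: "A \<subseteq> B \<Longrightarrow> content_outer m A \<le> content_outer m B"
  unfolding content_outer_def by (intro INF_superset_mono) auto

lemma content_outer_approx:
  assumes "e > 0"
  obtains U where "open U" "A \<subseteq> U" "open_content m U \<le> content_outer m A + ennreal e"
proof -
  have fin: "content_outer m A \<noteq> \<infinity>"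
    using content_outer_lower[of UNIV A] open_content_le_1[of UNIV]
    by (metis ennreal_one_neq_top infinity_ennreal_def neq_top_trans open_UNIV order_trans subset_UNIV top.extremum_uniqueI)
  then have "content_outer m A < content_outer m A + ennreal e"
    using assms ennreal_add_left_cancel_less[of "content_outer m A" 0 "ennreal e"] by (simp add: less_top)
  then obtain U where "open U" "A \<subseteq> U" "open_content m U < content_outer m A + ennreal e"
    unfolding content_outer_def[of m A] by (auto simp: INF_less_iff)
  then show thesis using that by (simp add: less_imp_le)
qed

lemma outer_measure_space_content_outer: "outer_measure_space UNIV (content_outer m)"
  unfolding outer_measure_space_def
proof (intro conjI)
  show "positive UNIV (content_outer m)"
    by (simp add: positive_def content_outer_open)
  show "increasing UNIV (content_outer m)"
    by (simp add: increasing_def content_outer_mono)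
  show "countably_subadditive UNIV (content_outer m)"
  proof (simp add: countably_subadditive_def, intro allI impI)
    fix A :: "nat \<Rightarrow> 'a set"
    show "content_outer m (\<Union>i. A i) \<le> (\<Sum>i. content_outer m (A i))"
    proof (rule ennreal_le_epsilon)
      fix e :: real assume e: "e > 0"
      have "\<forall>i. \<exists>U. open U \<and> A i \<subseteq> U \<and> open_content m U \<le> content_outer m (A i) + ennreal (e * (1/2)^Suc i)"
        using content_outer_approx e by (metis divide_pos_pos mult_pos_pos zero_less_numeral zero_less_one zero_less_power)
      then obtain U where U: "\<And>i. open (U i)" "\<And>i. A i \<subseteq> U i"
        "\<And>i. open_content m (U i) \<le> content_outer m (A i) + ennreal (e * (1/2)^Suc i)" by metis
      have "content_outer m (\<Union>i. A i) \<le> open_content m (\<Union>i. U i)"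
        using U by (intro content_outer_lower open_UN) auto
      also have "\<dots> \<le> (\<Sum>i. open_content m (U i))" by (intro open_content_UN U)
      also have "\<dots> \<le> (\<Sum>i. content_outer m (A i) + ennreal (e * (1/2)^Suc i))"
        by (intro suminf_le U) auto
      also have "\<dots> = (\<Sum>i. content_outer m (A i)) + (\<Sum>i. ennreal (e * (1/2)^Suc i))"
        by (intro suminf_add[symmetric]) auto
      also have "(\<Sum>i. ennreal (e * (1/2)^Suc i)) = ennreal e"
        using e sums_mult[OF power_half_series, of e]
        by (intro sums_unique[symmetric]) (simp add: sums_ennreal)
      finally show "content_outer m (\<Union>i. A i) \<le> (\<Sum>i. content_outer m (A i)) + ennreal e" .
    qed
  qed
qed

text \<open>Caratheodory's condition for open sets. After A is replaced by an open V of almost the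
  same outer content, a compact K inside V and U and a compact K' inside \<open>V - K\<close> are
  disjoint, so additivity of m on their union gives the inequality; suprema over K' and then over K
  finish.\<close>

lemma content_outer_split_open:
  assumes U: "open U"
  shows "content_outer m (A \<inter> U) + content_outer m (A - U) \<le> content_outer m A"
proof (rule ennreal_le_epsilon)
  fix e :: real assume e: "e > 0"
  from content_outer_approx[OF e, of A] obtain V where V: "open V" "A \<subseteq> V"
    "open_content m V \<le> content_outer m A + ennreal e" .
  have *: "ennreal (m K) + open_content m (V - K) \<le> open_content m V" if K: "compact K" "K \<subseteq> V \<inter> U" for K
  proof -
    have "ennreal (m K) + ennreal (m K') \<le> open_content m V" if "compact K'" "K' \<subseteq> V - K" for K'
    proof -
      have "ennreal (m K) + ennreal (m K') = ennreal (m (K \<union> K'))"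
        using that K by (subst m_add) (auto intro: borel_compact)
      also have "\<dots> \<le> open_content m V" using that K by (intro open_content_upper) auto
      finally show ?thesis .
    qed
    then show ?thesis
      unfolding open_content_def[of m "V - K"]
      by (subst ennreal_SUP_add_right) (auto intro!: SUP_least)
  qed
  have "content_outer m (A - U) + ennreal (m K) \<le> open_content m V" if K: "compact K" "K \<subseteq> V \<inter> U" for K
  proof -
    have "content_outer m (A - U) \<le> open_content m (V - K)"
      using V K by (intro content_outer_lower open_Diff) (auto simp: compact_imp_closed)
    then show ?thesis using *[OF K] by (metis add.commute add_left_mono order_trans)
  qed
  then have "content_outer m (A - U) + open_content m (V \<inter> U) \<le> open_content m V"
    unfolding open_content_def[of m "V \<inter> U"]
    by (subst ennreal_SUP_add_right) (auto intro!: SUP_least)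
  moreover have "content_outer m (A \<inter> U) \<le> open_content m (V \<inter> U)"
    using V U by (intro content_outer_lower) auto
  ultimately have "content_outer m (A \<inter> U) + content_outer m (A - U) \<le> open_content m V"
    by (metis add.commute add_left_mono order_trans)
  with V show "content_outer m (A \<inter> U) + content_outer m (A - U) \<le> content_outer m A + ennreal e"
    by simp
qed

lemma measure_space_content_outer: "measure_space UNIV (sets borel) (content_outer m)"
proof -
  interpret sigma_algebra UNIV "Pow UNIV :: 'a set set" by (rule sigma_algebra_Pow)
  let ?L = "lambda_system UNIV UNIV (content_outer m)"
  have ms: "measure_space UNIV ?L (content_outer m)"
    using caratheodory_lemma[OF ] outer_measure_space_content_outer by (simp add: Pow_UNIV)
  have "U \<in> ?L" if "open U" for U
  proof -
    have "content_outer m (U \<inter> A) + content_outer m ((UNIV - U) \<inter> A) = content_outer m A" for A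
    proof (rule antisym)
      show "content_outer m (U \<inter> A) + content_outer m ((UNIV - U) \<inter> A) \<le> content_outer m A"
        using content_outer_split_open[OF that, of A]
        by (simp add: Int_commute Diff_eq)
      have "subadditive UNIV (content_outer m)"
        using outer_measure_space_content_outer countably_subadditive_subadditive
        by (auto simp: outer_measure_space_def)
      then have "content_outer m ((U \<inter> A) \<union> ((UNIV - U) \<inter> A)) \<le>
        content_outer m (U \<inter> A) + content_outer m ((UNIV - U) \<inter> A)"
        by (intro subadditiveD) auto
      moreover have "(U \<inter> A) \<union> ((UNIV - U) \<inter> A) = A" by auto
      ultimately show "content_outer m A \<le> content_outer m (U \<inter> A) + content_outer m ((UNIV - U) \<inter> A)"
        by simp
    qed
    then show ?thesis by (simp add: lambda_system_def)
  qed
  moreover have "sigma_algebra UNIV ?L" using ms by (simp add: measure_space_def)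
  ultimately have "sigma_sets UNIV {U. open U} \<subseteq> ?L"
    by (intro sigma_algebra.sigma_sets_subset) auto
  then have sub: "sets borel \<subseteq> ?L" by (simp add: borel_def)
  show ?thesis
    by (rule measure_down[OF ms _ sub]) (use sets.sigma_algebra_axioms[of borel] in simp)
qed

lemma sets_content_measure [simp, measurable_cong]: "sets (content_measure m) = sets borel"
  unfolding content_measure_def by (simp add: sets.sigma_sets_eq[of borel, simplified])

lemma space_content_measure [simp]: "space (content_measure m) = UNIV"
  unfolding content_measure_def by simp

lemma emeasure_content_measure: "A \<in> sets borel \<Longrightarrow> emeasure (content_measure m) A = content_outer m A"
  using measure_space_content_outer
  unfolding content_measure_def measure_space_def
  by (intro emeasure_measure_of_sigma) auto

text \<open>One half of the portmanteau theorem: closed sets cannot lose mass. Inside a large ball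
  the set is compact, where the outer content dominates m; the rest has content at most
  \<open>b k\<close>, which vanishes. With C = UNIV this makes the generated measure a
  probability.\<close>

lemma content_le_content_measure:
  assumes C: "closed C"
  shows "ennreal (m C) \<le> emeasure (content_measure m) C"
proof -
  have cpt: "ennreal (m K) \<le> content_outer m K" if "compact K" for K
    unfolding content_outer_def using that by (intro INF_greatest open_content_upper) auto
  have le: "ennreal (m C) \<le> content_outer m C + ennreal (b k)" for k
  proof -
    have "m (C \<inter> cball 0 (real k) \<union> (C - cball 0 (real k))) \<le> m (C \<inter> cball 0 (real k)) + m (C - cball 0 (real k))"
      using C by (intro m_subadd) auto
    moreover have "m (C - cball 0 (real k)) \<le> m (- cball 0 (real k))"
      using C by (intro m_mono) auto
    ultimately have "m C \<le> m (C \<inter> cball 0 (real k)) + b k"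
      using m_tail[of k] by (simp add: Int_Diff_Un)
    moreover have "0 \<le> b k" using m_tail[of k] m_nonneg order_trans by blast
    ultimately have "ennreal (m C) \<le> ennreal (m (C \<inter> cball 0 (real k))) + ennreal (b k)"
      by (simp flip: ennreal_plus)
    also have "ennreal (m (C \<inter> cball 0 (real k))) \<le> content_outer m (C \<inter> cball 0 (real k))"
      using C by (intro cpt closed_Int_compact) auto
    also have "\<dots> \<le> content_outer m C" by (intro content_outer_mono) auto
    finally show ?thesis by (simp add: add_right_mono)
  qed
  have "(\<lambda>k. content_outer m C + ennreal (b k)) \<longlonglongrightarrow> content_outer m C + ennreal 0"
    by (intro tendsto_add tendsto_const tendsto_ennrealI b)
  then have "ennreal (m C) \<le> content_outer m C + ennreal 0"
    by (rule LIMSEQ_le_const) (use le in auto)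
  then show ?thesis using C by (simp add: emeasure_content_measure)
qed

lemma prob_space_content_measure: "prob_space (content_measure m)"
proof
  have "1 \<le> emeasure (content_measure m) UNIV" using content_le_content_measure[of UNIV] by simp
  moreover have "emeasure (content_measure m) UNIV \<le> 1"
    by (simp add: emeasure_content_measure content_outer_open open_content_le_1)
  ultimately show "emeasure (content_measure m) (space (content_measure m)) = 1" by simp
qed

lemma content_measure_in_borel_probs: "content_measure m \<in> borel_probs"
  by (simp add: borel_probs_def prob_space_content_measure)

text \<open>A layer-cake Riemann sum. It reads only N values of m, so it is continuous in m for the
  product topology, and it makes sense without countable additivity.\<close>

definition layer_sum :: "('a \<Rightarrow> real) \<Rightarrow> nat \<Rightarrow> real" where
  "layer_sum f N = (\<Sum>j=1..N. m {x. f x \<ge> real j / real N}) / real N"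

end

section \<open>Layer-cake approximation of integrals\<close>

lemma layer_bounds:
  fixes t :: real
  assumes t: "0 \<le> t" "t \<le> 1" and N: "N > 0"
  shows "(\<Sum>j=1..N. if t \<ge> real j / real N then 1 else 0) / real N \<le> t"
    and "t \<le> (\<Sum>j=1..N. if t \<ge> real j / real N then 1 else 0) / real N + 1 / real N"
proof -
  define k where "k = nat \<lfloor>t * real N\<rfloor>"
  have k: "real k \<le> t * real N" "t * real N < real k + 1"
    using t by (auto simp: k_def of_nat_nat)
  have kN: "k \<le> N"
  proof -
    have "t * real N \<le> real N" using t by (simp add: mult_left_le_one_le)
    then show ?thesis using k by linarith
  qed
  have iff: "t \<ge> real j / real N \<longleftrightarrow> j \<le> k" for j
  proof -
    have "t \<ge> real j / real N \<longleftrightarrow> real j \<le> t * real N"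
      using N by (simp add: field_simps)
    also have "\<dots> \<longleftrightarrow> j \<le> k" using k by linarith
    finally show ?thesis .
  qed
  have "(\<Sum>j=1..N. if t \<ge> real j / real N then 1 else 0) = (\<Sum>j\<in>{1..k}. 1::real)"
    unfolding iff using kN by (intro sum.mono_neutral_cong_right) auto
  then have s: "(\<Sum>j=1..N. if t \<ge> real j / real N then 1 else 0) = real k" by simp
  show "(\<Sum>j=1..N. if t \<ge> real j / real N then 1 else 0) / real N \<le> t"
    and "t \<le> (\<Sum>j=1..N. if t \<ge> real j / real N then 1 else 0) / real N + 1 / real N"
    unfolding s using k N by (auto simp: field_simps)
qed

lemma integral_layer_bounds:
  fixes f :: "'a::topological_space \<Rightarrow> real"
  assumes \<mu>: "prob_space \<mu>" and [measurable_cong]: "sets \<mu> = sets borel"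
    and f[measurable]: "f \<in> borel_measurable borel" and f01: "\<And>x. f x \<in> {0..1}" and N: "N > 0"
  shows "(\<Sum>j=1..N. measure \<mu> {x. f x \<ge> real j / real N}) / real N \<le> (\<integral>x. f x \<partial>\<mu>)"
    and "(\<integral>x. f x \<partial>\<mu>) \<le> (\<Sum>j=1..N. measure \<mu> {x. f x \<ge> real j / real N}) / real N + 1 / real N"
proof -
  interpret prob_space \<mu> by fact
  have sp: "space \<mu> = UNIV" using sets_eq_imp_space_eq[OF assms(2)] by simp
  have int: "integrable \<mu> f"
    by (rule integrable_const_bound[of _ 1]) (use f01 in auto)
  have int': "integrable \<mu> (\<lambda>x. if f x \<ge> real j / real N then 1 else 0 :: real)" for j
    by (rule integrable_const_bound[of _ 1]) auto
  have I: "(\<integral>x. (if f x \<ge> real j / real N then 1 else 0 :: real) \<partial>\<mu>) = measure \<mu> {x. f x \<ge> real j / real N}" for j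
  proof -
    have "(\<integral>x. (if f x \<ge> real j / real N then 1 else 0 :: real) \<partial>\<mu>) = (\<integral>x. indicator {x. f x \<ge> real j / real N} x \<partial>\<mu>)"
      by (intro Bochner_Integration.integral_cong) auto
    then show ?thesis by (simp add: sp)
  qed
  have "(\<integral>x. (\<Sum>j=1..N. if f x \<ge> real j / real N then 1 else 0) / real N \<partial>\<mu>) \<le> (\<integral>x. f x \<partial>\<mu>)"
    using f01 N by (intro integral_mono int integrable_divide Bochner_Integration.integrable_sum int' layer_bounds) auto
  then show "(\<Sum>j=1..N. measure \<mu> {x. f x \<ge> real j / real N}) / real N \<le> (\<integral>x. f x \<partial>\<mu>)"
    by (simp add: Bochner_Integration.integral_sum int' I)
  have "(\<integral>x. f x \<partial>\<mu>) \<le> (\<integral>x. (\<Sum>j=1..N. if f x \<ge> real j / real N then 1 else 0) / real N + 1 / real N \<partial>\<mu>)"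
    using f01 N by (intro integral_mono int Bochner_Integration.integrable_add integrable_divide
        Bochner_Integration.integrable_sum int' layer_bounds) auto
  also have "\<dots> = (\<Sum>j=1..N. measure \<mu> {x. f x \<ge> real j / real N}) / real N + 1 / real N"
    by (subst Bochner_Integration.integral_add)
       (auto intro!: integrable_divide Bochner_Integration.integrable_sum int' simp: Bochner_Integration.integral_sum int' I prob_space)
  finally show "(\<integral>x. f x \<partial>\<mu>) \<le> (\<Sum>j=1..N. measure \<mu> {x. f x \<ge> real j / real N}) / real N + 1 / real N" .
qed

context tight_content
begin

lemma layer_sum_le_integral:
  fixes f :: "'a \<Rightarrow> real"
  assumes f: "continuous_on UNIV f" and f01: "\<And>x. f x \<in> {0..1}" and N: "N > 0"
  shows "layer_sum f N \<le> (\<integral>x. f x \<partial>content_measure m)"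
proof -
  interpret P: prob_space "content_measure m" by (rule prob_space_content_measure)
  have "m {x. f x \<ge> real j / real N} \<le> measure (content_measure m) {x. f x \<ge> real j / real N}" for j
  proof -
    have "closed {x. f x \<ge> real j / real N}"
      using f by (intro closed_Collect_le continuous_intros)
    from content_le_content_measure[OF this] show ?thesis
      by (simp add: P.emeasure_eq_measure)
  qed
  then have "layer_sum f N \<le> (\<Sum>j=1..N. measure (content_measure m) {x. f x \<ge> real j / real N}) / real N"
    unfolding layer_sum_def by (intro divide_right_mono sum_mono) auto
  also have "\<dots> \<le> (\<integral>x. f x \<partial>content_measure m)"
    using f f01 N by (intro integral_layer_bounds prob_space_content_measure borel_measurable_continuous_onI) auto
  finally show ?thesis .
qed

text \<open>The comparison of m with its measure is available on closed sets only, so the upper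
  estimate comes from the lower one for \<open>1 - f\<close>: complementation, exact for a finitely
  additive m, turns its layers into strict superlevel sets of f.\<close>

lemma integral_le_layer_sum:
  fixes f :: "'a \<Rightarrow> real"
  assumes f: "continuous_on UNIV f" and f01: "\<And>x. f x \<in> {0..1}" and N: "N > 0"
  shows "(\<integral>x. f x \<partial>content_measure m) \<le> layer_sum f N + 1 / real N"
proof -
  interpret P: prob_space "content_measure m" by (rule prob_space_content_measure)
  have [measurable]: "f \<in> borel_measurable borel" using f by (rule borel_measurable_continuous_onI)
  have int: "integrable (content_measure m) f"
    by (rule P.integrable_const_bound[of _ 1]) (use f01 in auto)
  have "layer_sum (\<lambda>x. 1 - f x) N \<le> (\<integral>x. 1 - f x \<partial>content_measure m)"
    using f01 N by (intro layer_sum_le_integral continuous_intros f) auto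
  also have "\<dots> = 1 - (\<integral>x. f x \<partial>content_measure m)"
    using int P.prob_space by simp
  finally have "(\<integral>x. f x \<partial>content_measure m) \<le> 1 - layer_sum (\<lambda>x. 1 - f x) N" by simp
  also have "\<dots> = (\<Sum>j=1..N. 1 - m {x. 1 - f x \<ge> real j / real N}) / real N"
    unfolding layer_sum_def using N by (simp add: sum_subtractf diff_divide_distrib)
  also have "\<dots> = (\<Sum>j=1..N. m {x. f x > real (N - j) / real N}) / real N"
  proof -
    have "1 - m {x. 1 - f x \<ge> real j / real N} = m {x. f x > real (N - j) / real N}" if "j \<in> {1..N}" for j
    proof -
      have "{x. f x > real (N - j) / real N} = - {x. 1 - f x \<ge> real j / real N}"
        using that N by (auto simp: field_simps of_nat_diff)
      then show ?thesis by (simp add: m_Compl)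
    qed
    then show ?thesis by (intro arg_cong2[where f="(/)"] sum.cong refl)
  qed
  also have "(\<Sum>j=1..N. m {x. f x > real (N - j) / real N}) = (\<Sum>j<N. m {x. f x > real j / real N})"
    by (rule sum.reindex_bij_witness[of _ "\<lambda>j. N - j" "\<lambda>j. N - j"]) auto
  \<comment> \<open>After reindexing, the level j = 0 remains, which \<open>layer_sum\<close> omits;
    its content is at most 1 and becomes the error \<open>1 / real N\<close>.\<close>
  also have "\<dots> \<le> 1 + (\<Sum>j=1..N. m {x. f x \<ge> real j / real N})"
  proof -
    have "(\<Sum>j<N. m {x. f x > real j / real N}) \<le> (\<Sum>j<N. m {x. f x \<ge> real j / real N})"
      by (intro sum_mono m_mono) auto
    also have "\<dots> \<le> (\<Sum>j\<in>insert 0 {1..N}. m {x. f x \<ge> real j / real N})"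
      by (intro sum_mono2) auto
    also have "\<dots> \<le> 1 + (\<Sum>j=1..N. m {x. f x \<ge> real j / real N})"
      by (subst sum.insert) auto
    finally show ?thesis .
  qed
  finally show ?thesis using N by (simp add: layer_sum_def divide_right_mono add_divide_distrib)
qed

end

text \<open>A uniform limit of layer sums: the error 1 / N does not depend on m.\<close>

lemma continuous_on_integral_content_measure:
  fixes f :: "'a::euclidean_space \<Rightarrow> real"
  assumes b: "b \<longlonglongrightarrow> 0" and f: "continuous_on UNIV f" and f01: "\<And>x. f x \<in> {0..1}"
  shows "continuous_on (tight_contents b) (\<lambda>m. \<integral>x. f x \<partial>content_measure m)"
proof (rule uniform_limit_theorem)
  let ?s = "\<lambda>N (m :: 'a set \<Rightarrow> real). (\<Sum>j=1..N. m {x. f x \<ge> real j / real N}) / real N"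
  show "\<forall>\<^sub>F N in sequentially. continuous_on (tight_contents b) (?s N)"
    unfolding divide_inverse
    by (intro always_eventually allI continuous_on_mult_right continuous_on_sum
        continuous_on_subset[OF continuous_on_product_coordinates]) auto
  show "uniform_limit (tight_contents b) ?s (\<lambda>m. \<integral>x. f x \<partial>content_measure m) sequentially"
    unfolding uniform_limit_iff
  proof (intro allI impI)
    fix e :: real assume "e > 0"
    have "\<forall>\<^sub>F N in sequentially. 1 / real N < e \<and> N > 0"
      using order_tendstoD(2)[OF lim_1_over_n \<open>e > 0\<close>] eventually_gt_at_top[of 0] by eventually_elim auto
    then show "\<forall>\<^sub>F N in sequentially. \<forall>m\<in>tight_contents b. dist (?s N m) (\<integral>x. f x \<partial>content_measure m) < e"
    proof eventually_elim
      case (elim N)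
      show ?case
      proof
        fix m :: "'a set \<Rightarrow> real" assume "m \<in> tight_contents b"
        then interpret tight_content b m using b by unfold_locales
        have "?s N m = layer_sum f N" by (simp add: layer_sum_def)
        then show "dist (?s N m) (\<integral>x. f x \<partial>content_measure m) < e"
          using layer_sum_le_integral[OF f f01, of N] integral_le_layer_sum[OF f f01, of N] elim
          by (simp add: dist_real_def)
      qed
    qed
  qed
qed simp

lemma continuous_map_content_measure:
  fixes b :: "nat \<Rightarrow> real"
  assumes b: "b \<longlonglongrightarrow> 0"
  shows "continuous_map (top_of_set (tight_contents b)) weak_topology
    (content_measure :: ('a::euclidean_space set \<Rightarrow> real) \<Rightarrow> 'a measure)"
  unfolding weak_topology_def
proof (rule continuous_on_generated_topo)
  have in_probs: "content_measure m \<in> borel_probs" if "m \<in> tight_contents b" for m :: "'a set \<Rightarrow> real"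
  proof -
    interpret tight_content b m using that b by unfold_locales
    show ?thesis by (rule content_measure_in_borel_probs)
  qed
  {
    fix U assume "U \<in> {{\<mu> \<in> borel_probs. (\<integral>x. f x \<partial>\<mu>) \<in> U} | (f :: 'a \<Rightarrow> real) U.
        continuous_on UNIV f \<and> bounded (range f) \<and> open U}"
    then obtain f :: "'a \<Rightarrow> real" and V where U: "U = {\<mu> \<in> borel_probs. (\<integral>x. f x \<partial>\<mu>) \<in> V}"
      and f: "continuous_on UNIV f" and bf: "bounded (range f)" and V: "open V" by blast
    obtain B where B: "B > 0" "\<And>x. \<bar>f x\<bar> \<le> B"
      using bf unfolding bounded_pos by auto
    \<comment> \<open>Affine rescaling to values in [0, 1], where the layer sums apply.\<close>
    define g where "g x = (f x + B) / (2 * B)" for x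
    have cg: "continuous_on UNIV g" unfolding g_def using B by (intro continuous_intros f) auto
    have g01: "g x \<in> {0..1}" for x using B(2)[of x] B(1) by (auto simp: g_def field_simps)
    have eq: "(\<integral>x. f x \<partial>content_measure m) = 2 * B * (\<integral>x. g x \<partial>content_measure m) - B"
      if "m \<in> tight_contents b" for m :: "'a set \<Rightarrow> real"
    proof -
      interpret tight_content b m using that b by unfold_locales
      interpret P: prob_space "content_measure m" by (rule prob_space_content_measure)
      have [measurable]: "f \<in> borel_measurable borel" using f by (rule borel_measurable_continuous_onI)
      have "integrable (content_measure m) f"
        by (rule P.integrable_const_bound[of _ B]) (use B in auto)
      then show ?thesis using B P.prob_space by (simp add: g_def field_simps)
    qed
    have "continuous_on (tight_contents b) (\<lambda>m. 2 * B * (\<integral>x. g x \<partial>content_measure m) - B)"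
      by (intro continuous_intros continuous_on_integral_content_measure[OF b cg g01])
    then have "continuous_on (tight_contents b) (\<lambda>m. \<integral>x. f x \<partial>content_measure m)"
      by (rule continuous_on_eq) (simp add: eq)
    then have "openin (top_of_set (tight_contents b)) (tight_contents b \<inter> (\<lambda>m. \<integral>x. f x \<partial>content_measure m) -` V)"
      using V by (rule continuous_openin_preimage_gen)
    also have "tight_contents b \<inter> (\<lambda>m. \<integral>x. f x \<partial>content_measure m) -` V = content_measure -` U \<inter> topspace (top_of_set (tight_contents b))"
      using in_probs by (auto simp: U)
    finally show "openin (top_of_set (tight_contents b)) (content_measure -` U \<inter> topspace (top_of_set (tight_contents b)))" .
  }
  show "content_measure ` topspace (top_of_set (tight_contents b))
    \<subseteq> \<Union> {{\<mu> \<in> borel_probs. (\<integral>x. f x \<partial>\<mu>) \<in> U} | (f :: 'a \<Rightarrow> real) U.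
        continuous_on UNIV f \<and> bounded (range f) \<and> open U}"
    using in_probs topspace_weak_topology[where 'a='a]
    unfolding weak_topology_def topology_generated_by_topspace by auto
qed

text \<open>Borel probabilities on a Euclidean space are inner and outer regular, so the
  construction gives \<mu> back. Hence all measures with tails bounded by b lie in the image of a
  compact set of contents.\<close>

lemma content_measure_measure:
  fixes \<mu> :: "'a::euclidean_space measure"
  assumes \<mu>: "\<mu> \<in> borel_probs" and tail: "\<And>k. measure \<mu> (- cball 0 (real k)) \<le> b k" and b: "b \<longlonglongrightarrow> 0"
  shows "measure \<mu> \<in> tight_contents b" "content_measure (measure \<mu>) = \<mu>"
proof -
  interpret prob_space \<mu> using \<mu> by (simp add: borel_probs_def)
  have s: "sets \<mu> = sets borel" using \<mu> by (simp add: borel_probs_def)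
  then have sp: "space \<mu> = UNIV" using sets_eq_imp_space_eq[OF s] by simp
  show *: "measure \<mu> \<in> tight_contents b"
    using tail prob_space sp s by (auto simp: tight_contents_def finite_measure_Union)
  interpret tight_content b "measure \<mu>" using * b by unfold_locales
  show "content_measure (measure \<mu>) = \<mu>"
  proof (rule measure_eqI)
    fix A assume "A \<in> sets (content_measure (measure \<mu>))"
    then have A: "A \<in> sets borel" by simp
    have "open_content (measure \<mu>) U = emeasure \<mu> U" if "open U" for U
      using that by (subst inner_regular[OF s]) (auto simp: open_content_def emeasure_eq_measure conj_commute)
    then have "content_outer (measure \<mu>) A = (INF U\<in>{U. open U \<and> A \<subseteq> U}. emeasure \<mu> U)"
      unfolding content_outer_def by (intro INF_cong) auto
    also have "\<dots> = emeasure \<mu> A"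
      using A by (subst outer_regular[OF s]) (auto simp: conj_commute)
    finally show "emeasure (content_measure (measure \<mu>)) A = emeasure \<mu> A"
      using A by (simp add: emeasure_content_measure)
  qed (simp add: s)
qed

section \<open>Compactness of sets of bounded first moment\<close>

lemma openin_weak_topology_integral:
  fixes f :: "'a::topological_space \<Rightarrow> real"
  assumes "continuous_on UNIV f" "bounded (range f)" "open U"
  shows "openin weak_topology {\<mu> \<in> borel_probs. (\<integral>x. f x \<partial>\<mu>) \<in> U}"
  unfolding weak_topology_def by (rule topology_generated_by_Basis) (use assms in blast)

text \<open>The first moment is the supremum of the integrals of its truncations
  \<open>?f k\<close>, which are bounded and continuous, hence it is lower semicontinuous.
  \<open>max R 0\<close> appears because \<open>ennreal R\<close> is 0 for negative R.\<close>

lemma closedin_first_moment_le: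
  fixes R :: real
  shows "closedin weak_topology
    {\<mu> \<in> borel_probs. (\<integral>\<^sup>+x. ennreal (norm (x::'a::euclidean_space)) \<partial>\<mu>) \<le> ennreal R}"
proof -
  let ?f = "\<lambda>k (x::'a). min (norm x) (real k)"
  have "borel_probs - {\<mu> \<in> borel_probs. (\<integral>\<^sup>+x. ennreal (norm (x::'a)) \<partial>\<mu>) \<le> ennreal R} =
    (\<Union>k. {\<mu> \<in> borel_probs. (\<integral>x. ?f k x \<partial>\<mu>) \<in> {max R 0<..}})"
  proof -
    have "(\<integral>\<^sup>+x. ennreal (norm x) \<partial>\<mu>) > ennreal R \<longleftrightarrow> (\<exists>k. (\<integral>x. ?f k x \<partial>\<mu>) > max R 0)"
      if \<mu>: "\<mu> \<in> borel_probs" for \<mu> :: "'a measure"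
    proof -
      interpret prob_space \<mu> using \<mu> by (simp add: borel_probs_def)
      have s[measurable_cong]: "sets \<mu> = sets borel" using \<mu> by (simp add: borel_probs_def)
      have "(\<integral>\<^sup>+x. ennreal (norm x) \<partial>\<mu>) = (\<integral>\<^sup>+x. (SUP k. ennreal (?f k x)) \<partial>\<mu>)"
      proof (intro nn_integral_cong antisym SUP_least)
        fix x :: 'a
        obtain k where "norm x \<le> real k" using real_arch_simple by blast
        then have "norm x = ?f k x" by simp
        then show "ennreal (norm x) \<le> (SUP k. ennreal (?f k x))"
          by (metis SUP_upper UNIV_I)
      qed (auto intro!: ennreal_leI)
      also have "\<dots> = (SUP k. \<integral>\<^sup>+x. ennreal (?f k x) \<partial>\<mu>)"
        by (intro nn_integral_monotone_convergence_SUP) (auto simp: incseq_def le_fun_def intro!: ennreal_leI min.mono)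
      also have "\<dots> = (SUP k. ennreal (\<integral>x. ?f k x \<partial>\<mu>))"
      proof (intro SUP_cong refl nn_integral_eq_integral)
        show "integrable \<mu> (?f k)" for k by (rule integrable_const_bound[of _ "real k"]) auto
      qed auto
      finally have "(\<integral>\<^sup>+x. ennreal (norm x) \<partial>\<mu>) = (SUP k. ennreal (\<integral>x. ?f k x \<partial>\<mu>))" .
      moreover have "ennreal R < ennreal t \<longleftrightarrow> max R 0 < t" if "t \<ge> 0" for t
        using that by (cases "R \<ge> 0") (auto simp: ennreal_less_iff ennreal_neg max_def)
      ultimately show ?thesis by (simp add: less_SUP_iff)
    qed
    then have iff: "\<mu> \<in> borel_probs \<Longrightarrow>
        \<not> (\<integral>\<^sup>+x. ennreal (norm x) \<partial>\<mu>) \<le> ennreal R \<longleftrightarrow> (\<exists>k. (\<integral>x. ?f k x \<partial>\<mu>) \<in> {max R 0<..})"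
      for \<mu> :: "'a measure"
      unfolding greaterThan_iff not_le .
    show ?thesis using iff by blast
  qed
  moreover have "openin weak_topology {\<mu> \<in> borel_probs. (\<integral>x. ?f k x \<partial>\<mu>) \<in> {max R 0<..}}" for k
  proof (rule openin_weak_topology_integral)
    show "bounded (range (?f k))" by (rule boundedI[of _ "real k"]) auto
  qed (auto intro!: continuous_intros)
  ultimately show ?thesis unfolding closedin_def by auto
qed

theorem compactin_first_moment_le:
  fixes R :: real
  shows "compactin weak_topology {\<mu> \<in> borel_probs. (\<integral>\<^sup>+x. ennreal (norm (x::'a::euclidean_space)) \<partial>\<mu>) \<le> ennreal R}"
    (is "compactin _ ?K")
proof -
  \<comment> \<open>Markov's inequality gives the tail R / k. The value 1 at k = 0 is needed because
    division by zero yields 0, while mass off the origin is allowed.\<close>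
  define b where "b k = (if k = 0 then 1 else max R 0 / real k)" for k :: nat
  have "(\<lambda>k. max R 0 / real k) \<longlonglongrightarrow> 0" by (rule lim_const_over_n)
  moreover have "\<forall>\<^sub>F k in sequentially. b k = max R 0 / real k"
    using eventually_gt_at_top[of 0] by eventually_elim (simp add: b_def)
  ultimately have b: "b \<longlonglongrightarrow> 0" by (simp add: tendsto_cong)
  have "compactin (top_of_set (tight_contents b)) (tight_contents b :: ('a set \<Rightarrow> real) set)"
    using compact_tight_contents by (simp add: compactin_subtopology)
  then have c: "compactin weak_topology (content_measure ` (tight_contents b :: ('a set \<Rightarrow> real) set))"
    using continuous_map_content_measure[OF b] by (rule image_compactin)
  have "?K \<subseteq> content_measure ` tight_contents b"
  proof
    fix \<mu> assume "\<mu> \<in> ?K"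
    then have \<mu>: "\<mu> \<in> borel_probs" and R: "(\<integral>\<^sup>+x. ennreal (norm x) \<partial>\<mu>) \<le> ennreal R" by auto
    interpret prob_space \<mu> using \<mu> by (simp add: borel_probs_def)
    have s[measurable_cong]: "sets \<mu> = sets borel" using \<mu> by (simp add: borel_probs_def)
    have sp: "space \<mu> = UNIV" using sets_eq_imp_space_eq[OF s] by simp
    have "measure \<mu> (- cball 0 (real k)) \<le> b k" for k
    proof (cases "k = 0")
      case False
      have "ennreal (real k * measure \<mu> (- cball 0 (real k))) = ennreal (real k) * emeasure \<mu> (- cball 0 (real k))"
        by (simp add: emeasure_eq_measure ennreal_mult)
      also have "\<dots> = (\<integral>\<^sup>+x. ennreal (real k) * indicator (- cball 0 (real k)) x \<partial>\<mu>)"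
        by (subst nn_integral_cmult_indicator) (auto simp: s)
      also have "\<dots> \<le> (\<integral>\<^sup>+x. ennreal (norm x) \<partial>\<mu>)"
        by (intro nn_integral_mono) (auto simp: indicator_def intro!: ennreal_leI)
      also have "\<dots> \<le> ennreal (max R 0)" using R by (metis ennreal_leI max.cobounded1 order_trans)
      finally have "real k * measure \<mu> (- cball 0 (real k)) \<le> max R 0"
        by (subst (asm) ennreal_le_iff) auto
      then show ?thesis using False by (simp add: b_def field_simps)
    qed (simp add: b_def)
    from content_measure_measure[OF \<mu> this b] show "\<mu> \<in> content_measure ` tight_contents b"
      by (metis imageI)
  qed
  then show ?thesis
    using closed_compactin[OF c _ closedin_first_moment_le] by blast
qed

section \<open>Entropy\<close>

lemma borel_probsD:
  assumes "\<mu> \<in> borel_probs"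
  shows "sets \<mu> = sets borel" "space \<mu> = UNIV" "prob_space \<mu>"
  using assms sets_eq_imp_space_eq[of \<mu> borel] by (auto simp: borel_probs_def)

lemma measurable_borel_probs:
  "\<mu> \<in> borel_probs \<Longrightarrow> measurable \<mu> N = measurable borel N"
  by (rule measurable_cong_sets) (simp_all add: borel_probsD)

lemma borel_probs_integrable_bounded:
  fixes f :: "'a::topological_space \<Rightarrow> real"
  assumes \<mu>: "\<mu> \<in> borel_probs" and f: "f \<in> borel_measurable borel" and b: "bounded (range f)"
  shows "integrable \<mu> f"
proof -
  interpret prob_space \<mu> using \<mu> by (rule borel_probsD)
  have [measurable_cong]: "sets \<mu> = sets borel" using \<mu> by (rule borel_probsD)
  obtain B where "\<And>x. norm (f x) \<le> B" using b unfolding bounded_pos by auto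
  then show ?thesis by (intro integrable_const_bound[of _ B]) (use f in auto)
qed

lemma integrable_exp_neg_norm:
  assumes "r > 0"
  shows "integrable lborel (\<lambda>x::'a::euclidean_space. exp (- r * norm x))"
proof (rule integrableI_bounded)
  \<comment> \<open>The absolute values of the d coordinates sum to at most d times the norm, so the
    rate r / d per coordinate bounds the integrand by a product of one-dimensional
    exponentials.\<close>
  define c where "c = r / real DIM('a)"
  have c: "c > 0" using assms by (simp add: c_def)
  have one: "(\<integral>\<^sup>+(t::real). ennreal (exp (- c * \<bar>t\<bar>)) \<partial>lborel) < \<infinity>"
  proof -
    have half: "(\<integral>\<^sup>+(t::real). ennreal (exponential_density c t) \<partial>lborel) = 1"
      using prob_space.emeasure_space_1[OF prob_space_exponential_density[OF c]]
      by (simp add: emeasure_density)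
    have "(\<integral>\<^sup>+(t::real). ennreal (exp (- c * \<bar>t\<bar>)) \<partial>lborel)
       \<le> (\<integral>\<^sup>+t. ennreal (1 / c) * (ennreal (exponential_density c t) + ennreal (exponential_density c (- t))) \<partial>lborel)"
    proof (intro nn_integral_mono)
      fix t :: real
      have "exp (- c * \<bar>t\<bar>) \<le> (1 / c) * (exponential_density c t + exponential_density c (- t))"
        using c by (auto simp: exponential_density_def abs_if field_simps)
      also have "ennreal \<dots> = ennreal (1 / c) * (ennreal (exponential_density c t) + ennreal (exponential_density c (- t)))"
        using c by (subst ennreal_mult) (auto simp: ennreal_plus)
      finally show "ennreal (exp (- c * \<bar>t\<bar>)) \<le> ennreal (1 / c) * (ennreal (exponential_density c t) + ennreal (exponential_density c (- t)))"
        by (simp add: ennreal_leI)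
    qed
    also have "\<dots> = ennreal (1 / c) * (1 + (\<integral>\<^sup>+t. ennreal (exponential_density c (- t)) \<partial>lborel))"
      by (simp add: nn_integral_cmult nn_integral_add half)
    also have "(\<integral>\<^sup>+t. ennreal (exponential_density c (- t)) \<partial>lborel) = 1"
      using nn_integral_real_affine[of "\<lambda>t. ennreal (exponential_density c t)" "-1" 0] half by simp
    finally show ?thesis by (simp add: ennreal_mult_less_top order_le_less_trans)
  qed
  have "(\<integral>\<^sup>+(x::'a). ennreal (norm (exp (- r * norm x))) \<partial>lborel) \<le>
        (\<integral>\<^sup>+(x::'a). (\<Prod>b\<in>Basis. ennreal (exp (- c * \<bar>x \<bullet> b\<bar>))) \<partial>lborel)"
  proof (intro nn_integral_mono)
    fix x :: 'a
    have "(\<Sum>b\<in>(Basis::'a set). \<bar>x \<bullet> b\<bar>) \<le> (\<Sum>b\<in>(Basis::'a set). norm x)"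
      by (intro sum_mono Basis_le_norm)
    then have "c * (\<Sum>b\<in>Basis. \<bar>x \<bullet> b\<bar>) \<le> r * norm x"
      using c assms by (simp add: c_def field_simps)
    then have "exp (- r * norm x) \<le> exp (- (\<Sum>b\<in>Basis. c * \<bar>x \<bullet> b\<bar>))"
      by (simp add: sum_distrib_left)
    also have "\<dots> = (\<Prod>b\<in>Basis. exp (- c * \<bar>x \<bullet> b\<bar>))"
      by (simp add: exp_sum flip: sum_negf)
    finally show "ennreal (norm (exp (- r * norm x))) \<le> (\<Prod>b\<in>Basis. ennreal (exp (- c * \<bar>x \<bullet> b\<bar>)))"
      by (simp add: prod_ennreal ennreal_leI)
  qed
  also have "\<dots> = (\<Prod>b\<in>(Basis::'a set). \<integral>\<^sup>+(t::real). ennreal (exp (- c * \<bar>t\<bar>)) \<partial>lborel)"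
    by (intro nn_integral_lborel_prod) auto
  also have "\<dots> < \<infinity>" using one by (simp add: power_less_top_ennreal)
  finally show "(\<integral>\<^sup>+(x::'a). ennreal (norm (exp (- r * norm x))) \<partial>lborel) < \<infinity>" .
qed simp

text \<open>The Laplace functional of the measure with density \<open>exp (- r * norm x)\<close>, a
  finite substitute for Lebesgue measure. Its logarithm is the convex dual of the entropy, up to the
  linear term \<open>r * norm x\<close>.\<close>

definition tilt :: "('a::euclidean_space \<Rightarrow> real) \<Rightarrow> real \<Rightarrow> real" where
  "tilt f r = (\<integral>x. exp (f x - r * norm x) \<partial>lborel)"

lemma integrable_tilt:
  fixes f :: "'a::euclidean_space \<Rightarrow> real"
  assumes f[measurable]: "f \<in> borel_measurable borel" and b: "bounded (range f)" and r: "r > 0"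
  shows "integrable lborel (\<lambda>x. exp (f x - r * norm x))"
proof -
  obtain B where B: "\<And>x. norm (f x) \<le> B" using b unfolding bounded_pos by auto
  have "integrable lborel (\<lambda>x::'a. exp B * exp (- r * norm x))"
    using integrable_exp_neg_norm[OF r] by (intro integrable_mult_right)
  then show ?thesis
  proof (rule Bochner_Integration.integrable_bound)
    show "AE x in lborel. norm (exp (f x - r * norm x)) \<le> norm (exp B * exp (- r * norm x))"
      using B by (auto simp: abs_le_iff simp flip: exp_add)
  qed measurable
qed

lemma tilt_pos:
  fixes f :: "'a::euclidean_space \<Rightarrow> real"
  assumes "f \<in> borel_measurable borel" and "bounded (range f)" and "r > 0"
  shows "tilt f r > 0"
proof -
  have "tilt f r \<noteq> 0"
    unfolding tilt_def
    by (subst integral_nonneg_eq_0_iff_AE)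
       (use integrable_tilt[OF assms] in \<open>auto simp: eventually_False ae_filter_eq_bot_iff\<close>)
  moreover have "tilt f r \<ge> 0" unfolding tilt_def by simp
  ultimately show ?thesis by linarith
qed

section \<open>First moments and densities\<close>

lemma probs_moment_1: "probs_moment 1 = {\<mu> \<in> borel_probs. (\<integral>\<^sup>+x. ennreal (norm (x::'a::euclidean_space)) \<partial>\<mu>) < \<infinity>}"
  by (simp add: probs_moment_def)

lemma probs_moment_subset_1:
  assumes "l \<ge> 1"
  shows "probs_moment l \<subseteq> (probs_moment 1 :: 'a::euclidean_space measure set)"
proof
  fix \<mu> :: "'a measure" assume \<mu>: "\<mu> \<in> probs_moment l"
  then have \<mu>': "\<mu> \<in> borel_probs" and fin: "(\<integral>\<^sup>+x. ennreal (norm x powr l) \<partial>\<mu>) < \<infinity>" 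
    by (auto simp: probs_moment_def)
  interpret prob_space \<mu> using \<mu>' by (rule borel_probsD)
  have [measurable_cong]: "sets \<mu> = sets borel" using \<mu>' by (rule borel_probsD)
  have "(\<integral>\<^sup>+x. ennreal (norm x) \<partial>\<mu>) \<le> (\<integral>\<^sup>+x. 1 + ennreal (norm x powr l) \<partial>\<mu>)"
  proof (intro nn_integral_mono)
    fix x :: 'a
    have "norm x \<le> 1 + norm x powr l"
    proof (cases "norm x \<le> 1")
      case False
      then have "norm x powr 1 \<le> norm x powr l" using assms by (intro powr_mono) auto
      then show ?thesis by simp
    qed (simp add: add_increasing2)
    then show "ennreal (norm x) \<le> 1 + ennreal (norm x powr l)"
      by (metis ennreal_1 ennreal_leI ennreal_plus powr_ge_zero zero_le_one)
  qed
  also have "\<dots> < \<infinity>" using fin by (simp add: nn_integral_add emeasure_space_1)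
  finally show "\<mu> \<in> probs_moment 1" using \<mu>' by (simp add: probs_moment_1)
qed

lemma integrable_norm_probs_moment_1:
  assumes "\<mu> \<in> probs_moment 1"
  shows "integrable \<mu> (norm :: 'a::euclidean_space \<Rightarrow> real)" "integrable \<mu> (\<lambda>x. x)"
proof -
  have [measurable_cong]: "sets \<mu> = sets borel" using assms by (auto simp: probs_moment_1 borel_probsD)
  show "integrable \<mu> norm" by (rule integrableI_bounded) (use assms in \<open>auto simp: probs_moment_1\<close>)
  show "integrable \<mu> (\<lambda>x. x)" by (rule integrableI_bounded) (use assms in \<open>auto simp: probs_moment_1\<close>)
qed

text \<open>The Fenchel-Young inequality for \<open>p * ln p\<close>, from
  \<open>ln t \<le> t - 1\<close> at \<open>t = exp (- 1 - y) / p\<close>. With y the norm of x it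
  bounds the negative part of the entropy by the first moment and an integrable function.\<close>

lemma neg_xlogx_le: "- (p * ln p) \<le> p * y + exp (- 1 - y)" if "p \<ge> 0" for p y :: real
proof (cases "p = 0")
  case False
  then have p: "p > 0" using that by simp
  have "ln (exp (- 1 - y) / p) \<le> exp (- 1 - y) / p - 1"
    using p by (intro ln_le_minus_one) auto
  then have "- y - ln p \<le> exp (- 1 - y) / p" using p by (simp add: ln_div)
  then have "p * (- y - ln p) \<le> p * (exp (- 1 - y) / p)" using p by (intro mult_left_mono) auto
  then show ?thesis using p by (simp add: algebra_simps)
qed simp

text \<open>A real-valued version of the density, nonnegative everywhere, so that Bochner integrals
  and pointwise inequalities with \<open>ln\<close> apply to it.\<close>

definition prob_density :: "'a::euclidean_space measure \<Rightarrow> ('a \<Rightarrow> real) \<Rightarrow> bool" where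
  "prob_density \<mu> p \<longleftrightarrow> p \<in> borel_measurable borel \<and> (\<forall>x. 0 \<le> p x) \<and>
     \<mu> = density lborel (\<lambda>x. ennreal (p x)) \<and> prob_space \<mu>"

lemma prob_densityD:
  assumes "prob_density \<mu> p"
  shows "p \<in> borel_measurable borel" "\<And>x. 0 \<le> p x" "\<mu> = density lborel (\<lambda>x. ennreal (p x))" "prob_space \<mu>"
    "integrable lborel p" "(\<integral>x. p x \<partial>lborel) = 1" "\<mu> \<in> borel_probs"
proof -
  show *: "p \<in> borel_measurable borel" "\<And>x. 0 \<le> p x" "\<mu> = density lborel (\<lambda>x. ennreal (p x))" "prob_space \<mu>"
    using assms by (auto simp: prob_density_def)
  interpret prob_space \<mu> by fact
  have 1: "(\<integral>\<^sup>+x. ennreal (p x) \<partial>lborel) = 1"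
    using emeasure_space_1 unfolding *(3) using *(1) by (simp add: emeasure_density)
  show "integrable lborel p"
    by (rule integrableI_nonneg) (use * 1 in auto)
  show "(\<integral>x. p x \<partial>lborel) = 1"
    using integral_eq_nn_integral[of p lborel] * 1 by simp
  show "\<mu> \<in> borel_probs" using * by (auto simp: borel_probs_def)
qed

lemma integrable_prob_density_iff:
  fixes f :: "'a::euclidean_space \<Rightarrow> real"
  assumes "prob_density \<mu> p" "f \<in> borel_measurable borel"
  shows "integrable \<mu> f \<longleftrightarrow> integrable lborel (\<lambda>x. p x * f x)"
    and "(\<integral>x. f x \<partial>\<mu>) = (\<integral>x. p x * f x \<partial>lborel)"
  using prob_densityD(1,2)[OF assms(1)] assms(2) unfolding prob_densityD(3)[OF assms(1)]
  by (auto simp: integrable_density integral_density)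

text \<open>The Radon-Nikodym derivative is unique almost everywhere, so any real density computes
  the entropy.\<close>

lemma entropy_fun_prob_density:
  assumes d: "prob_density \<mu> p" and \<mu>: "\<mu> \<in> probs_moment 1"
  shows "entropy_fun \<mu> = enn2ereal (\<integral>\<^sup>+x. ennreal (p x * ln (p x)) \<partial>lborel)
        - enn2ereal (\<integral>\<^sup>+x. ennreal (- (p x * ln (p x))) \<partial>lborel)"
proof -
  note [measurable] = prob_densityD(1)[OF d]
  interpret prob_space \<mu> using d by (rule prob_densityD)
  have "AE x in lborel. ennreal (p x) = RN_deriv lborel \<mu> x"
    by (rule RN_deriv_unique_sigma_finite[OF _ prob_densityD(3)[OF d, symmetric] sigma_finite_measure_axioms]) simp
  then have ae: "AE x in lborel. enn2real (RN_deriv lborel \<mu> x) = p x"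
    by eventually_elim (metis enn2real_ennreal prob_densityD(2)[OF d])
  have "\<exists>f \<in> borel_measurable lborel. density lborel f = \<mu>"
    using prob_densityD(1,3)[OF d] by (intro bexI[of _ "\<lambda>x. ennreal (p x)"]) auto
  then have "entropy_fun \<mu> =
     enn2ereal (\<integral>\<^sup>+x. ennreal (enn2real (RN_deriv lborel \<mu> x) * ln (enn2real (RN_deriv lborel \<mu> x))) \<partial>lborel)
        - enn2ereal (\<integral>\<^sup>+x. ennreal (- (enn2real (RN_deriv lborel \<mu> x) * ln (enn2real (RN_deriv lborel \<mu> x)))) \<partial>lborel)"
    using \<mu> by (simp add: entropy_fun_def Let_def)
  also have "(\<integral>\<^sup>+x. ennreal (enn2real (RN_deriv lborel \<mu> x) * ln (enn2real (RN_deriv lborel \<mu> x))) \<partial>lborel) =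
      (\<integral>\<^sup>+x. ennreal (p x * ln (p x)) \<partial>lborel)"
    by (intro nn_integral_cong_AE) (use ae in eventually_elim, simp)
  also have "(\<integral>\<^sup>+x. ennreal (- (enn2real (RN_deriv lborel \<mu> x) * ln (enn2real (RN_deriv lborel \<mu> x)))) \<partial>lborel) =
      (\<integral>\<^sup>+x. ennreal (- (p x * ln (p x))) \<partial>lborel)"
    by (intro nn_integral_cong_AE) (use ae in eventually_elim, simp)
  finally show ?thesis .
qed

lemma prob_density_exists:
  assumes \<mu>: "\<mu> \<in> borel_probs" and f: "f \<in> borel_measurable lborel" "density lborel f = \<mu>"
  obtains p where "prob_density \<mu> p"
proof
  interpret prob_space \<mu> using \<mu> by (rule borel_probsD)
  have fin: "AE x in lborel. f x \<noteq> \<infinity>"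
  proof (rule nn_integral_PInf_AE)
    show "(\<integral>\<^sup>+x. f x \<partial>lborel) \<noteq> \<infinity>"
      using emeasure_space_1 f(1) unfolding f(2)[symmetric] by (simp add: emeasure_density)
  qed (use f in auto)
  have "density lborel f = density lborel (\<lambda>x. ennreal (enn2real (f x)))"
  proof (rule density_cong)
    show "AE x in lborel. f x = ennreal (enn2real (f x))"
      using fin by eventually_elim (simp add: less_top)
  qed (use f in auto)
  then show "prob_density \<mu> (\<lambda>x. enn2real (f x))"
    using f borel_probsD[OF \<mu>] by (simp add: prob_density_def)
qed

lemma entropy_fun_no_density:
  "\<lbrakk>\<mu> \<notin> probs_moment 1 \<or> (\<nexists>p. prob_density \<mu> p)\<rbrakk> \<Longrightarrow> entropy_fun \<mu> = \<infinity>"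
proof (rule ccontr)
  assume *: "\<mu> \<notin> probs_moment 1 \<or> (\<nexists>p. prob_density \<mu> p)" and "entropy_fun \<mu> \<noteq> \<infinity>"
  then obtain f where f: "f \<in> borel_measurable lborel" "density lborel f = \<mu>" and \<mu>: "\<mu> \<in> probs_moment 1"
    by (auto simp: entropy_fun_def split: if_splits)
  then obtain p where "prob_density \<mu> p" using prob_density_exists[OF _ f] by (auto simp: probs_moment_1)
  with * \<mu> show False by blast
qed

lemma entropy_neg_part_finite:
  assumes d: "prob_density \<mu> p" and \<mu>: "\<mu> \<in> probs_moment 1"
  shows "(\<integral>\<^sup>+x. ennreal (- (p x * ln (p x))) \<partial>lborel) < \<infinity>"
proof -
  note [measurable] = prob_densityD(1)[OF d]
  have "(\<integral>\<^sup>+x. ennreal (- (p x * ln (p x))) \<partial>lborel) \<le>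
    (\<integral>\<^sup>+x. ennreal (p x) * ennreal (norm x) + ennreal (exp (- 1) * exp (- 1 * norm x)) \<partial>lborel)"
  proof (intro nn_integral_mono)
    fix x
    have "- (p x * ln (p x)) \<le> p x * norm x + exp (- 1) * exp (- 1 * norm x)"
      using neg_xlogx_le[OF prob_densityD(2)[OF d], of x "norm x"] by (simp add: exp_diff exp_minus field_simps)
    then show "ennreal (- (p x * ln (p x))) \<le> ennreal (p x) * ennreal (norm x) + ennreal (exp (- 1) * exp (- 1 * norm x))"
      using prob_densityD(2)[OF d] by (simp add: ennreal_leI flip: ennreal_mult ennreal_plus)
  qed
  also have "\<dots> = (\<integral>\<^sup>+x. ennreal (norm x) \<partial>\<mu>) + (\<integral>\<^sup>+(x::'a). ennreal (exp (- 1) * exp (- 1 * norm x)) \<partial>lborel)"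
    unfolding prob_densityD(3)[OF d] by (simp add: nn_integral_add nn_integral_density)
  also have "\<dots> < \<infinity>"
  proof -
    have "integrable lborel (\<lambda>x::'a. exp (- 1) * exp (- 1 * norm x))"
      using integrable_exp_neg_norm[of 1, where 'a='a] by (intro integrable_mult_right) simp
    then have "(\<integral>\<^sup>+(x::'a). ennreal (norm (exp (- 1) * exp (- 1 * norm x))) \<partial>lborel) < \<infinity>"
      unfolding integrable_iff_bounded by blast
    then show ?thesis using \<mu> by (simp add: probs_moment_1)
  qed
  finally show ?thesis .
qed

lemma entropy_fun_not_MInfty: "entropy_fun \<mu> \<noteq> - \<infinity>"
proof (cases "\<mu> \<notin> probs_moment 1 \<or> (\<nexists>p. prob_density \<mu> p)")
  case False
  then obtain p where p: "prob_density \<mu> p" "\<mu> \<in> probs_moment 1" by blast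
  show ?thesis
    using entropy_neg_part_finite[OF p] unfolding entropy_fun_prob_density[OF p]
    by (cases "\<integral>\<^sup>+x. ennreal (- (p x * ln (p x))) \<partial>lborel"; cases "\<integral>\<^sup>+x. ennreal (p x * ln (p x)) \<partial>lborel")
       (auto simp: enn2ereal_ennreal)
qed (simp add: entropy_fun_no_density)

lemma entropy_fun_finiteE:
  assumes "entropy_fun \<mu> < \<infinity>"
  obtains p where "\<mu> \<in> probs_moment 1" "prob_density \<mu> p" "integrable lborel (\<lambda>x. p x * ln (p x))"
    "entropy_fun \<mu> = ereal (\<integral>x. p x * ln (p x) \<partial>lborel)"
proof -
  obtain p where p: "prob_density \<mu> p" "\<mu> \<in> probs_moment 1"
    using entropy_fun_no_density[of \<mu>] assms by auto
  note [measurable] = prob_densityD(1)[OF p(1)]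
  have N: "(\<integral>\<^sup>+x. ennreal (- (p x * ln (p x))) \<partial>lborel) < \<infinity>" by (rule entropy_neg_part_finite[OF p])
  have P: "(\<integral>\<^sup>+x. ennreal (p x * ln (p x)) \<partial>lborel) < \<infinity>"
    using assms N unfolding entropy_fun_prob_density[OF p]
    by (cases "\<integral>\<^sup>+x. ennreal (- (p x * ln (p x))) \<partial>lborel"; cases "\<integral>\<^sup>+x. ennreal (p x * ln (p x)) \<partial>lborel")
       (auto simp: enn2ereal_ennreal)
  have int: "integrable lborel (\<lambda>x. p x * ln (p x))"
    unfolding real_integrable_def using N P by auto
  have "entropy_fun \<mu> = ereal (\<integral>x. p x * ln (p x) \<partial>lborel)"
    unfolding entropy_fun_prob_density[OF p] real_lebesgue_integral_def[OF int] using N P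
    by (cases "\<integral>\<^sup>+x. ennreal (- (p x * ln (p x))) \<partial>lborel"; cases "\<integral>\<^sup>+x. ennreal (p x * ln (p x)) \<partial>lborel")
       (auto simp: enn2ereal_ennreal)
  with int p show thesis using that by blast
qed

text \<open>Nonnegativity of the relative entropy of \<nu> with respect to the probability density
  \<open>exp (f x - r * norm x) / A\<close>, where A is the normalising constant
  \<open>tilt f r\<close>.\<close>

theorem gibbs_variational_le:
  fixes f :: "'a::euclidean_space \<Rightarrow> real"
  assumes \<nu>: "\<nu> \<in> probs_moment 1" and f[measurable]: "f \<in> borel_measurable borel"
    and b: "bounded (range f)" and r: "r > 0"
  shows "ereal ((\<integral>x. f x \<partial>\<nu>) - r * (\<integral>x. norm x \<partial>\<nu>) - ln (tilt f r)) \<le> entropy_fun \<nu>"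
proof (cases "entropy_fun \<nu> < \<infinity>")
  case True
  then obtain p where d: "prob_density \<nu> p" and int: "integrable lborel (\<lambda>x. p x * ln (p x))"
    and S: "entropy_fun \<nu> = ereal (\<integral>x. p x * ln (p x) \<partial>lborel)"
    by (rule entropy_fun_finiteE)
  note [measurable] = prob_densityD(1)[OF d]
  interpret prob_space \<nu> using d by (rule prob_densityD)
  have [measurable_cong]: "sets \<nu> = sets borel" using \<nu> by (simp add: probs_moment_1 borel_probsD)
  define A where "A = tilt f r"
  have A: "A > 0" unfolding A_def using f b r by (rule tilt_pos)
  have intf: "integrable \<nu> f" using \<nu> f b by (intro borel_probs_integrable_bounded) (auto simp: probs_moment_1)
  have intn: "integrable \<nu> norm" using \<nu> by (rule integrable_norm_probs_moment_1)
  have int1: "integrable \<nu> (\<lambda>x. f x - r * norm x - ln A)"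
    using intf intn by (intro Bochner_Integration.integrable_diff) auto
  \<comment> \<open>\<open>ln t \<le> t - 1\<close> at the ratio of the two densities, multiplied by
    p. After integration the last two terms give A / A - 1 = 0.\<close>
  have pw: "p x * (f x - r * norm x - ln A) \<le> p x * ln (p x) + exp (f x - r * norm x) / A - p x" for x
  proof (cases "p x = 0")
    case False
    then have p: "p x > 0" using prob_densityD(2)[OF d, of x] by simp
    have "ln (exp (f x - r * norm x) / A / p x) \<le> exp (f x - r * norm x) / A / p x - 1"
      using p A by (intro ln_le_minus_one) auto
    then have "f x - r * norm x - ln A - ln (p x) \<le> exp (f x - r * norm x) / A / p x - 1"
      using p A by (simp add: ln_div ln_mult)
    then have "p x * (f x - r * norm x - ln A - ln (p x)) \<le> p x * (exp (f x - r * norm x) / A / p x - 1)"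
      using p by (intro mult_left_mono) auto
    then show ?thesis using p by (simp add: algebra_simps)
  qed (use A in simp)
  have "(\<integral>x. f x \<partial>\<nu>) - r * (\<integral>x. norm x \<partial>\<nu>) - ln A = (\<integral>x. f x - r * norm x - ln A \<partial>\<nu>)"
    using intf intn by (simp add: prob_space)
  also have "\<dots> = (\<integral>x. p x * (f x - r * norm x - ln A) \<partial>lborel)"
    by (rule integrable_prob_density_iff[OF d]) measurable
  also have "\<dots> \<le> (\<integral>x. p x * ln (p x) + exp (f x - r * norm x) / A - p x \<partial>lborel)"
  proof (rule integral_mono[OF _ _ pw])
    show "integrable lborel (\<lambda>x. p x * (f x - r * norm x - ln A))"
      using int1 by (subst (asm) integrable_prob_density_iff[OF d]) auto
    show "integrable lborel (\<lambda>x. p x * ln (p x) + exp (f x - r * norm x) / A - p x)"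
      using int integrable_tilt[OF f b r] prob_densityD(5)[OF d]
      by (intro Bochner_Integration.integrable_diff Bochner_Integration.integrable_add integrable_divide)
  qed
  also have "\<dots> = (\<integral>x. p x * ln (p x) \<partial>lborel) + A / A - 1"
    using int integrable_tilt[OF f b r] prob_densityD(5,6)[OF d]
    by (simp add: A_def tilt_def)
  finally show ?thesis using A by (simp add: S A_def)
qed simp

section \<open>Behaviour under translation\<close>

lemma sets_translate [simp, measurable_cong]: "sets (translate y \<mu>) = sets borel"
  and space_translate [simp]: "space (translate y \<mu>) = UNIV"
  by (simp_all add: translate_def)

lemma translate_in_borel_probs:
  assumes "\<mu> \<in> borel_probs"
  shows "translate y \<mu> \<in> borel_probs"
proof -
  have "prob_space (translate y \<mu>)"
    unfolding translate_def
    by (rule prob_space.prob_space_distr[OF borel_probsD(3)[OF assms]])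
       (simp add: measurable_borel_probs[OF assms])
  then show ?thesis by (simp add: borel_probs_def)
qed

lemma nn_integral_translate:
  assumes "\<mu> \<in> borel_probs" "f \<in> borel_measurable borel"
  shows "(\<integral>\<^sup>+x. f x \<partial>translate y \<mu>) = (\<integral>\<^sup>+x. f (x + y) \<partial>\<mu>)"
  unfolding translate_def
  by (rule nn_integral_distr) (simp_all add: measurable_borel_probs[OF assms(1)] assms(2))

lemma integral_translate:
  fixes f :: "'a::euclidean_space \<Rightarrow> 'b::{banach, second_countable_topology}"
  assumes "\<mu> \<in> borel_probs" "f \<in> borel_measurable borel"
  shows "(\<integral>x. f x \<partial>translate y \<mu>) = (\<integral>x. f (x + y) \<partial>\<mu>)"
  unfolding translate_def
  by (rule integral_distr) (simp_all add: measurable_borel_probs[OF assms(1)] assms(2))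

lemma translate_translate:
  assumes "\<mu> \<in> borel_probs"
  shows "translate y (translate z \<mu>) = translate (z + y) \<mu>"
  unfolding translate_def
  by (subst distr_distr) (simp_all add: measurable_borel_probs[OF assms] comp_def add.assoc)

lemma translate_0 [simp]:
  assumes "\<mu> \<in> borel_probs"
  shows "translate 0 \<mu> = \<mu>"
  unfolding translate_def using borel_probsD(1)[OF assms]
  by (simp add: distr_id2)

lemma translate_probs_moment_1: 
  assumes "\<mu> \<in> probs_moment 1"
  shows "translate y \<mu> \<in> probs_moment 1"
proof -
  have \<mu>: "\<mu> \<in> borel_probs" using assms by (simp add: probs_moment_1)
  interpret prob_space \<mu> using \<mu> by (rule borel_probsD)
  have [measurable_cong]: "sets \<mu> = sets borel" using \<mu> by (rule borel_probsD)
  have "(\<integral>\<^sup>+x. ennreal (norm x) \<partial>translate y \<mu>) = (\<integral>\<^sup>+x. ennreal (norm (x + y)) \<partial>\<mu>)"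
    using \<mu> by (subst nn_integral_translate) auto
  also have "\<dots> \<le> (\<integral>\<^sup>+x. ennreal (norm x) + ennreal (norm y) \<partial>\<mu>)"
    by (intro nn_integral_mono) (simp add: ennreal_leI norm_triangle_ineq flip: ennreal_plus)
  also have "\<dots> < \<infinity>" using assms by (simp add: nn_integral_add emeasure_space_1 probs_moment_1)
  finally show ?thesis using \<mu> by (simp add: probs_moment_1 translate_in_borel_probs)
qed

lemma translate_prob_density:
  assumes d: "prob_density \<mu> p"
  shows "prob_density (translate y \<mu>) (\<lambda>x. p (x - y))"
proof -
  note [measurable] = prob_densityD(1)[OF d]
  have \<mu>: "\<mu> \<in> borel_probs" using d by (rule prob_densityD)
  have "translate y \<mu> = density lborel (\<lambda>x. ennreal (p (x - y)))"
  proof (rule measure_eqI)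
    fix A assume "A \<in> sets (translate y \<mu>)"
    then have [measurable]: "A \<in> sets borel" by simp
    have "emeasure (translate y \<mu>) A = (\<integral>\<^sup>+x. indicator A (x + y) \<partial>\<mu>)"
      using nn_integral_translate[OF \<mu>, of "indicator A" y] by simp
    also have "\<dots> = (\<integral>\<^sup>+x. ennreal (p x) * indicator A (x + y) \<partial>lborel)"
      unfolding prob_densityD(3)[OF d] by (subst nn_integral_density) auto
    also have "\<dots> = (\<integral>\<^sup>+x. ennreal (p (x - y)) * indicator A x \<partial>distr lborel borel ((+) y))"
      by (subst nn_integral_distr) (auto simp: add.commute)
    also have "\<dots> = (\<integral>\<^sup>+x. ennreal (p (x - y)) * indicator A x \<partial>lborel)"
      by (simp add: lborel_distr_plus)
    finally show "emeasure (translate y \<mu>) A = emeasure (density lborel (\<lambda>x. ennreal (p (x - y)))) A"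
      by (simp add: emeasure_density)
  qed simp
  then show ?thesis
    using d translate_in_borel_probs[OF \<mu>, of y] by (auto simp: prob_density_def borel_probsD)
qed

lemma nn_integral_lborel_shift:
  fixes f :: "'a::euclidean_space \<Rightarrow> ennreal"
  assumes [measurable]: "f \<in> borel_measurable borel"
  shows "(\<integral>\<^sup>+x. f (x + y) \<partial>lborel) = (\<integral>\<^sup>+x. f x \<partial>lborel)"
proof -
  have "(\<integral>\<^sup>+x. f x \<partial>lborel) = (\<integral>\<^sup>+x. f x \<partial>distr lborel borel ((+) y))" by (simp add: lborel_distr_plus)
  also have "\<dots> = (\<integral>\<^sup>+x. f (x + y) \<partial>lborel)" by (subst nn_integral_distr) (auto simp: add.commute)
  finally show ?thesis by simp
qed

lemma entropy_fun_translate: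
  assumes \<mu>: "\<mu> \<in> borel_probs"
  shows "entropy_fun (translate y \<mu>) = entropy_fun \<mu>"
proof (cases "\<mu> \<in> probs_moment 1 \<and> (\<exists>p. prob_density \<mu> p)")
  case True
  then obtain p where p: "prob_density \<mu> p" and \<mu>1: "\<mu> \<in> probs_moment 1" by blast
  note [measurable] = prob_densityD(1)[OF p]
  show ?thesis
    unfolding entropy_fun_prob_density[OF p \<mu>1]
      entropy_fun_prob_density[OF translate_prob_density[OF p] translate_probs_moment_1[OF \<mu>1]]
    using nn_integral_lborel_shift[of "\<lambda>x. ennreal (p x * ln (p x))" "- y"]
      nn_integral_lborel_shift[of "\<lambda>x. ennreal (- (p x * ln (p x)))" "- y"] by simp
next
  case False
  \<comment> \<open>A first moment and a density of the translate would pass back to \<mu>, so both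
    entropies are infinite.\<close>
  have tt: "translate (- y) (translate y \<mu>) = \<mu>" using \<mu> by (simp add: translate_translate)
  then have "\<not> (translate y \<mu> \<in> probs_moment 1 \<and> (\<exists>p. prob_density (translate y \<mu>) p))"
    using False translate_probs_moment_1[of "translate y \<mu>" "- y"] translate_prob_density[of "translate y \<mu>" _ "- y"]
    by auto
  with False show ?thesis by (metis entropy_fun_no_density)
qed

text \<open>The good test functions for the entropy are only measurable, while the weak topology
  sees continuous ones. Because \<mu> has a density, convergence Lebesgue-almost everywhere is also
  convergence \<mu>-almost everywhere, so one sequence serves both integrals.\<close>

lemma bounded_measurable_approx:
  fixes u :: "'a::euclidean_space \<Rightarrow> real"
  assumes d: "prob_density \<mu> p" and u[measurable]: "u \<in> borel_measurable borel"
    and B: "\<And>x. \<bar>u x\<bar> \<le> B" and r: "r > 0"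
  obtains g where "\<And>n::nat. continuous_on UNIV (g n)" "\<And>n. bounded (range (g n))"
    "(\<lambda>n. \<integral>x. g n x \<partial>\<mu>) \<longlonglongrightarrow> (\<integral>x. u x \<partial>\<mu>)" "(\<lambda>n. tilt (g n) r) \<longlonglongrightarrow> tilt u r"
proof -
  note [measurable] = prob_densityD(1)[OF d]
  interpret prob_space \<mu> using d by (rule prob_densityD)
  have [measurable_cong]: "sets \<mu> = sets borel" using prob_densityD(7)[OF d] by (rule borel_probsD)
  have "u \<in> borel_measurable lebesgue" by (rule measurable_completion) simp
  from lebesgue_measurable_imp_measurable_on[OF this, of UNIV]
  obtain N h where N: "negligible N" and h: "\<And>n::nat. continuous_on UNIV (h n)"
    and lim: "\<And>x. x \<notin> N \<Longrightarrow> (\<lambda>n. h n x) \<longlonglongrightarrow> u x"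
    unfolding measurable_on_def by auto
  \<comment> \<open>Clamping gives all members of the sequence the bound B, as dominated convergence
    requires, and leaves the limit u unchanged.\<close>
  define g where "g n x = max (- B) (min B (h n x))" for n x
  have cont: "continuous_on UNIV (g n)" for n unfolding g_def by (intro continuous_intros h)
  have B0: "B \<ge> 0" using B[of 0] by linarith
  have gB: "\<bar>g n x\<bar> \<le> B" for n x using B0 by (auto simp: g_def)
  have [measurable]: "g n \<in> borel_measurable borel" for n using cont by (rule borel_measurable_continuous_onI)
  have bdd: "bounded (range (g n))" for n by (rule boundedI[of _ B]) (use gB in auto)
  have limg: "(\<lambda>n. g n x) \<longlonglongrightarrow> u x" if "x \<notin> N" for x
  proof -
    have "(\<lambda>n. max (- B) (min B (h n x))) \<longlonglongrightarrow> max (- B) (min B (u x))"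
      by (intro tendsto_intros lim that)
    moreover have "max (- B) (min B (u x)) = u x" using B[of x] by auto
    ultimately show ?thesis by (simp add: g_def)
  qed
  have "AE x in lebesgue. x \<notin> N"
    using N by (intro AE_not_in) (simp add: negligible_iff_null_sets)
  then have ae: "AE x in lborel. x \<notin> N" by (simp add: AE_completion_iff)
  then have ae\<mu>: "AE x in \<mu>. x \<notin> N"
    unfolding prob_densityD(3)[OF d] by (subst AE_density) auto
  have 1: "(\<lambda>n. \<integral>x. g n x \<partial>\<mu>) \<longlonglongrightarrow> (\<integral>x. u x \<partial>\<mu>)"
  proof (rule integral_dominated_convergence[where w="\<lambda>_. B"])
    show "AE x in \<mu>. (\<lambda>n. g n x) \<longlonglongrightarrow> u x" using ae\<mu> by eventually_elim (rule limg)
  qed (use gB in auto)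
  have 2: "(\<lambda>n. tilt (g n) r) \<longlonglongrightarrow> tilt u r"
    unfolding tilt_def
  proof (rule integral_dominated_convergence[where w="\<lambda>x. exp B * exp (- r * norm x)"])
    show "AE x in lborel. (\<lambda>n. exp (g n x - r * norm x)) \<longlonglongrightarrow> exp (u x - r * norm x)"
      using ae by eventually_elim (intro tendsto_intros limg)
    show "integrable lborel (\<lambda>x::'a. exp B * exp (- r * norm x))"
      using integrable_exp_neg_norm[OF r] by (intro integrable_mult_right)
    show "AE x in lborel. norm (exp (g n x - r * norm x)) \<le> exp B * exp (- r * norm x)" for n
      using gB[of n] by (auto simp: abs_le_iff simp flip: exp_add)
  qed measurable
  show thesis using that[OF cont bdd 1 2] .
qed

text \<open>u is \<open>ln p\<close> truncated to [-k, k]. The three bounds make it a bounded test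
  function, control its \<open>tilt\<close>, and dominate the negative part of \<open>p * u\<close>
  by that of \<open>p * ln p\<close>.\<close>

lemma ln_clamp_bounds:
  fixes p k :: real
  assumes "k \<ge> 0" "p \<ge> 0"
  defines "u \<equiv> ln (max (exp (- k)) (min (exp k) p))"
  shows "\<bar>u\<bar> \<le> k" "exp u \<le> p + exp (- k)" "- (p * u) \<le> max 0 (- (p * ln p))"
proof -
  have pos: "max (exp (- k)) (min (exp k) p) > 0" by (simp add: less_max_iff_disj)
  have "u \<le> ln (exp k)" unfolding u_def using pos assms(1) by (subst ln_le_cancel_iff) auto
  moreover have "ln (exp (- k)) \<le> u" unfolding u_def using pos by (subst ln_le_cancel_iff) auto
  ultimately show "\<bar>u\<bar> \<le> k" by simp
  show "exp u \<le> p + exp (- k)"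
    using pos assms by (auto simp: u_def max_def min_def intro: add_increasing2)
  show "- (p * u) \<le> max 0 (- (p * ln p))"
  proof (cases "p = 0 \<or> p \<ge> 1")
    case True
    then have "p * u \<ge> 0"
      using assms(1) by (cases "p = 0") (auto simp: u_def le_max_iff_disj intro!: mult_nonneg_nonneg ln_ge_zero)
    then show ?thesis by simp
  next
    case False
    then have p: "0 < p" "p < 1" using assms(2) by auto
    then have "ln p \<le> u" unfolding u_def using assms(1) pos
      by (subst ln_le_cancel_iff) (auto simp: le_max_iff_disj intro: order_trans[of p 1])
    then have "p * ln p \<le> p * u" using p by (intro mult_left_mono) auto
    then show ?thesis by simp
  qed
qed

text \<open>\<open>ennreal\<close> discards negative values, so only p > 1 contributes, and there u
  is \<open>min k (ln p)\<close>, which increases with k.\<close>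

lemma SUP_xln_clamp:
  fixes p :: real
  assumes p: "p \<ge> 0"
  defines "u \<equiv> \<lambda>k::nat. ln (max (exp (- real k)) (min (exp (real k)) p))"
  shows "(SUP k. ennreal (p * u k)) = ennreal (p * ln p)" "incseq (\<lambda>k. ennreal (p * u k))"
proof -
  have small: "p * u k \<le> 0" if "p \<le> 1" for k
  proof -
    have "max (exp (- real k)) (min (exp (real k)) p) \<le> 1" using that by (auto simp: min_le_iff_disj)
    then have "u k \<le> 0" unfolding u_def by (intro ln_le_zero_iff[THEN iffD2]) (auto simp: less_max_iff_disj)
    then show ?thesis using p by (simp add: mult_nonneg_nonpos)
  qed
  have large: "u k = min (real k) (ln p)" if "p > 1" for k
  proof -
    have "exp (- real k) \<le> min (exp (real k)) p"
      using that by (auto intro: order_trans[of _ 1])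
    then have "u k = ln (min (exp (real k)) p)" by (simp add: u_def max_def)
    also have "\<dots> = min (real k) (ln p)"
      using that by (auto simp: min_def ln_ge_iff)
    finally show ?thesis .
  qed
  show "incseq (\<lambda>k. ennreal (p * u k))"
  proof (cases "p > 1")
    case True
    then show ?thesis by (auto simp: incseq_def large intro!: ennreal_leI mult_left_mono)
  next
    case False
    then show ?thesis using small by (simp add: incseq_def ennreal_neg)
  qed
  show "(SUP k. ennreal (p * u k)) = ennreal (p * ln p)"
  proof (cases "p > 1")
    case True
    obtain k where k: "ln p \<le> real k" using real_arch_simple by blast
    have "(SUP k. ennreal (p * u k)) \<le> ennreal (p * ln p)"
      using True by (intro SUP_least) (auto simp: large intro!: ennreal_leI)
    moreover have "ennreal (p * ln p) = ennreal (p * u k)" using k True by (simp add: large)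
    then have "ennreal (p * ln p) \<le> (SUP k. ennreal (p * u k))" by (metis SUP_upper UNIV_I)
    ultimately show ?thesis by (rule antisym)
  next
    case False
    then have "p * ln p \<le> 0" using p by (cases "p = 0") (auto intro!: mult_nonneg_nonpos)
    then show ?thesis using small False by (simp add: ennreal_neg)
  qed
qed

text \<open>The test function \<open>ln p\<close> gives at least the entropy: its
  \<open>tilt\<close> is at most the total mass of p, because
  \<open>exp (- r * norm x) \<le> 1\<close>, so the logarithm is at most 0. Truncation and
  continuous approximation make it admissible.\<close>

lemma entropy_dual_ac:
  fixes \<mu> :: "'a::euclidean_space measure"
  assumes d: "prob_density \<mu> p" and \<mu>: "\<mu> \<in> probs_moment 1" and a: "ereal a < entropy_fun \<mu>" and r: "r > 0"
  obtains f where "continuous_on UNIV f" "bounded (range f)" "a < (\<integral>x. f x \<partial>\<mu>) - ln (tilt f r)"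
proof -
  note [measurable] = prob_densityD(1)[OF d]
  note p0 = prob_densityD(2)[OF d]
  interpret prob_space \<mu> using d by (rule prob_densityD)
  define u where "u k x = ln (max (exp (- real k)) (min (exp (real k)) (p x)))" for k :: nat and x
  have [measurable]: "u k \<in> borel_measurable borel" for k unfolding u_def by measurable
  have ub: "\<bar>u k x\<bar> \<le> real k" and eu: "exp (u k x) \<le> p x + exp (- real k)"
    and nu: "- (p x * u k x) \<le> max 0 (- (p x * ln (p x)))" for k x
    using ln_clamp_bounds[OF _ p0, of "real k" x] by (simp_all add: u_def)
  have bu: "bounded (range (u k))" for k by (rule boundedI[of _ "real k"]) (use ub in auto)
  define P where "P = (\<integral>\<^sup>+x. ennreal (p x * ln (p x)) \<partial>lborel)"
  obtain n where n: "(\<integral>\<^sup>+x. ennreal (- (p x * ln (p x))) \<partial>lborel) = ennreal n" "n \<ge> 0"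
    using entropy_neg_part_finite[OF d \<mu>] by (cases "\<integral>\<^sup>+x. ennreal (- (p x * ln (p x))) \<partial>lborel") auto
  have "ereal a < enn2ereal P - ereal n"
    using a n by (simp add: entropy_fun_prob_density[OF d \<mu>] P_def enn2ereal_ennreal)
  then have "ereal (a + n) < enn2ereal P"
    by (cases P) (auto simp: enn2ereal_ennreal)
  \<comment> \<open>A strict gap between a and a', which later absorbs the error of the
    truncation.\<close>
  then obtain a' where a': "a < a'" "ereal (a' + n) < enn2ereal P"
  proof (cases P)
    case (real q)
    then have "a + n < q" using \<open>ereal (a + n) < enn2ereal P\<close> by (simp add: enn2ereal_ennreal)
    then show thesis using that[of "(a + q - n) / 2"] real by (simp add: enn2ereal_ennreal field_simps)
  next
    case top
    then show thesis using that[of "a + 1"] by simp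
  qed
  have SUPu: "(SUP k. \<integral>\<^sup>+x. ennreal (p x * u k x) \<partial>lborel) = P"
  proof -
    have "P = (\<integral>\<^sup>+x. (SUP k. ennreal (p x * u k x)) \<partial>lborel)"
      unfolding P_def u_def by (intro nn_integral_cong SUP_xln_clamp(1)[symmetric] p0)
    also have "\<dots> = (SUP k. \<integral>\<^sup>+x. ennreal (p x * u k x) \<partial>lborel)"
      using SUP_xln_clamp(2)[OF p0]
      by (intro nn_integral_monotone_convergence_SUP) (auto simp: incseq_def le_fun_def u_def)
    finally show ?thesis by simp
  qed
  \<comment> \<open>The positive parts increase to P by monotone convergence. A negative bound is
    treated apart because \<open>ennreal\<close> would turn it into 0.\<close>
  have ev1: "\<forall>\<^sub>F k in sequentially. ereal (a' + n) \<le> enn2ereal (\<integral>\<^sup>+x. ennreal (p x * u k x) \<partial>lborel)"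
  proof (cases "a' + n < 0")
    case True
    then have "ereal (a' + n) \<le> 0" by simp
    also have "0 \<le> enn2ereal t" for t by simp
    finally show ?thesis by simp
  next
    case False
    then have "ennreal (a' + n) < P" using a'(2) by (simp add: ennreal_less_iff less_ennreal.rep_eq enn2ereal_ennreal)
    then obtain k0 where k0: "ennreal (a' + n) < (\<integral>\<^sup>+x. ennreal (p x * u k0 x) \<partial>lborel)"
      unfolding SUPu[symmetric] less_SUP_iff by auto
    have "ereal (a' + n) \<le> enn2ereal (\<integral>\<^sup>+x. ennreal (p x * u k x) \<partial>lborel)" if "k \<ge> k0" for k
    proof -
      have "(\<integral>\<^sup>+x. ennreal (p x * u k0 x) \<partial>lborel) \<le> (\<integral>\<^sup>+x. ennreal (p x * u k x) \<partial>lborel)"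
        using SUP_xln_clamp(2)[OF p0] that by (intro nn_integral_mono) (auto simp: incseq_def u_def)
      then have "ennreal (a' + n) \<le> (\<integral>\<^sup>+x. ennreal (p x * u k x) \<partial>lborel)" using k0 by (simp add: order_less_imp_le order_trans)
      then show ?thesis using False by (simp add: less_eq_ennreal.rep_eq enn2ereal_ennreal)
    qed
    then show ?thesis by (auto simp: eventually_sequentially)
  qed
  define Z where "Z = tilt (\<lambda>_::'a. 0) r"
  have Z: "Z > 0" unfolding Z_def using r by (intro tilt_pos) auto
  have "(\<lambda>k. exp (- real k) * Z) \<longlonglongrightarrow> 0 * Z"
    by (intro tendsto_mult_right) (rule filterlim_compose[OF exp_at_bot], 
        rule filterlim_compose[OF filterlim_uminus_at_bot_at_top filterlim_real_sequentially])
  then have "\<forall>\<^sub>F k in sequentially. exp (- real k) * Z < (a' - a) / 2"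
    using a'(1) by (intro order_tendstoD(2)) auto
  then obtain k where k1: "ereal (a' + n) \<le> enn2ereal (\<integral>\<^sup>+x. ennreal (p x * u k x) \<partial>lborel)"
    and k2: "exp (- real k) * Z < (a' - a) / 2"
    using eventually_happens'[OF sequentially_bot eventually_conj[OF ev1]] by blast
  have intpu: "integrable lborel (\<lambda>x. p x * u k x)"
    using borel_probs_integrable_bounded[OF prob_densityD(7)[OF d] _ bu]
    by (subst (asm) integrable_prob_density_iff[OF d]) auto
  have int_u: "(\<integral>x. u k x \<partial>\<mu>) \<ge> a'"
  proof -
    have fin: "(\<integral>\<^sup>+x. ennreal (p x * u k x) \<partial>lborel) \<noteq> \<infinity>" "(\<integral>\<^sup>+x. ennreal (- (p x * u k x)) \<partial>lborel) \<noteq> \<infinity>"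
      using intpu unfolding real_integrable_def by auto
    have "(\<integral>\<^sup>+x. ennreal (- (p x * u k x)) \<partial>lborel) \<le> (\<integral>\<^sup>+x. ennreal (- (p x * ln (p x))) \<partial>lborel)"
    proof (intro nn_integral_mono)
      fix x
      have "ennreal (- (p x * u k x)) \<le> ennreal (max 0 (- (p x * ln (p x))))" using nu by (rule ennreal_leI)
      also have "\<dots> = ennreal (- (p x * ln (p x)))" by (cases "p x * ln (p x) \<ge> 0") (auto simp: ennreal_neg)
      finally show "ennreal (- (p x * u k x)) \<le> ennreal (- (p x * ln (p x)))" .
    qed
    then have "enn2real (\<integral>\<^sup>+x. ennreal (- (p x * u k x)) \<partial>lborel) \<le> n"
      using n by (simp add: enn2real_leI)
    moreover have "a' + n \<le> enn2real (\<integral>\<^sup>+x. ennreal (p x * u k x) \<partial>lborel)"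
      using k1 fin(1) by (cases "\<integral>\<^sup>+x. ennreal (p x * u k x) \<partial>lborel") (auto simp: enn2ereal_ennreal)
    ultimately show ?thesis
      by (subst integrable_prob_density_iff(2)[OF d]) (simp_all add: real_lebesgue_integral_def[OF intpu])
  qed
  \<comment> \<open>Cutting \<open>ln p\<close> off below at -k adds at most
    \<open>exp (- real k)\<close> to its exponential, hence at most that times Z to the total mass 1
    of p.\<close>
  have til: "tilt (u k) r \<le> 1 + exp (- real k) * Z"
  proof -
    have i0: "integrable lborel (\<lambda>x::'a. exp (- r * norm x))" by (rule integrable_exp_neg_norm[OF r])
    have "tilt (u k) r \<le> (\<integral>x. p x + exp (- real k) * exp (- r * norm x) \<partial>lborel)"
      unfolding tilt_def
    proof (rule integral_mono)
      show "integrable lborel (\<lambda>x. exp (u k x - r * norm x))" by (intro integrable_tilt bu r) measurable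
      show "integrable lborel (\<lambda>x. p x + exp (- real k) * exp (- r * norm x))"
        using prob_densityD(5)[OF d] i0 by (intro Bochner_Integration.integrable_add integrable_mult_right)
      fix x
      have "exp (u k x - r * norm x) = exp (u k x) * exp (- r * norm x)" by (simp add: exp_diff exp_minus field_simps)
      also have "\<dots> \<le> (p x + exp (- real k)) * exp (- r * norm x)" using eu by (intro mult_right_mono) auto
      also have "\<dots> \<le> p x + exp (- real k) * exp (- r * norm x)"
        using p0[of x] r by (simp add: distrib_right mult_left_le)
      finally show "exp (u k x - r * norm x) \<le> p x + exp (- real k) * exp (- r * norm x)" .
    qed
    also have "\<dots> = 1 + exp (- real k) * Z"
      using prob_densityD(5,6)[OF d] i0 by (simp add: Z_def tilt_def)
    finally show ?thesis .
  qed
  have tpos: "tilt (u k) r > 0" by (intro tilt_pos bu r) measurable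
  have "ln (tilt (u k) r) \<le> ln (1 + exp (- real k) * Z)" using til tpos by (subst ln_le_cancel_iff) auto
  also have "\<dots> \<le> exp (- real k) * Z" using Z by (intro ln_add_one_self_le_self) auto
  finally have lt: "a < (\<integral>x. u k x \<partial>\<mu>) - ln (tilt (u k) r)" using int_u k2 a'(1) by argo
  obtain g where g: "\<And>n::nat. continuous_on UNIV (g n)" "\<And>n. bounded (range (g n))"
    "(\<lambda>n. \<integral>x. g n x \<partial>\<mu>) \<longlonglongrightarrow> (\<integral>x. u k x \<partial>\<mu>)" "(\<lambda>n. tilt (g n) r) \<longlonglongrightarrow> tilt (u k) r"
    by (rule bounded_measurable_approx[of \<mu> p "u k" "real k" r]) (use d ub r in auto)
  have "(\<lambda>n. (\<integral>x. g n x \<partial>\<mu>) - ln (tilt (g n) r)) \<longlonglongrightarrow> (\<integral>x. u k x \<partial>\<mu>) - ln (tilt (u k) r)"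
    using tpos by (intro tendsto_intros g) auto
  from order_tendstoD(1)[OF this lt] obtain N where "a < (\<integral>x. g N x \<partial>\<mu>) - ln (tilt (g N) r)"
    using eventually_happens' sequentially_bot by blast
  with g show thesis using that by blast
qed

text \<open>Without a density, \<mu> charges a Lebesgue null set and hence a compact null set K.
  Continuous functions of height t shrinking to K have integral at least \<open>t * \<eta>\<close>,
  while their \<open>tilt\<close> tends to the constant Z, so the dual value exceeds every
  a.\<close>

lemma entropy_dual_singular:
  fixes \<mu> :: "'a::euclidean_space measure"
  assumes \<mu>: "\<mu> \<in> borel_probs" and nd: "\<nexists>p. prob_density \<mu> p" and r: "r > 0"
  obtains f where "continuous_on UNIV f" "bounded (range f)" "a < (\<integral>x. f x \<partial>\<mu>) - ln (tilt f r)"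
proof -
  interpret prob_space \<mu> using \<mu> by (rule borel_probsD)
  have s[measurable_cong]: "sets \<mu> = sets borel" using \<mu> by (rule borel_probsD)
  have "\<not> absolutely_continuous lborel \<mu>"
  proof
    assume "absolutely_continuous lborel \<mu>"
    then obtain f where "f \<in> borel_measurable lborel" "density lborel f = \<mu>"
      using sigma_finite_measure.Radon_Nikodym[OF sigma_finite_lborel, of \<mu>] s by auto
    then show False using prob_density_exists[OF \<mu>] nd by blast
  qed
  then obtain N where N: "N \<in> null_sets lborel" "N \<notin> null_sets \<mu>" by (auto simp: absolutely_continuous_def)
  then have Ns: "N \<in> sets borel" by (auto simp: null_sets_def)
  have "emeasure \<mu> N \<noteq> 0" using N Ns s by (auto simp: null_sets_def)
  then have "0 < (SUP K\<in>{K. K \<subseteq> N \<and> compact K}. emeasure \<mu> K)"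
    using inner_regular[OF s _ Ns] by (simp add: zero_less_iff_neq_zero)
  then obtain K where K: "K \<subseteq> N" "compact K" "0 < emeasure \<mu> K" by (auto simp: less_SUP_iff)
  define \<eta> where "\<eta> = measure \<mu> K"
  have \<eta>: "\<eta> > 0" using K(3) by (simp add: \<eta>_def emeasure_eq_measure)
  have Kb[measurable]: "K \<in> sets borel" using K(2) by (rule borel_compact)
  have Kne: "K \<noteq> {}" using K(3) by auto
  have "K \<in> null_sets lborel" using N(1) K(1) Kb by (auto intro: null_sets_subset)
  then have aeK: "AE x in lborel. x \<notin> K" by (rule AE_not_in)
  define Z where "Z = tilt (\<lambda>_::'a. 0) r"
  have Z: "Z > 0" unfolding Z_def using r by (intro tilt_pos) auto
  \<comment> \<open>Makes \<open>t * \<eta> - ln Z\<close> exceed a by at least 1.\<close>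
  define t where "t = (\<bar>a\<bar> + \<bar>ln Z\<bar> + 1) / \<eta>"
  have t: "t > 0" "t * \<eta> - ln Z > a" using \<eta> by (auto simp: t_def)
  \<comment> \<open>A tent around K whose slope grows with j: it equals t on K and is eventually 0
    at every point off K.\<close>
  define g where "g j x = t * max 0 (1 - real j * infdist x K)" for j :: nat and x
  have cont: "continuous_on UNIV (g j)" for j unfolding g_def by (intro continuous_intros)
  have [measurable]: "g j \<in> borel_measurable borel" for j using cont by (rule borel_measurable_continuous_onI)
  have gB: "0 \<le> g j x" "g j x \<le> t" for j x
    using t infdist_nonneg[of x K] by (auto simp: g_def max_def mult_left_le)
  have bdd: "bounded (range (g j))" for j by (rule boundedI[of _ t]) (use gB in \<open>auto simp: abs_of_nonneg\<close>)
  have limg: "(\<lambda>j. g j x) \<longlonglongrightarrow> 0" if "x \<notin> K" for x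
  proof -
    have pos: "infdist x K > 0"
      using that K(2) Kne in_closed_iff_infdist_zero[of K x] infdist_nonneg[of x K]
      by (auto simp: compact_imp_closed less_le)
    obtain j0 where j0: "1 / infdist x K \<le> real j0" using real_arch_simple by blast
    have "g j x = 0" if "j \<ge> j0" for j
    proof -
      have "1 / infdist x K \<le> real j" using j0 that by linarith
      then show ?thesis using pos by (simp add: g_def field_simps)
    qed
    then show ?thesis by (intro tendsto_eventually) (auto simp: eventually_sequentially)
  qed
  have "(\<lambda>j. tilt (g j) r) \<longlonglongrightarrow> Z"
    unfolding Z_def tilt_def
  proof (rule integral_dominated_convergence[where w="\<lambda>x. exp t * exp (- r * norm x)"])
    show "AE x in lborel. (\<lambda>j. exp (g j x - r * norm x)) \<longlonglongrightarrow> exp (0 - r * norm x)"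
      using aeK by eventually_elim (intro tendsto_intros limg)
    show "integrable lborel (\<lambda>x::'a. exp t * exp (- r * norm x))"
      using integrable_exp_neg_norm[OF r] by (intro integrable_mult_right)
    show "AE x in lborel. norm (exp (g j x - r * norm x)) \<le> exp t * exp (- r * norm x)" for j
      using gB(2)[of j] by (auto simp flip: exp_add)
  qed measurable
  then have "(\<lambda>j. t * \<eta> - ln (tilt (g j) r)) \<longlonglongrightarrow> t * \<eta> - ln Z"
    using Z by (intro tendsto_intros) auto
  from order_tendstoD(1)[OF this t(2)] obtain j where j: "a < t * \<eta> - ln (tilt (g j) r)"
    using eventually_happens' sequentially_bot by blast
  have "t * \<eta> = (\<integral>x. t * indicator K x \<partial>\<mu>)" using s by (simp add: \<eta>_def)
  also have "\<dots> \<le> (\<integral>x. g j x \<partial>\<mu>)"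
  proof (rule integral_mono)
    show "integrable \<mu> (g j)" using \<mu> by (intro borel_probs_integrable_bounded bdd) auto
    show "t * indicator K x \<le> g j x" for x using gB(1)[of j x] by (auto simp: indicator_def g_def)
  qed (use s in \<open>auto simp: emeasure_eq_measure\<close>)
  finally have "a < (\<integral>x. g j x \<partial>\<mu>) - ln (tilt (g j) r)" using j by simp
  with cont bdd show thesis using that by blast
qed

text \<open>The hard half of the Donsker-Varadhan formula, in the direction opposite to
  \<open>gibbs_variational_le\<close>. No first-moment term is subtracted here, because the weight
  \<open>exp (- r * norm x)\<close> can only lower \<open>tilt\<close>, that is, raise the dual
  value.\<close>

theorem entropy_dual:
  fixes \<mu> :: "'a::euclidean_space measure"
  assumes "\<mu> \<in> probs_moment 1" "ereal a < entropy_fun \<mu>" "r > 0"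
  obtains f where "continuous_on UNIV f" "bounded (range f)" "a < (\<integral>x. f x \<partial>\<mu>) - ln (tilt f r)"
proof (cases "\<exists>p. prob_density \<mu> p")
  case True
  then show thesis using entropy_dual_ac assms that by metis
next
  case False
  then show thesis using entropy_dual_singular assms that by (metis (no_types, lifting) mem_Collect_eq probs_moment_1)
qed

section \<open>Empirical measures and the energy\<close>

lemma measurable_uniform_count: "x \<in> measurable (uniform_count_measure {..<n}) borel"
  by (simp add: measurable_def sets_uniform_count_measure space_uniform_count_measure Pi_def)

lemma empirical_in_borel_probs:
  assumes "n > 0"
  shows "empirical n x \<in> borel_probs"
proof -
  have "prob_space (uniform_count_measure {..<n})"
    using assms by (intro prob_space_uniform_count_measure) auto
  then show ?thesis
    unfolding empirical_eq_distr[OF assms] borel_probs_def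
    by (simp add: prob_space.prob_space_distr measurable_uniform_count)
qed

lemma integral_empirical:
  fixes f :: "'a::topological_space \<Rightarrow> 'b::{banach, second_countable_topology}"
  assumes "n > 0" "f \<in> borel_measurable borel"
  shows "(\<integral>t. f t \<partial>empirical n x) = (1 / real n) *\<^sub>R (\<Sum>i<n. f (x i))"
  unfolding empirical_eq_distr[OF assms(1)] integral_distr[OF measurable_uniform_count assms(2)]
  by (simp add: uniform_count_measure_def lebesgue_integral_point_measure_finite scaleR_sum_right)

lemma emeasure_empirical:
  assumes "n > 0" "A \<in> sets borel"
  shows "emeasure (empirical n x) A = ennreal (real (card {i. i < n \<and> x i \<in> A}) / real n)"
proof -
  have "x -` A \<inter> {..<n} = {i. i < n \<and> x i \<in> A}" by auto
  moreover have sub: "emeasure (uniform_count_measure {..<n}) {i. i < n \<and> x i \<in> A} =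
      ennreal (real (card {i. i < n \<and> x i \<in> A}) / real n)"
    by (subst emeasure_uniform_count_measure) auto
  ultimately show ?thesis
    unfolding empirical_eq_distr[OF assms(1)]
    by (subst emeasure_distr[OF measurable_uniform_count assms(2)])
       (simp add: space_uniform_count_measure sub)
qed

lemma empirical_cong:
  assumes "\<And>i. i < n \<Longrightarrow> x i = y i"
  shows "empirical n x = empirical n y"
proof -
  have "(\<Sum>i<n. emeasure (return borel (x i)) A) = (\<Sum>i<n. emeasure (return borel (y i)) A)" for A
    using assms by (intro sum.cong) auto
  then show ?thesis unfolding empirical_def by simp
qed

lemma translate_empirical:
  assumes "n > 0"
  shows "translate y (empirical n x) = empirical n (\<lambda>i. x i + y)"
  unfolding translate_def empirical_eq_distr[OF assms]
  by (subst distr_distr) (auto simp: comp_def measurable_uniform_count)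

text \<open>Serves measurability: the Borel sets of the weak topology are generated by its open
  sets, so continuous maps into it are the natural source of measurable ones.\<close>

lemma continuous_map_empirical:
  assumes n: "n > 0"
  shows "continuous_map euclidean weak_topology (empirical n :: (nat \<Rightarrow> 'a::topological_space) \<Rightarrow> 'a measure)"
  unfolding weak_topology_def
proof (rule continuous_on_generated_topo)
  fix U assume "U \<in> {{\<mu> \<in> borel_probs. (\<integral>x. f x \<partial>\<mu>) \<in> U} | (f :: 'a \<Rightarrow> real) U.
        continuous_on UNIV f \<and> bounded (range f) \<and> open U}"
  then obtain f :: "'a \<Rightarrow> real" and V where U: "U = {\<mu> \<in> borel_probs. (\<integral>x. f x \<partial>\<mu>) \<in> V}"
    and f: "continuous_on UNIV f" and V: "open V" by blast
  have "f \<in> borel_measurable borel" using f by (rule borel_measurable_continuous_onI)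
  then have "empirical n -` U \<inter> topspace euclidean = (\<lambda>x. (\<Sum>i<n. f (x i)) / real n) -` V"
    using n by (auto simp: U integral_empirical empirical_in_borel_probs)
  moreover have "continuous_on UNIV (\<lambda>x::nat \<Rightarrow> 'a. (\<Sum>i<n. f (x i)) / real n)"
    using n by (intro continuous_intros continuous_on_compose2[OF f]) auto
  ultimately show "openin euclidean (empirical n -` U \<inter> topspace euclidean)"
    using V by (simp add: open_vimage)
next
  show "empirical n ` topspace euclidean \<subseteq> \<Union> {{\<mu> \<in> borel_probs. (\<integral>x. f x \<partial>\<mu>) \<in> U} | (f :: 'a \<Rightarrow> real) U.
        continuous_on UNIV f \<and> bounded (range f) \<and> open U}"
    using empirical_in_borel_probs[OF n] topspace_weak_topology[where 'a='a]
    unfolding weak_topology_def topology_generated_by_topspace by auto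
qed

section \<open>Borel sets of a topology and measurability of the empirical measure\<close>

lemma space_borel_of [simp]: "space (borel_of X) = topspace X"
  by (simp add: borel_of_def space_measure_of_conv)

lemma openin_sets_borel_of: "openin X U \<Longrightarrow> U \<in> sets (borel_of X)"
  unfolding borel_of_def by (rule in_measure_of) (auto dest: openin_subset)

lemma closedin_sets_borel_of:
  assumes "closedin X C"
  shows "C \<in> sets (borel_of X)"
proof -
  have "topspace X - (topspace X - C) = C" using closedin_subset[OF assms] by blast
  moreover have "topspace X - (topspace X - C) \<in> sets (borel_of X)"
    using sets.compl_sets[OF openin_sets_borel_of[of X "topspace X - C"]] assms by (simp add: closedin_def)
  ultimately show ?thesis by simp
qed

lemma continuous_map_measurable:
  assumes "continuous_map X Y f"
  shows "f \<in> measurable (borel_of X) (borel_of Y)"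
  unfolding borel_of_def[of Y]
proof (rule measurable_measure_of)
  show "f \<in> space (borel_of X) \<rightarrow> topspace Y"
    using continuous_map_image_subset_topspace[OF assms] by auto
  fix U assume "U \<in> {U. openin Y U}"
  then have "openin X {x \<in> topspace X. f x \<in> U}"
    using assms by (simp add: continuous_map_def)
  also have "{x \<in> topspace X. f x \<in> U} = f -` U \<inter> space (borel_of X)" by auto
  finally show "f -` U \<inter> space (borel_of X) \<in> sets (borel_of X)" by (rule openin_sets_borel_of)
qed (auto dest: openin_subset)

lemma borel_of_euclidean: "borel_of euclidean = borel"
  by (simp add: borel_of_def borel_def)

text \<open>Configurations in the product over \<open>{..<n}\<close> are \<open>undefined\<close>
  from n on. Padding with 0 moves them to the full sequence space, where the Borel and the product
  sigma-algebra coincide, and \<open>empirical n\<close> does not notice the change.\<close>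

lemma measurable_empirical:
  assumes n: "n > 0" and s: "sets M = sets (\<Pi>\<^sub>M i\<in>{..<n}. borel :: 'a::euclidean_space measure)"
  shows "empirical n \<in> measurable M (borel_of weak_topology)"
proof -
  have e: "(\<lambda>x i. if i < n then x i else 0) \<in> measurable (\<Pi>\<^sub>M i\<in>{..<n}. borel :: 'a measure) borel"
  proof -
    have "(\<lambda>x i. if i < n then x i else 0) \<in> measurable (\<Pi>\<^sub>M i\<in>{..<n}. borel) (\<Pi>\<^sub>M i\<in>(UNIV :: nat set). borel :: 'a measure)"
    proof (rule measurable_PiM_single')
      fix i :: nat
      show "(\<lambda>x. if i < n then x i else 0) \<in> borel_measurable (\<Pi>\<^sub>M i\<in>{..<n}. borel :: 'a measure)"
        by (cases "i < n") auto
    qed auto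
    also have "measurable (\<Pi>\<^sub>M i\<in>{..<n}. borel :: 'a measure) (\<Pi>\<^sub>M i\<in>(UNIV :: nat set). borel :: 'a measure) =
        measurable (\<Pi>\<^sub>M i\<in>{..<n}. borel) borel"
      by (rule measurable_cong_sets[OF refl sets_PiM_equal_borel])
    finally show ?thesis .
  qed
  have "empirical n \<in> measurable borel (borel_of (weak_topology :: 'a measure topology))"
    using continuous_map_measurable[OF continuous_map_empirical[OF n, where 'a='a]] by (simp add: borel_of_euclidean)
  from measurable_comp[OF e this]
  have "(\<lambda>x. empirical n (\<lambda>i. if i < n then x i else 0)) \<in> measurable (\<Pi>\<^sub>M i\<in>{..<n}. borel) (borel_of (weak_topology :: 'a measure topology))"
    by (simp add: comp_def)
  also have "(\<lambda>x. empirical n (\<lambda>i. if i < n then x i else 0)) = (empirical n :: (nat \<Rightarrow> 'a) \<Rightarrow> 'a measure)"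
    by (intro ext empirical_cong) auto
  finally show ?thesis by (simp cong: measurable_cong_sets add: s)
qed

text \<open>Together with \<open>sigma_finite_energy\<close> this makes the energy of every
  configuration finite.\<close>

lemma compact_measure_support_empirical:
  fixes x :: "nat \<Rightarrow> 'a::euclidean_space"
  assumes n: "n > 0"
  shows "compact (measure_support (empirical n x))"
proof -
  have "y \<in> x ` {..<n}" if "y \<in> measure_support (empirical n x)" for y
  proof (rule ccontr)
    assume y: "y \<notin> x ` {..<n}"
    have "open (- x ` {..<n})" by (intro open_Compl finite_imp_closed) auto
    then have "emeasure (empirical n x) (- x ` {..<n}) > 0"
      using that y by (auto simp: measure_support_def)
    moreover have "{i. i < n \<and> x i \<in> - x ` {..<n}} = {}" by auto
    then have "emeasure (empirical n x) (- x ` {..<n}) = 0"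
      using n by (subst emeasure_empirical) (auto intro!: borel_open open_Compl finite_imp_closed)
    ultimately show False by simp
  qed
  then have "measure_support (empirical n x) \<subseteq> x ` {..<n}" by blast
  then show ?thesis by (rule finite_imp_compact[OF finite_subset]) simp
qed

section \<open>Energies with growth control and the Gibbs mass\<close>

locale confining_energy =
  fixes W :: "'a::euclidean_space measure \<Rightarrow> ennreal" and \<sigma>2 l \<kappa> :: real
  assumes \<sigma>2: "\<sigma>2 > 0"
    and inv: "translation_invariant W"
    and sigma_fin: "sigma_finite_energy W"
    and lsc: "lsc_energy W"
    and l: "l \<ge> 1" and \<kappa>: "\<kappa> > 0"
    and growth_infinite: "\<And>\<mu>. \<mu> \<in> borel_probs \<Longrightarrow> \<mu> \<notin> probs_moment l \<Longrightarrow> W \<mu> = \<infinity>"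
    and growth: "\<And>\<mu>. \<mu> \<in> centred_probs l \<Longrightarrow> W \<mu> \<ge> ennreal \<kappa> * (\<integral>\<^sup>+x. ennreal (norm x powr l) \<partial>\<mu>)"
    and chaos: "chaos_compatible W"
begin

definition \<beta> :: real where "\<beta> = 2 / \<sigma>2"

lemma \<beta>_pos: "\<beta> > 0" using \<sigma>2 by (simp add: \<beta>_def)

lemma W_translate: "\<mu> \<in> borel_probs \<Longrightarrow> W (translate y \<mu>) = W \<mu>"
  using inv by (simp add: translation_invariant_def)

lemma W_finite_imp_moment: "\<mu> \<in> borel_probs \<Longrightarrow> W \<mu> < \<infinity> \<Longrightarrow> \<mu> \<in> probs_moment l"
  using growth_infinite[of \<mu>] by (cases "\<mu> \<in> probs_moment l") auto

lemma W_finite_imp_moment_1: "\<mu> \<in> borel_probs \<Longrightarrow> W \<mu> < \<infinity> \<Longrightarrow> \<mu> \<in> probs_moment 1"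
  using W_finite_imp_moment probs_moment_subset_1[OF l] by blast

text \<open>Growth control applies to the translate with mean 0, which has the same energy. The norm
  of the mean is the cost of moving back, and the 1 comes from
  \<open>norm x - 1 \<le> norm x powr l\<close>, valid because l is at least 1.\<close>

lemma W_ge_first_moment:
  assumes \<mu>: "\<mu> \<in> borel_probs" and fin: "W \<mu> < \<infinity>"
  shows "\<kappa> * ((\<integral>x. norm x \<partial>\<mu>) - norm (\<integral>x. x \<partial>\<mu>) - 1) \<le> enn2real (W \<mu>)"
proof -
  interpret prob_space \<mu> using \<mu> by (rule borel_probsD)
  have [measurable_cong]: "sets \<mu> = sets borel" using \<mu> by (rule borel_probsD)
  define m where "m = (\<integral>x. x \<partial>\<mu>)"
  define \<nu> where "\<nu> = translate (- m) \<mu>"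
  have W\<nu>: "W \<nu> = W \<mu>" unfolding \<nu>_def using \<mu> by (rule W_translate)
  have \<nu>: "\<nu> \<in> borel_probs" unfolding \<nu>_def using \<mu> by (rule translate_in_borel_probs)
  interpret N: prob_space \<nu> using \<nu> by (rule borel_probsD)
  have [measurable_cong]: "sets \<nu> = sets borel" using \<nu> by (rule borel_probsD)
  have \<mu>1: "\<mu> \<in> probs_moment 1" using W_finite_imp_moment_1[OF \<mu> fin] .
  note int = integrable_norm_probs_moment_1[OF \<mu>1]
  have "(\<integral>x. x \<partial>\<nu>) = (\<integral>x. x + (- m) \<partial>\<mu>)" unfolding \<nu>_def using \<mu> by (intro integral_translate) auto
  also have "\<dots> = 0" using int prob_space by (simp add: m_def)
  finally have "\<nu> \<in> centred_probs l"
    using W_finite_imp_moment[OF \<nu>] fin W\<nu> by (simp add: centred_probs_def)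
  from growth[OF this] have g: "ennreal \<kappa> * (\<integral>\<^sup>+x. ennreal (norm x powr l) \<partial>\<nu>) \<le> W \<mu>" by (simp add: W\<nu>)
  have \<nu>1: "\<nu> \<in> probs_moment 1" using W_finite_imp_moment_1[OF \<nu>] W\<nu> fin by simp
  note int\<nu> = integrable_norm_probs_moment_1[OF \<nu>1]
  have "ennreal ((\<integral>x. norm x \<partial>\<nu>) - 1) \<le> (\<integral>\<^sup>+x. ennreal (norm x powr l) \<partial>\<nu>)"
  proof -
    have "(\<integral>x. norm x \<partial>\<nu>) - 1 = (\<integral>x. norm x - 1 \<partial>\<nu>)" using int\<nu> N.prob_space by simp
    also have "ennreal \<dots> \<le> ennreal (\<integral>x. max 0 (norm x - 1) \<partial>\<nu>)"
      using int\<nu> by (intro ennreal_leI integral_mono) auto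
    also have "\<dots> = (\<integral>\<^sup>+x. ennreal (max 0 (norm x - 1)) \<partial>\<nu>)"
      using int\<nu> by (intro nn_integral_eq_integral[symmetric]) auto
    also have "\<dots> \<le> (\<integral>\<^sup>+x. ennreal (norm x powr l) \<partial>\<nu>)"
    proof (intro nn_integral_mono ennreal_leI)
      fix x :: 'a
      show "max 0 (norm x - 1) \<le> norm x powr l"
      proof (cases "norm x \<le> 1")
        case False
        then have "norm x powr 1 \<le> norm x powr l" using l by (intro powr_mono) auto
        then show ?thesis using False by simp
      qed simp
    qed
    finally show ?thesis .
  qed
  then have "ennreal \<kappa> * ennreal ((\<integral>x. norm x \<partial>\<nu>) - 1) \<le> W \<mu>"
    using g by (meson mult_left_mono order_trans zero_le)
  then have "ennreal (\<kappa> * ((\<integral>x. norm x \<partial>\<nu>) - 1)) \<le> W \<mu>"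
    using \<kappa> by (cases "(\<integral>x. norm x \<partial>\<nu>) - 1 \<ge> 0") (auto simp: ennreal_mult ennreal_neg mult_nonneg_nonpos)
  then have "\<kappa> * ((\<integral>x. norm x \<partial>\<nu>) - 1) \<le> enn2real (W \<mu>)"
    using fin by (cases "W \<mu>") (auto simp: ennreal_le_iff2)
  moreover have "(\<integral>x. norm x \<partial>\<mu>) - norm m \<le> (\<integral>x. norm x \<partial>\<nu>)"
  proof -
    have "(\<integral>x. norm x \<partial>\<mu>) - norm m = (\<integral>x. norm x - norm m \<partial>\<mu>)" using int prob_space by simp
    also have "\<dots> \<le> (\<integral>x. norm (x + (- m)) \<partial>\<mu>)"
    proof (intro integral_mono)
      show "norm x - norm m \<le> norm (x + - m)" for x using norm_triangle_ineq2[of x m] by simp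
    qed (use int in auto)
    also have "\<dots> = (\<integral>x. norm x \<partial>\<nu>)" unfolding \<nu>_def using \<mu> by (intro integral_translate[symmetric]) auto
    finally show ?thesis .
  qed
  then have "\<kappa> * ((\<integral>x. norm x \<partial>\<mu>) - norm m - 1) \<le> \<kappa> * ((\<integral>x. norm x \<partial>\<nu>) - 1)"
    using \<kappa> by (intro mult_left_mono) auto
  ultimately show ?thesis by (simp add: m_def)
qed

text \<open>Levels of either sign are wanted: \<open>free_energy_dual\<close> may produce a negative
  one.\<close>

lemma openin_W_gt: "openin weak_topology {\<mu> \<in> borel_probs. ereal w < enn2ereal (W \<mu>)}"
proof (cases "w < 0")
  case True
  have "ereal w < enn2ereal t" for t by (rule order_less_le_trans[of _ 0]) (use True in auto)
  then have "{\<mu> \<in> borel_probs. ereal w < enn2ereal (W \<mu>)} = topspace weak_topology" by auto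
  then show ?thesis by (metis openin_topspace)
next
  case False
  then have "{\<mu> \<in> borel_probs. ereal w < enn2ereal (W \<mu>)} = {\<mu> \<in> borel_probs. ennreal w < W \<mu>}"
    by (auto simp: less_ennreal.rep_eq enn2ereal_ennreal)
  then show ?thesis using lsc by (simp add: lsc_energy_def)
qed

lemma W_measurable: "W \<in> borel_measurable (borel_of weak_topology)"
proof (rule borel_measurableI_greater)
  fix y
  show "{x \<in> space (borel_of weak_topology). y < W x} \<in> sets (borel_of weak_topology)"
    using lsc by (intro openin_sets_borel_of) (simp add: lsc_energy_def)
qed

abbreviation configs :: "nat \<Rightarrow> (nat \<Rightarrow> 'a) measure" where
  "configs n \<equiv> (\<Pi>\<^sub>M i\<in>{..<n}. lborel)"

text \<open>This is \<open>sqrt n\<close> times the mean: the orthonormal coordinate on the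
  complement of the centred configurations, as in \<open>lebesgue_centred\<close>.\<close>

definition bary :: "nat \<Rightarrow> (nat \<Rightarrow> 'a) \<Rightarrow> 'a" where
  "bary n x = (1 / sqrt (real n)) *\<^sub>R (\<Sum>i<n. x i)"

text \<open>The value 0 that \<open>enn2real\<close> assigns to infinity does not occur for n > 0,
  by \<open>energy_finite\<close>.\<close>

definition E :: "nat \<Rightarrow> (nat \<Rightarrow> 'a) \<Rightarrow> real" where
  "E n x = enn2real (energy_n W n x)"

lemma energy_finite: "n > 0 \<Longrightarrow> energy_n W n x < \<infinity>"
  using sigma_fin[unfolded sigma_finite_energy_def, rule_format,
      OF empirical_in_borel_probs compact_measure_support_empirical]
  by (simp add: energy_n_def)

lemma energy_eq: "n > 0 \<Longrightarrow> energy_n W n x = ennreal (E n x)" and E_nonneg: "0 \<le> E n x"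
  using energy_finite[of n x] by (simp_all add: E_def less_top)

lemma gibbs_weight_eq: "n > 0 \<Longrightarrow> gibbs_weight W \<sigma>2 n x = ennreal (exp (- (\<beta> * real n * E n x)))"
  using \<sigma>2 E_nonneg[of n x]
  by (simp add: gibbs_weight_def exp_neg_def energy_eq ennreal_mult_less_top \<beta>_def flip: ennreal_mult)

lemma sets_configs: "sets (configs n) = sets (\<Pi>\<^sub>M i\<in>{..<n}. borel)"
  by (intro sets_PiM_cong) auto

lemma measurable_configs: "measurable (configs n) N = measurable (\<Pi>\<^sub>M i\<in>{..<n}. borel) N"
  by (rule measurable_cong_sets[OF sets_configs refl])

lemma E_measurable:
  assumes "n > 0"
  shows "E n \<in> borel_measurable (\<Pi>\<^sub>M i\<in>{..<n}. borel)" "E n \<in> borel_measurable (configs n)"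
  using measurable_comp[OF measurable_empirical[OF assms refl] W_measurable]
  unfolding E_def[abs_def] energy_n_def by (auto simp: comp_def measurable_configs)

lemma bary_measurable [measurable]: "bary n \<in> borel_measurable (\<Pi>\<^sub>M i\<in>{..<n}. borel)"
    "bary n \<in> borel_measurable (configs n)"
  unfolding bary_def[abs_def] measurable_configs by measurable

lemma indicator_empirical_measurable:
  assumes "n > 0" "A \<in> sets (borel_of weak_topology)"
  shows "(\<lambda>x. indicator A (empirical n x) :: ennreal) \<in> borel_measurable (configs n)"
    "(\<lambda>x. indicator A (empirical n x) :: ennreal) \<in> borel_measurable (\<Pi>\<^sub>M i\<in>{..<n}. borel)"
  using measurable_comp[OF measurable_empirical[OF assms(1) refl] borel_measurable_indicator[OF assms(2)]]
  by (auto simp: measurable_configs comp_def)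

text \<open>The unnormalised Gibbs mass of A, over all configurations with barycentre coordinate in
  the unit cube. Some confinement is necessary: the energy is blind to common shifts, so for a
  translation-invariant A of positive mass the unrestricted integral is infinite.\<close>

definition mass :: "nat \<Rightarrow> 'a measure set \<Rightarrow> ennreal" where
  "mass n A = (\<integral>\<^sup>+x. indicator (cbox 0 One) (bary n x) * (indicator A (empirical n x) * ennreal (exp (- (\<beta> * real n * E n x)))) \<partial>configs n)"

lemma nn_integral_lebesgue_centred:
  assumes f: "f \<in> borel_measurable (\<Pi>\<^sub>M i\<in>{..<n}. borel)"
  shows "(\<integral>\<^sup>+x. f x \<partial>lebesgue_centred n) = (\<integral>\<^sup>+x. indicator (cbox 0 One) (bary n x) * f (centring n x) \<partial>configs n)"
proof -
  have ind: "indicator {x. (1 / sqrt (real n)) *\<^sub>R (\<Sum>i<n. x i) \<in> cbox 0 One} x = (indicator (cbox 0 One) (bary n x) :: ennreal)" for x :: "nat \<Rightarrow> 'a"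
    by (simp add: bary_def indicator_def)
  have "(\<integral>\<^sup>+x. f x \<partial>lebesgue_centred n) = (\<integral>\<^sup>+x. f (centring n x) \<partial>density (configs n) (indicator {x. (1 / sqrt (real n)) *\<^sub>R (\<Sum>i<n. x i) \<in> cbox 0 One}))"
    unfolding lebesgue_centred_def using measurable_centring f by (intro nn_integral_distr) auto
  also have "\<dots> = (\<integral>\<^sup>+x. indicator (cbox 0 One) (bary n x) * f (centring n x) \<partial>configs n)"
    unfolding ind[symmetric] using measurable_comp[OF measurable_centring f]
    by (intro nn_integral_density) (auto simp: ind[abs_def] comp_def)
  finally show ?thesis .
qed

lemma empirical_centring:
  assumes "n > 0"
  shows "empirical n (centring n x) = translate (- ((1 / real n) *\<^sub>R (\<Sum>j<n. x j))) (empirical n x)"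
  unfolding translate_empirical[OF assms] by (rule empirical_cong) (simp add: centring_def)

lemma E_translate: "n > 0 \<Longrightarrow> E n (\<lambda>i. x i + y) = E n x"
  using W_translate[OF empirical_in_borel_probs, of n y x]
  by (simp add: E_def energy_n_def translate_empirical)

lemma E_cong: "(\<And>i. i < n \<Longrightarrow> x i = y i) \<Longrightarrow> E n x = E n y"
  by (simp add: E_def energy_n_def empirical_cong[of n x y])

lemma E_centring: "n > 0 \<Longrightarrow> E n (centring n x) = E n x"
  using W_translate[OF empirical_in_borel_probs, of n _ x]
  by (simp add: E_def energy_n_def empirical_centring)

definition transl_inv :: "'a measure set \<Rightarrow> bool" where
  "transl_inv A \<longleftrightarrow> (\<forall>\<mu>\<in>borel_probs. \<forall>y. translate y \<mu> \<in> A \<longleftrightarrow> \<mu> \<in> A)"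

text \<open>\<open>centring n\<close> translates the empirical measure, so neither a
  translation-invariant event nor the energy notices it, and the projection disappears from the
  integral.\<close>

lemma nn_integral_gibbs_weight:
  assumes n: "n > 0" and A: "A \<in> sets (borel_of weak_topology)" "transl_inv A"
  shows "(\<integral>\<^sup>+x. indicator A (empirical n x) * gibbs_weight W \<sigma>2 n x \<partial>lebesgue_centred n) = mass n A"
proof -
  note [measurable] = E_measurable[OF n] indicator_empirical_measurable[OF n A(1)]
  have "(\<integral>\<^sup>+x. indicator A (empirical n x) * gibbs_weight W \<sigma>2 n x \<partial>lebesgue_centred n) =
    (\<integral>\<^sup>+x. indicator (cbox 0 One) (bary n x) * (indicator A (empirical n (centring n x)) * gibbs_weight W \<sigma>2 n (centring n x)) \<partial>configs n)"
    by (intro nn_integral_lebesgue_centred) (simp add: gibbs_weight_eq[OF n])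
  also have "\<dots> = mass n A"
  proof -
    have "empirical n (centring n x) \<in> A \<longleftrightarrow> empirical n x \<in> A" for x
      using A(2) empirical_in_borel_probs[OF n, of x] unfolding empirical_centring[OF n] transl_inv_def by blast
    then show ?thesis
      unfolding mass_def by (simp add: gibbs_weight_eq[OF n] E_centring[OF n] indicator_def)
  qed
  finally show ?thesis .
qed

lemma transl_inv_borel_probs: "transl_inv borel_probs"
  by (simp add: transl_inv_def translate_in_borel_probs)

lemma borel_probs_sets: "borel_probs \<in> sets (borel_of weak_topology)"
  using sets.top[of "borel_of weak_topology"] by simp

lemma partition_const_eq: "n > 0 \<Longrightarrow> partition_const W \<sigma>2 n = mass n borel_probs"
  using nn_integral_gibbs_weight[OF _ borel_probs_sets transl_inv_borel_probs]
  by (simp add: partition_const_def empirical_in_borel_probs)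

section \<open>Orbits and translation-invariant events\<close>

lemma translate_orbit:
  assumes "\<mu> \<in> borel_probs"
  shows "orbit (translate y \<mu>) = orbit \<mu>"
proof -
  have "orbit (translate y \<mu>) = range (\<lambda>z. translate (y + z) \<mu>)"
    using assms by (simp add: orbit_def translate_translate)
  also have "\<dots> = (\<lambda>z. translate z \<mu>) ` range ((+) y)" by (simp only: image_image)
  also have "range ((+) y) = UNIV" by (rule surj_plus)
  finally show ?thesis by (simp add: orbit_def)
qed

lemma continuous_map_orbit: "continuous_map weak_topology orbit_topology orbit"
  unfolding orbit_topology_def
  by (rule quotient_imp_continuous_map[OF quotient_map_quotient_topology])

text \<open>The preimage of U under the orbit map. It is translation invariant, which is what turns
  its Gibbs probability into a quotient of masses.\<close>

definition lift_orbit :: "'a measure set set \<Rightarrow> 'a measure set" where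
  "lift_orbit U = {\<mu> \<in> borel_probs. orbit \<mu> \<in> U}"

lemma lift_orbit_sets:
  assumes "U \<in> sets (borel_of orbit_topology)"
  shows "lift_orbit U \<in> sets (borel_of weak_topology)"
  using measurable_sets[OF continuous_map_measurable[OF continuous_map_orbit] assms]
  by (simp add: lift_orbit_def vimage_def Int_def conj_commute)

lemma transl_inv_lift_orbit: "transl_inv (lift_orbit U)"
  by (auto simp: transl_inv_def lift_orbit_def translate_in_borel_probs translate_orbit)

lemma emeasure_gibbs_orbit:
  assumes n: "n > 0" and U: "U \<in> sets (borel_of orbit_topology)"
  shows "emeasure (gibbs_orbit W \<sigma>2 n) U = mass n (lift_orbit U) / mass n borel_probs"
proof -
  let ?Z = "mass n borel_probs"
  let ?A = "lift_orbit U"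
  have sg: "sets (gibbs W \<sigma>2 n) = sets (\<Pi>\<^sub>M i\<in>{..<n}. borel :: 'a measure)"
    by (simp add: gibbs_def lebesgue_centred_def)
  then have spg: "space (gibbs W \<sigma>2 n) = space (\<Pi>\<^sub>M i\<in>{..<n}. borel :: 'a measure)" by (rule sets_eq_imp_space_eq)
  have slc: "sets (lebesgue_centred n) = sets (\<Pi>\<^sub>M i\<in>{..<n}. borel :: 'a measure)"
    by (simp add: lebesgue_centred_def)
  note [measurable] = E_measurable[OF n] indicator_empirical_measurable[OF n lift_orbit_sets[OF U]]
  have emp: "empirical n \<in> measurable (gibbs W \<sigma>2 n) (borel_of weak_topology)"
    using n sg by (rule measurable_empirical)
  have "emeasure (gibbs_orbit W \<sigma>2 n) U = emeasure (gibbs_empirical W \<sigma>2 n) (orbit -` U \<inter> space (gibbs_empirical W \<sigma>2 n))"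
    unfolding gibbs_orbit_def
    by (rule emeasure_distr) (use U continuous_map_measurable[OF continuous_map_orbit] in \<open>simp_all add: gibbs_empirical_def\<close>)
  also have "orbit -` U \<inter> space (gibbs_empirical W \<sigma>2 n) = ?A"
    by (auto simp: gibbs_empirical_def lift_orbit_def)
  also have "emeasure (gibbs_empirical W \<sigma>2 n) ?A = (\<integral>\<^sup>+\<mu>. indicator ?A \<mu> \<partial>gibbs_empirical W \<sigma>2 n)"
    using lift_orbit_sets[OF U] by (simp add: gibbs_empirical_def)
  also have "\<dots> = (\<integral>\<^sup>+x. indicator ?A (empirical n x) \<partial>gibbs W \<sigma>2 n)"
    unfolding gibbs_empirical_def using emp lift_orbit_sets[OF U] by (intro nn_integral_distr) auto
  also have "\<dots> = (\<integral>\<^sup>+x. gibbs_weight W \<sigma>2 n x / ?Z * indicator ?A (empirical n x) \<partial>lebesgue_centred n)"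
    unfolding gibbs_def partition_const_eq[OF n]
    by (intro nn_integral_density)
       (auto simp: gibbs_weight_eq[OF n] measurable_cong_sets[OF slc refl])
  also have "\<dots> = (\<integral>\<^sup>+x. (indicator ?A (empirical n x) * gibbs_weight W \<sigma>2 n x) / ?Z \<partial>lebesgue_centred n)"
    by (simp add: ennreal_times_divide mult.commute divide_ennreal_def mult.assoc mult.left_commute)
  also have "\<dots> = (\<integral>\<^sup>+x. indicator ?A (empirical n x) * gibbs_weight W \<sigma>2 n x \<partial>lebesgue_centred n) / ?Z"
    by (intro nn_integral_divide) (auto simp: gibbs_weight_eq[OF n] measurable_cong_sets[OF slc refl])
  also have "\<dots> = mass n ?A / ?Z"
    using nn_integral_gibbs_weight[OF n lift_orbit_sets[OF U] transl_inv_lift_orbit] by simp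
  finally show ?thesis .
qed

end

section \<open>Upper bound\<close>

interpretation lborel_product: product_sigma_finite "\<lambda>_::nat. lborel :: 'a::euclidean_space measure"
  by standard

context confining_energy
begin

lemma free_energy_W_finite:
  "W \<mu> < \<infinity> \<Longrightarrow> free_energy W \<sigma>2 \<mu> = entropy_fun \<mu> + ereal (\<beta> * enn2real (W \<mu>))"
  by (cases "W \<mu>") (auto simp: free_energy_def enn2ereal_ennreal \<beta>_def)

lemma free_energy_W_infinite: "W \<mu> = \<infinity> \<Longrightarrow> free_energy W \<sigma>2 \<mu> = \<infinity>"
  using \<sigma>2 entropy_fun_not_MInfty[of \<mu>] by (simp add: free_energy_def)

lemma free_energy_not_MInfty: "free_energy W \<sigma>2 \<mu> \<noteq> - \<infinity>"
proof (cases "W \<mu> < \<infinity>")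
  case True
  then show ?thesis
    using entropy_fun_not_MInfty[of \<mu>] by (cases "entropy_fun \<mu>") (simp_all add: free_energy_W_finite)
qed (simp add: free_energy_W_infinite less_top[symmetric])

lemma free_energy_translate: "\<mu> \<in> borel_probs \<Longrightarrow> free_energy W \<sigma>2 (translate y \<mu>) = free_energy W \<sigma>2 \<mu>"
  by (simp add: free_energy_def W_translate entropy_fun_translate)

text \<open>Prepares the estimate in which a share \<epsilon> of the energy is replaced by a
  multiple of the first moment. D stands for the mean and the 1 that are lost in
  \<open>W_ge_first_moment\<close>; w is strictly below the energy, so that exceeding w is an open
  condition satisfied by \<mu>.\<close>

lemma free_energy_dual:
  assumes \<mu>: "\<mu> \<in> borel_probs" and a: "ereal a < free_energy W \<sigma>2 \<mu>" and D: "D \<ge> 0"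
  obtains f w \<epsilon> where "continuous_on UNIV f" "bounded (range f)" "0 < \<epsilon>" "\<epsilon> < 1"
    "ereal w < enn2ereal (W \<mu>)"
    "a < \<beta> * (1 - \<epsilon>) * w + (\<integral>x. f x \<partial>\<mu>) - ln (tilt f (\<beta> * \<epsilon> * \<kappa>)) - \<beta> * \<epsilon> * \<kappa> * D"
proof (cases "W \<mu> < \<infinity>")
  case False
  \<comment> \<open>For infinite energy the test function 0 suffices: half of a sufficiently high
    level w beats all other terms.\<close>
  define w where "w = (a + ln (tilt (\<lambda>_::'a. 0) (\<beta> * (1/2) * \<kappa>)) + \<beta> * (1/2) * \<kappa> * D + 1) / (\<beta> * (1/2))"
  have "\<beta> * (1/2) * w = a + ln (tilt (\<lambda>_::'a. 0) (\<beta> * (1/2) * \<kappa>)) + \<beta> * (1/2) * \<kappa> * D + 1"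
    using \<beta>_pos by (simp add: w_def)
  then have "a < \<beta> * (1 - 1/2) * w + (\<integral>x. (\<lambda>_. 0) x \<partial>\<mu>) - ln (tilt (\<lambda>_::'a. 0) (\<beta> * (1/2) * \<kappa>)) - \<beta> * (1/2) * \<kappa> * D"
    by (simp add: field_simps)
  moreover have "ereal w < enn2ereal (W \<mu>)" using False by (simp add: less_top[symmetric])
  ultimately show thesis using that[of "\<lambda>_. 0" "1/2" w] by simp
next
  case True
  have \<mu>1: "\<mu> \<in> probs_moment 1" using W_finite_imp_moment_1[OF \<mu> True] .
  define w0 where "w0 = enn2real (W \<mu>)"
  have "ereal (a - \<beta> * w0) < entropy_fun \<mu>"
    using a unfolding free_energy_W_finite[OF True] w0_def[symmetric]
    by (cases "entropy_fun \<mu>") auto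
  then obtain a1 where a1: "a - \<beta> * w0 < a1" "ereal a1 < entropy_fun \<mu>"
    using ereal_dense2 by (metis less_ereal.simps(1))
  \<comment> \<open>The gap g is spent in thirds: one on lowering the energy level, one on all terms
    with \<epsilon>, and the last remains. The choice of \<epsilon> uses nothing about f, because f
    is found afterwards for the resulting r.\<close>
  define g where "g = a1 + \<beta> * w0 - a"
  have g: "g > 0" using a1 by (simp add: g_def)
  define w where "w = w0 - g / (3 * \<beta>)"
  define \<epsilon> where "\<epsilon> = min (1/2) (g / (3 * \<beta> * (\<bar>w\<bar> + \<kappa> * D + 1)))"
  have pos: "\<bar>w\<bar> + \<kappa> * D + 1 > 0" using D \<kappa> by (intro add_nonneg_pos add_nonneg_nonneg) auto
  have \<epsilon>: "0 < \<epsilon>" "\<epsilon> < 1" using g \<beta>_pos pos by (auto simp: \<epsilon>_def)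
  have "\<epsilon> * (3 * \<beta> * (\<bar>w\<bar> + \<kappa> * D + 1)) \<le> g"
  proof -
    have "\<epsilon> \<le> g / (3 * \<beta> * (\<bar>w\<bar> + \<kappa> * D + 1))" by (simp add: \<epsilon>_def)
    then show ?thesis using \<beta>_pos pos by (subst (asm) pos_le_divide_eq) auto
  qed
  moreover have "\<epsilon> * (3 * \<beta> * (\<bar>w\<bar> + \<kappa> * D + 1)) \<ge> 3 * \<beta> * \<epsilon> * w + 3 * (\<beta> * \<epsilon> * \<kappa> * D)"
  proof -
    have "\<epsilon> * (3 * \<beta>) * (w + \<kappa> * D) \<le> \<epsilon> * (3 * \<beta>) * (\<bar>w\<bar> + \<kappa> * D + 1)"
      using \<epsilon> \<beta>_pos by (intro mult_left_mono) auto
    then show ?thesis by (simp add: algebra_simps)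
  qed
  ultimately have *: "3 * \<beta> * \<epsilon> * w + 3 * (\<beta> * \<epsilon> * \<kappa> * D) \<le> g" by linarith
  have "\<beta> * \<epsilon> * \<kappa> > 0" using \<beta>_pos \<epsilon> \<kappa> by simp
  from entropy_dual[OF \<mu>1 a1(2) this] obtain f where f: "continuous_on UNIV f" "bounded (range f)"
    "a1 < (\<integral>x. f x \<partial>\<mu>) - ln (tilt f (\<beta> * \<epsilon> * \<kappa>))" .
  have "\<beta> * w = \<beta> * w0 - g / 3" using \<beta>_pos by (simp add: w_def right_diff_distrib)
  moreover have "\<beta> * (1 - \<epsilon>) * w = \<beta> * w - \<beta> * \<epsilon> * w" by (simp add: algebra_simps)
  ultimately have "a < \<beta> * (1 - \<epsilon>) * w + (\<integral>x. f x \<partial>\<mu>) - ln (tilt f (\<beta> * \<epsilon> * \<kappa>)) - \<beta> * \<epsilon> * \<kappa> * D"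
    using f(3) * g by (simp add: g_def field_simps)
  moreover have "ereal w < enn2ereal (W \<mu>)"
    using True g \<beta>_pos by (cases "W \<mu>") (auto simp: w_def w0_def enn2ereal_ennreal)
  ultimately show thesis using f \<epsilon> that by blast
qed

text \<open>The diameter of the unit cube: it bounds \<open>bary\<close> inside the cube, hence also
  the mean, which is \<open>bary\<close> divided by \<open>sqrt n\<close>.\<close>

definition D0 :: real where "D0 = norm (One :: 'a)"

lemma D0_nonneg: "D0 \<ge> 0" by (simp add: D0_def)

lemma norm_mean_empirical_le:
  assumes n: "n > 0" and x: "bary n x \<in> cbox 0 One"
  shows "norm (\<integral>t. t \<partial>empirical n x) \<le> D0"
proof -
  have b: "norm (bary n x) \<le> D0"
    unfolding D0_def using x
    by (intro norm_le_componentwise) (auto simp: mem_box abs_le_iff intro: order_trans[of _ 0])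
  have "norm (\<integral>t. t \<partial>empirical n x) = norm ((1 / real n) *\<^sub>R (\<Sum>i<n. x i))"
    using n by (subst integral_empirical) auto
  also have "(1 / real n) *\<^sub>R (\<Sum>i<n. x i) = (1 / sqrt (real n)) *\<^sub>R bary n x"
    by (simp add: bary_def)
  also have "norm \<dots> \<le> 1 * norm (bary n x)"
    unfolding norm_scaleR using n by (intro mult_right_mono) auto
  finally show ?thesis using b by simp
qed

text \<open>On the event the integrand is at most K times a product of one-particle functions, so
  the integral factorises into \<open>tilt f r ^ n\<close>. The energy is split: the share
  \<epsilon> pays for the factors \<open>exp (- r * norm (x i))\<close> through growth control and
  the bounded mean, the rest is at least w per particle.\<close>

lemma mass_exp_bound:
  assumes f[measurable]: "f \<in> borel_measurable borel" and bf: "bounded (range f)"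
    and \<epsilon>: "0 < \<epsilon>" "\<epsilon> < 1" and n: "n > 0"
  defines "r \<equiv> \<beta> * \<epsilon> * \<kappa>"
  shows "mass n {\<mu> \<in> borel_probs. ereal w < enn2ereal (W \<mu>) \<and> (\<integral>x. f x \<partial>\<mu>) > t} \<le>
    ennreal (exp (- (real n * (\<beta> * (1 - \<epsilon>) * w + t - r * (D0 + 1) - ln (tilt f r)))))"
proof -
  have r: "r > 0" using \<beta>_pos \<epsilon> \<kappa> by (simp add: r_def)
  have tp: "tilt f r > 0" using f bf r by (rule tilt_pos)
  define A where "A = {\<mu> \<in> borel_probs. ereal w < enn2ereal (W \<mu>) \<and> (\<integral>x. f x \<partial>\<mu>) > t}"
  define K where "K = exp (- (real n * (\<beta> * (1 - \<epsilon>) * w + t - r * (D0 + 1))))"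
  have pw: "indicator (cbox 0 One) (bary n x) * (indicator A (empirical n x) * ennreal (exp (- (\<beta> * real n * E n x))))
      \<le> ennreal K * (\<Prod>i<n. ennreal (exp (f (x i) - r * norm (x i))))" for x
  proof (cases "bary n x \<in> cbox 0 One \<and> empirical n x \<in> A")
    case True
    then have x: "bary n x \<in> cbox 0 One" and w: "ereal w < enn2ereal (W (empirical n x))"
      and t: "(\<integral>s. f s \<partial>empirical n x) > t" by (auto simp: A_def)
    have W: "W (empirical n x) = ennreal (E n x)" using energy_eq[OF n, of x] by (simp add: energy_n_def)
    have w': "w \<le> E n x" using w E_nonneg by (simp add: W enn2ereal_ennreal)
    have "\<kappa> * ((\<integral>s. norm s \<partial>empirical n x) - norm (\<integral>s. s \<partial>empirical n x) - 1) \<le> E n x"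
      using W_ge_first_moment[OF empirical_in_borel_probs[OF n, of x]] W E_nonneg[of n x] by simp
    moreover have "(\<integral>s. norm s \<partial>empirical n x) = (\<Sum>i<n. norm (x i)) / real n"
      using n by (subst integral_empirical) (auto simp: divide_inverse mult.commute)
    ultimately have "\<kappa> * ((\<Sum>i<n. norm (x i)) / real n - norm (\<integral>s. s \<partial>empirical n x) - 1) \<le> E n x" by simp
    moreover have "\<kappa> * ((\<Sum>i<n. norm (x i)) / real n - D0 - 1) \<le> \<kappa> * ((\<Sum>i<n. norm (x i)) / real n - norm (\<integral>s. s \<partial>empirical n x) - 1)"
      using norm_mean_empirical_le[OF n x] \<kappa> by (intro mult_left_mono) auto
    ultimately have g: "\<kappa> * ((\<Sum>i<n. norm (x i)) / real n - D0 - 1) \<le> E n x" by linarith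
    have "\<beta> * \<epsilon> * real n * (\<kappa> * ((\<Sum>i<n. norm (x i)) / real n - D0 - 1)) \<le> \<beta> * \<epsilon> * real n * E n x"
      using g \<beta>_pos \<epsilon> by (intro mult_left_mono) auto
    then have 1: "r * (\<Sum>i<n. norm (x i)) - real n * (r * (D0 + 1)) \<le> \<beta> * \<epsilon> * real n * E n x"
    proof -
      have "real n * ((\<Sum>i<n. norm (x i)) / real n - D0 - 1) = (\<Sum>i<n. norm (x i)) - real n * (D0 + 1)"
        using n by (simp add: field_simps)
      moreover have "\<beta> * \<epsilon> * real n * (\<kappa> * t) = r * (real n * t)" for t by (simp add: r_def)
      ultimately have "\<beta> * \<epsilon> * real n * (\<kappa> * ((\<Sum>i<n. norm (x i)) / real n - D0 - 1)) =
          r * ((\<Sum>i<n. norm (x i)) - real n * (D0 + 1))" by (simp only:)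
      then show ?thesis
        using \<open>\<beta> * \<epsilon> * real n * (\<kappa> * _) \<le> _\<close> by (simp add: right_diff_distrib mult.left_commute)
    qed
    have 2: "real n * (\<beta> * (1 - \<epsilon>) * w) \<le> \<beta> * (1 - \<epsilon>) * real n * E n x"
    proof -
      have "\<beta> * (1 - \<epsilon>) * real n * w \<le> \<beta> * (1 - \<epsilon>) * real n * E n x"
        using w' \<beta>_pos \<epsilon> by (intro mult_left_mono) auto
      then show ?thesis by (simp add: ac_simps)
    qed
    have 3: "real n * t \<le> (\<Sum>i<n. f (x i))"
      using t n by (subst (asm) integral_empirical) (auto simp: field_simps)
    have "\<beta> * real n * E n x = \<beta> * \<epsilon> * real n * E n x + \<beta> * (1 - \<epsilon>) * real n * E n x" by (simp add: algebra_simps)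
    then have "- (\<beta> * real n * E n x) \<le> - (real n * (\<beta> * (1 - \<epsilon>) * w + t - r * (D0 + 1))) + ((\<Sum>i<n. f (x i)) - r * (\<Sum>i<n. norm (x i)))"
      using 1 2 3 by (simp add: algebra_simps)
    also have "(\<Sum>i<n. f (x i)) - r * (\<Sum>i<n. norm (x i)) = (\<Sum>i<n. f (x i) - r * norm (x i))"
      by (simp add: sum_subtractf sum_distrib_left)
    finally have "exp (- (\<beta> * real n * E n x)) \<le> K * (\<Prod>i<n. exp (f (x i) - r * norm (x i)))"
      unfolding K_def exp_sum[OF finite_lessThan, symmetric] exp_add[symmetric] by simp
    then have "ennreal (exp (- (\<beta> * real n * E n x))) \<le> ennreal (K * (\<Prod>i<n. exp (f (x i) - r * norm (x i))))"
      by (rule ennreal_leI)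
    also have "\<dots> = ennreal K * (\<Prod>i<n. ennreal (exp (f (x i) - r * norm (x i))))"
      by (simp add: ennreal_mult K_def prod_nonneg prod_ennreal)
    finally show ?thesis using True by simp
  qed auto
  have "mass n A \<le> (\<integral>\<^sup>+x. ennreal K * (\<Prod>i<n. ennreal (exp (f (x i) - r * norm (x i)))) \<partial>configs n)"
    unfolding mass_def by (intro nn_integral_mono pw)
  also have "\<dots> = ennreal K * (\<integral>\<^sup>+x. (\<Prod>i<n. ennreal (exp (f (x i) - r * norm (x i)))) \<partial>configs n)"
    by (intro nn_integral_cmult) measurable
  also have "(\<integral>\<^sup>+x. (\<Prod>i<n. ennreal (exp (f (x i) - r * norm (x i)))) \<partial>configs n) = (\<Prod>i<n. \<integral>\<^sup>+s. ennreal (exp (f s - r * norm s)) \<partial>lborel)"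
    by (rule lborel_product.product_nn_integral_prod) auto
  also have "(\<integral>\<^sup>+s. ennreal (exp (f s - r * norm s)) \<partial>lborel) = ennreal (tilt f r)"
    unfolding tilt_def by (intro nn_integral_eq_integral integrable_tilt f bf r) auto
  also have "ennreal K * (\<Prod>i<n. ennreal (tilt f r)) = ennreal (K * tilt f r ^ n)"
    using tp by (simp add: K_def ennreal_mult ennreal_power)
  also have "tilt f r ^ n = exp (real n * ln (tilt f r))"
    using tp by (simp add: exp_of_nat_mult)
  also have "K * exp (real n * ln (tilt f r)) = exp (- (real n * (\<beta> * (1 - \<epsilon>) * w + t - r * (D0 + 1) - ln (tilt f r))))"
    unfolding K_def exp_add[symmetric] by (simp add: algebra_simps)
  finally show ?thesis unfolding A_def .
qed

text \<open>One choice of f, w and \<epsilon> yields both conclusions, since the same splitting of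
  the energy is followed either by the Chebyshev estimate or by \<open>gibbs_variational_le\<close>.
  The radius R concerns the second conclusion only.\<close>

lemma local_bound:
  assumes \<mu>: "\<mu> \<in> borel_probs" and a: "ereal a < free_energy W \<sigma>2 \<mu>" and R: "R \<ge> 0"
  obtains U where "openin weak_topology U" "\<mu> \<in> U"
    "\<And>n. n > 0 \<Longrightarrow> mass n U \<le> ennreal (exp (- (real n * a)))"
    "\<And>\<nu>. \<nu> \<in> U \<Longrightarrow> (\<integral>\<^sup>+x. ennreal (norm x) \<partial>\<nu>) \<le> ennreal R \<Longrightarrow> ereal a \<le> free_energy W \<sigma>2 \<nu>"
proof -
  \<comment> \<open>At least D0 + 1 for configurations with barycentre in the cube, and at least R +
    1 for measures of first moment at most R, whose mean has norm at most R.\<close>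
  define D where "D = max D0 R + 1"
  have D: "D \<ge> 0" using R by (simp add: D_def)
  obtain f w \<epsilon> where f: "continuous_on UNIV f" "bounded (range f)" and \<epsilon>: "0 < \<epsilon>" "\<epsilon> < 1"
    and w: "ereal w < enn2ereal (W \<mu>)"
    and lt: "a < \<beta> * (1 - \<epsilon>) * w + (\<integral>x. f x \<partial>\<mu>) - ln (tilt f (\<beta> * \<epsilon> * \<kappa>)) - \<beta> * \<epsilon> * \<kappa> * D"
    using free_energy_dual[OF \<mu> a D] .
  have fm[measurable]: "f \<in> borel_measurable borel" using f(1) by (rule borel_measurable_continuous_onI)
  define r where "r = \<beta> * \<epsilon> * \<kappa>"
  have r: "r > 0" using \<beta>_pos \<epsilon> \<kappa> by (simp add: r_def)
  define gap where "gap = \<beta> * (1 - \<epsilon>) * w + (\<integral>x. f x \<partial>\<mu>) - ln (tilt f r) - r * D - a"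
  have gap: "gap > 0" using lt by (simp add: gap_def r_def)
  \<comment> \<open>Below the integral by exactly the gap: this keeps \<mu> in U and makes the
    exponent with D equal to a.\<close>
  define t where "t = (\<integral>x. f x \<partial>\<mu>) - gap"
  have t: "a = \<beta> * (1 - \<epsilon>) * w + t - ln (tilt f r) - r * D" by (simp add: t_def gap_def)
  define U where "U = {\<mu> \<in> borel_probs. ereal w < enn2ereal (W \<mu>) \<and> (\<integral>x. f x \<partial>\<mu>) > t}"
  have U_eq: "U = {\<mu> \<in> borel_probs. ereal w < enn2ereal (W \<mu>)} \<inter> {\<mu> \<in> borel_probs. (\<integral>x. f x \<partial>\<mu>) \<in> {t<..}}"
    by (auto simp: U_def)
  have "openin weak_topology U"
    unfolding U_eq by (intro openin_Int openin_W_gt openin_weak_topology_integral f) auto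
  moreover have "\<mu> \<in> U" using \<mu> w gap by (simp add: U_def t_def)
  moreover have "mass n U \<le> ennreal (exp (- (real n * a)))" if n: "n > 0" for n
  proof -
    have "mass n U \<le> ennreal (exp (- (real n * (\<beta> * (1 - \<epsilon>) * w + t - r * (D0 + 1) - ln (tilt f r)))))"
      unfolding U_def r_def by (rule mass_exp_bound[OF fm f(2) \<epsilon> n])
    also have "r * (D0 + 1) \<le> r * D" using r by (intro mult_left_mono) (auto simp: D_def)
    then have "real n * a \<le> real n * (\<beta> * (1 - \<epsilon>) * w + t - r * (D0 + 1) - ln (tilt f r))"
      unfolding t by (intro mult_left_mono) auto
    then have "ennreal (exp (- (real n * (\<beta> * (1 - \<epsilon>) * w + t - r * (D0 + 1) - ln (tilt f r))))) \<le> ennreal (exp (- (real n * a)))"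
      by (intro ennreal_leI) simp
    finally show ?thesis .
  qed
  moreover have "ereal a \<le> free_energy W \<sigma>2 \<nu>" if \<nu>U: "\<nu> \<in> U" and R\<nu>: "(\<integral>\<^sup>+x. ennreal (norm x) \<partial>\<nu>) \<le> ennreal R" for \<nu>
  proof (cases "W \<nu> < \<infinity>")
    case True
    have \<nu>: "\<nu> \<in> borel_probs" and w\<nu>: "ereal w < enn2ereal (W \<nu>)" and t\<nu>: "(\<integral>x. f x \<partial>\<nu>) > t" using \<nu>U by (auto simp: U_def)
    have \<nu>1: "\<nu> \<in> probs_moment 1" using W_finite_imp_moment_1[OF \<nu> True] .
    define w1 where "w1 = enn2real (W \<nu>)"
    have w1: "w \<le> w1" using w\<nu> True by (cases "W \<nu>") (auto simp: w1_def enn2ereal_ennreal)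
    have "ennreal (\<integral>x. norm x \<partial>\<nu>) \<le> ennreal R"
      using R\<nu> by (subst (asm) nn_integral_eq_integral[OF integrable_norm_probs_moment_1(1)[OF \<nu>1]]) auto
    then have "(\<integral>x. norm x \<partial>\<nu>) \<le> R" using R by simp
    moreover have "norm (\<integral>x. x \<partial>\<nu>) \<le> (\<integral>x. norm x \<partial>\<nu>)" by (rule integral_norm_bound)
    ultimately have "norm (\<integral>x. x \<partial>\<nu>) \<le> R" by linarith
    then have m: "norm (\<integral>x. x \<partial>\<nu>) \<le> D - 1" by (simp add: D_def)
    have "\<kappa> * ((\<integral>x. norm x \<partial>\<nu>) - D) \<le> \<kappa> * ((\<integral>x. norm x \<partial>\<nu>) - norm (\<integral>x. x \<partial>\<nu>) - 1)"
      using m \<kappa> by (intro mult_left_mono) auto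
    then have "\<kappa> * ((\<integral>x. norm x \<partial>\<nu>) - D) \<le> w1"
      using W_ge_first_moment[OF \<nu> True] by (simp add: w1_def)
    then have "\<beta> * \<epsilon> * (\<kappa> * ((\<integral>x. norm x \<partial>\<nu>) - D)) \<le> \<beta> * \<epsilon> * w1"
      using \<beta>_pos \<epsilon> by (intro mult_left_mono) auto
    then have 1: "r * (\<integral>x. norm x \<partial>\<nu>) - r * D \<le> \<beta> * \<epsilon> * w1" by (simp add: r_def algebra_simps)
    have 2: "\<beta> * (1 - \<epsilon>) * w \<le> \<beta> * (1 - \<epsilon>) * w1" using w1 \<beta>_pos \<epsilon> by (intro mult_left_mono) auto
    have "\<beta> * w1 = \<beta> * \<epsilon> * w1 + \<beta> * (1 - \<epsilon>) * w1" by (simp add: algebra_simps)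
    then have "a \<le> ((\<integral>x. f x \<partial>\<nu>) - r * (\<integral>x. norm x \<partial>\<nu>) - ln (tilt f r)) + \<beta> * w1"
      using 1 2 t\<nu> unfolding t by linarith
    then have "ereal a \<le> ereal ((\<integral>x. f x \<partial>\<nu>) - r * (\<integral>x. norm x \<partial>\<nu>) - ln (tilt f r)) + ereal (\<beta> * w1)" by simp
    also have "\<dots> \<le> entropy_fun \<nu> + ereal (\<beta> * w1)"
      by (intro add_right_mono gibbs_variational_le \<nu>1 fm f r)
    finally show ?thesis by (simp add: free_energy_W_finite[OF True] w1_def)
  qed (simp add: free_energy_W_infinite less_top[symmetric])
  ultimately show thesis using that by blast
qed

text \<open>High energy alone gives any exponential rate: \<open>mass_exp_bound\<close> with f = 0
  and \<epsilon> = 1/2, where the condition on the integral of f reads 0 > -1 and is void.\<close>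

lemma mass_tail:
  obtains L where "L \<ge> 0"
    "\<And>n. n > 0 \<Longrightarrow> mass n {\<mu> \<in> borel_probs. ereal L < enn2ereal (W \<mu>)} \<le> ennreal (exp (- (real n * a)))"
proof -
  define r where "r = \<beta> * (1/2) * \<kappa>"
  define T where "T = 1 + r * (D0 + 1) + ln (tilt (\<lambda>_::'a. 0) r)"
  define L where "L = max 0 ((a + T) / (\<beta> * (1/2)))"
  have "(a + T) / (\<beta> * (1/2)) \<le> L" by (simp add: L_def)
  then have L: "a + T \<le> \<beta> * (1/2) * L" using \<beta>_pos by (subst (asm) pos_divide_le_eq) (auto simp: mult.commute)
  have "mass n {\<mu> \<in> borel_probs. ereal L < enn2ereal (W \<mu>)} \<le> ennreal (exp (- (real n * a)))" if n: "n > 0" for n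
  proof -
    have "mass n {\<mu> \<in> borel_probs. ereal L < enn2ereal (W \<mu>) \<and> (\<integral>x. (0::real) \<partial>\<mu>) > - 1} \<le>
      ennreal (exp (- (real n * (\<beta> * (1 - 1/2) * L + (- 1) - r * (D0 + 1) - ln (tilt (\<lambda>_::'a. 0) r)))))"
      using mass_exp_bound[of "\<lambda>_. 0" "1/2" n L "- 1"] n unfolding r_def by simp
    also have "real n * a \<le> real n * (\<beta> * (1 - 1/2) * L + (- 1) - r * (D0 + 1) - ln (tilt (\<lambda>_::'a. 0) r))"
      using L by (intro mult_left_mono) (auto simp: T_def)
    then have "ennreal (exp (- (real n * (\<beta> * (1 - 1/2) * L + (- 1) - r * (D0 + 1) - ln (tilt (\<lambda>_::'a. 0) r))))) \<le> ennreal (exp (- (real n * a)))"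
      by (intro ennreal_leI) simp
    finally show ?thesis by simp
  qed
  moreover have "L \<ge> 0" by (simp add: L_def)
  ultimately show thesis using that by blast
qed

theorem upper_bound:
  assumes C: "closedin weak_topology C" and a: "\<And>\<mu>. \<mu> \<in> C \<Longrightarrow> ereal a < free_energy W \<sigma>2 \<mu>"
  obtains M :: nat where "\<And>n. n > 0 \<Longrightarrow> mass n C \<le> of_nat M * ennreal (exp (- (real n * a)))"
proof -
  obtain L where L: "L \<ge> 0"
    "\<And>n. n > 0 \<Longrightarrow> mass n {\<mu> \<in> borel_probs. ereal L < enn2ereal (W \<mu>)} \<le> ennreal (exp (- (real n * a)))"
    by (rule mass_tail[of a]) auto
  \<comment> \<open>A configuration with energy at most L and barycentre in the cube has first
    moment at most \<open>L / \<kappa> + D0 + 1\<close>, so its empirical measure lies in the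
    compact set K.\<close>
  define R where "R = L / \<kappa> + D0 + 1"
  have R: "R \<ge> 0" using L \<kappa> D0_nonneg by (simp add: R_def)
  define K where "K = {\<mu> \<in> borel_probs. (\<integral>\<^sup>+x. ennreal (norm (x::'a)) \<partial>\<mu>) \<le> ennreal R}"
  have CK: "compactin weak_topology (K \<inter> C)"
    unfolding K_def using compactin_first_moment_le C by (rule compact_Int_closedin)
  have Csub: "C \<subseteq> borel_probs" using closedin_subset[OF C] by simp
  \<comment> \<open>Only the mass estimate of \<open>local_bound\<close> is used here, so any radius
    will do; 0 is taken.\<close>
  have "\<exists>U. openin weak_topology U \<and> \<mu> \<in> U \<and> (\<forall>n>0. mass n U \<le> ennreal (exp (- (real n * a))))" if "\<mu> \<in> K \<inter> C" for \<mu>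
    using local_bound[of \<mu> a 0] a[of \<mu>] that by (metis IntD1 IntD2 K_def mem_Collect_eq order_refl)
  then obtain V where V: "\<And>\<mu>. \<mu> \<in> K \<inter> C \<Longrightarrow> openin weak_topology (V \<mu>) \<and> \<mu> \<in> V \<mu> \<and> (\<forall>n>0. mass n (V \<mu>) \<le> ennreal (exp (- (real n * a))))"
    by metis
  have "(\<forall>U\<in>V ` (K \<inter> C). openin weak_topology U) \<and> K \<inter> C \<subseteq> \<Union> (V ` (K \<inter> C))" using V by blast
  then obtain F where F: "finite F" "F \<subseteq> V ` (K \<inter> C)" "K \<inter> C \<subseteq> \<Union> F"
    using CK unfolding compactin_def by meson
  have Fo: "openin weak_topology U" "\<And>n. n > 0 \<Longrightarrow> mass n U \<le> ennreal (exp (- (real n * a)))" if "U \<in> F" for U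
    using F(2) V that by blast+
  let ?T = "{\<mu> \<in> borel_probs. ereal L < enn2ereal (W \<mu>)}"
  \<comment> \<open>The covering neighbourhoods and one tail set give a constant that does not
    depend on n.\<close>
  have "mass n C \<le> of_nat (Suc (card F)) * ennreal (exp (- (real n * a)))" if n: "n > 0" for n
  proof -
    note [measurable] = E_measurable[OF n] indicator_empirical_measurable[OF n openin_sets_borel_of[OF openin_W_gt[of L]]]
    have Fm: "(\<lambda>x. indicator U (empirical n x) :: ennreal) \<in> borel_measurable (configs n)" if "U \<in> F" for U
      using indicator_empirical_measurable[OF n openin_sets_borel_of[OF Fo(1)[OF that]]] by simp
    let ?w = "\<lambda>x. ennreal (exp (- (\<beta> * real n * E n x)))"
    let ?i = "\<lambda>x. indicator (cbox 0 One) (bary n x) :: ennreal"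
    \<comment> \<open>The factor with the cube is essential: outside the cube both sides vanish, and
      inside it an empirical measure in C has either high energy or bounded first moment, hence lies
      in some U.\<close>
    have pw: "?i x * (indicator C (empirical n x) * ?w x) \<le> ?i x * (indicator ?T (empirical n x) * ?w x) +
        (\<Sum>U\<in>F. ?i x * (indicator U (empirical n x) * ?w x))" for x
    proof (cases "bary n x \<in> cbox 0 One \<and> empirical n x \<in> C \<and> empirical n x \<notin> ?T")
      case True
      then have x: "bary n x \<in> cbox 0 One" and eC: "empirical n x \<in> C" and
        WL: "enn2ereal (W (empirical n x)) \<le> ereal L"
        using empirical_in_borel_probs[OF n] by auto
      have We: "W (empirical n x) = ennreal (E n x)" using energy_eq[OF n, of x] by (simp add: energy_n_def)
      have EL: "E n x \<le> L" using WL E_nonneg by (simp add: We enn2ereal_ennreal)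
      have fin: "W (empirical n x) < \<infinity>" by (simp add: We)
      note e1 = W_finite_imp_moment_1[OF empirical_in_borel_probs[OF n] fin]
      have "\<kappa> * ((\<integral>s. norm s \<partial>empirical n x) - norm (\<integral>s. s \<partial>empirical n x) - 1) \<le> L"
        using W_ge_first_moment[OF empirical_in_borel_probs[OF n] fin] EL E_nonneg by (simp add: We)
      then have "(\<integral>s. norm s \<partial>empirical n x) - norm (\<integral>s. s \<partial>empirical n x) - 1 \<le> L / \<kappa>"
        using \<kappa> by (simp add: field_simps)
      then have "(\<integral>s. norm s \<partial>empirical n x) \<le> R"
        using norm_mean_empirical_le[OF n x] by (simp add: R_def)
      then have "(\<integral>\<^sup>+s. ennreal (norm s) \<partial>empirical n x) \<le> ennreal R"
        by (subst nn_integral_eq_integral[OF integrable_norm_probs_moment_1(1)[OF e1]]) (auto intro: ennreal_leI)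
      then have "empirical n x \<in> K \<inter> C" using eC empirical_in_borel_probs[OF n] by (simp add: K_def)
      then obtain U where U: "U \<in> F" "empirical n x \<in> U" using F(3) by blast
      have "?i x * (indicator C (empirical n x) * ?w x) = ?i x * (indicator U (empirical n x) * ?w x)"
        using U eC by simp
      also have "\<dots> \<le> (\<Sum>U\<in>F. ?i x * (indicator U (empirical n x) * ?w x))"
        using U F(1) by (intro member_le_sum) auto
      finally show ?thesis by (simp add: add_increasing)
    next
      case False
      then have "?i x * (indicator C (empirical n x) * ?w x) \<le> ?i x * (indicator ?T (empirical n x) * ?w x)"
        by (auto simp: indicator_def)
      then show ?thesis by (simp add: add_increasing2)
    qed
    have "mass n C \<le> (\<integral>\<^sup>+x. ?i x * (indicator ?T (empirical n x) * ?w x) +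
        (\<Sum>U\<in>F. ?i x * (indicator U (empirical n x) * ?w x)) \<partial>configs n)"
      unfolding mass_def by (intro nn_integral_mono pw)
    also have "\<dots> = mass n ?T + (\<Sum>U\<in>F. mass n U)"
      unfolding mass_def using Fm by (subst nn_integral_add) (auto simp: nn_integral_sum)
    also have "\<dots> \<le> ennreal (exp (- (real n * a))) + (\<Sum>U\<in>F. ennreal (exp (- (real n * a))))"
      using n by (intro add_mono sum_mono L Fo)
    also have "\<dots> = of_nat (Suc (card F)) * ennreal (exp (- (real n * a)))"
      by (simp add: distrib_right)
    finally show ?thesis .
  qed
  then show thesis using that by blast
qed

end

section \<open>Lower bound\<close>

lemma distr_configs_shift:
  fixes y :: "'a::euclidean_space"
  shows "distr (\<Pi>\<^sub>M i\<in>{..<n::nat}. lborel) (\<Pi>\<^sub>M i\<in>{..<n}. lborel) (\<lambda>x. \<lambda>i\<in>{..<n}. x i + y) = (\<Pi>\<^sub>M i\<in>{..<n}. lborel)"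
proof (rule lborel_product.PiM_eqI)
  fix A :: "nat \<Rightarrow> 'a set" assume A: "\<And>i. i \<in> {..<n} \<Longrightarrow> A i \<in> sets lborel"
  have m: "(\<lambda>x. \<lambda>i\<in>{..<n}. x i + y) \<in> measurable (\<Pi>\<^sub>M i\<in>{..<n}. lborel) (\<Pi>\<^sub>M i\<in>{..<n}. lborel)"
    by measurable
  have A': "(\<lambda>z. z + y) -` A i \<in> sets borel" if "i \<in> {..<n}" for i
    using measurable_sets[of "\<lambda>z. z + y" borel borel "A i"] A[OF that] by simp
  have "(\<lambda>x. \<lambda>i\<in>{..<n}. x i + y) -` (Pi\<^sub>E {..<n} A) \<inter> space (\<Pi>\<^sub>M i\<in>{..<n}. lborel) = Pi\<^sub>E {..<n} (\<lambda>i. (\<lambda>z. z + y) -` A i)"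
    by (auto simp: space_PiM PiE_iff extensional_def)
  then have "emeasure (distr (\<Pi>\<^sub>M i\<in>{..<n}. lborel) (\<Pi>\<^sub>M i\<in>{..<n}. lborel) (\<lambda>x. \<lambda>i\<in>{..<n}. x i + y)) (Pi\<^sub>E {..<n} A) =
      emeasure (\<Pi>\<^sub>M i\<in>{..<n}. lborel) (Pi\<^sub>E {..<n} (\<lambda>i. (\<lambda>z. z + y) -` A i))"
    using A by (subst emeasure_distr[OF m]) (auto intro!: sets_PiM_I_finite)
  also have "\<dots> = (\<Prod>i<n. emeasure lborel ((\<lambda>z. z + y) -` A i))"
    using A' by (intro lborel_product.emeasure_PiM) auto
  also have "\<dots> = (\<Prod>i<n. emeasure lborel (A i))"
  proof (intro prod.cong refl)
    fix i assume i: "i \<in> {..<n}"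
    then have [measurable]: "A i \<in> sets borel" using A by simp
    have "(\<integral>\<^sup>+z. indicator (A i) (z + y) \<partial>lborel) = (\<integral>\<^sup>+z. indicator ((\<lambda>z. z + y) -` A i) z \<partial>lborel)"
      by (intro nn_integral_cong) (simp add: indicator_def)
    also have "\<dots> = emeasure lborel ((\<lambda>z. z + y) -` A i)" using A'[OF i] by simp
    finally show "emeasure lborel ((\<lambda>z. z + y) -` A i) = emeasure lborel (A i)"
      using nn_integral_lborel_shift[of "indicator (A i)" y] by simp
  qed
  finally show "emeasure (distr (\<Pi>\<^sub>M i\<in>{..<n}. lborel) (\<Pi>\<^sub>M i\<in>{..<n}. lborel) (\<lambda>x. \<lambda>i\<in>{..<n}. x i + y)) (Pi\<^sub>E {..<n} A) =
    (\<Prod>i<n. emeasure lborel (A i))" .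
qed auto

lemma nn_integral_configs_shift:
  fixes y :: "'a::euclidean_space"
  assumes "f \<in> borel_measurable (\<Pi>\<^sub>M i\<in>{..<n::nat}. lborel)"
  shows "(\<integral>\<^sup>+x. f (\<lambda>i\<in>{..<n}. x i + y) \<partial>(\<Pi>\<^sub>M i\<in>{..<n}. lborel)) = (\<integral>\<^sup>+x. f x \<partial>(\<Pi>\<^sub>M i\<in>{..<n}. lborel))"
proof -
  have "(\<integral>\<^sup>+x. f x \<partial>(\<Pi>\<^sub>M i\<in>{..<n}. lborel)) =
      (\<integral>\<^sup>+x. f x \<partial>distr (\<Pi>\<^sub>M i\<in>{..<n}. lborel) (\<Pi>\<^sub>M i\<in>{..<n}. lborel) (\<lambda>x. \<lambda>i\<in>{..<n}. x i + y))"
    by (simp only: distr_configs_shift)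
  also have "\<dots> = (\<integral>\<^sup>+x. f (\<lambda>i\<in>{..<n}. x i + y) \<partial>(\<Pi>\<^sub>M i\<in>{..<n}. lborel))"
  proof (rule nn_integral_distr)
    show "(\<lambda>x. \<lambda>i\<in>{..<n}. x i + y) \<in> measurable (\<Pi>\<^sub>M i\<in>{..<n}. lborel) (\<Pi>\<^sub>M i\<in>{..<n}. lborel)"
      by measurable
  qed (simp add: assms)
  finally show ?thesis by simp
qed

text \<open>The change of reference measure: expectations over n independent samples of \<mu> become
  integrals over configurations.\<close>

lemma PiM_density_lborel:
  assumes d: "prob_density \<mu> p"
  shows "(\<Pi>\<^sub>M i\<in>{..<n::nat}. \<mu>) = density (\<Pi>\<^sub>M i\<in>{..<n}. lborel) (\<lambda>x. \<Prod>i<n. ennreal (p (x i)))"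
proof -
  note [measurable] = prob_densityD(1)[OF d]
  interpret prob_space \<mu> using d by (rule prob_densityD)
  interpret P: product_sigma_finite "\<lambda>_::nat. \<mu>" by standard
  have s: "sets \<mu> = sets borel" using prob_densityD(7)[OF d] by (rule borel_probsD)
  show ?thesis
  proof (rule P.PiM_eqI[symmetric])
    show "sets (density (\<Pi>\<^sub>M i\<in>{..<n}. lborel) (\<lambda>x. \<Prod>i<n. ennreal (p (x i)))) = sets (\<Pi>\<^sub>M i\<in>{..<n}. \<mu>)"
      unfolding sets_density by (intro sets_PiM_cong) (auto simp: s)
    fix A assume "\<And>i. i \<in> {..<n} \<Longrightarrow> A i \<in> sets \<mu>"
    then have A[measurable]: "\<And>i. i \<in> {..<n} \<Longrightarrow> A i \<in> sets borel" by (simp add: s)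
    have "emeasure (density (\<Pi>\<^sub>M i\<in>{..<n}. lborel) (\<lambda>x. \<Prod>i<n. ennreal (p (x i)))) (Pi\<^sub>E {..<n} A) =
      (\<integral>\<^sup>+x. (\<Prod>i<n. ennreal (p (x i))) * indicator (Pi\<^sub>E {..<n} A) x \<partial>(\<Pi>\<^sub>M i\<in>{..<n}. lborel))"
      using A by (intro emeasure_density) (auto intro!: sets_PiM_I_finite)
    also have "\<dots> = (\<integral>\<^sup>+x. (\<Prod>i<n. ennreal (p (x i)) * indicator (A i) (x i)) \<partial>(\<Pi>\<^sub>M i\<in>{..<n}. lborel))"
    proof (intro nn_integral_cong)
      fix x :: "nat \<Rightarrow> 'a" assume x: "x \<in> space (\<Pi>\<^sub>M i\<in>{..<n}. lborel)"
      have "indicator (Pi\<^sub>E {..<n} A) x = (\<Prod>i<n. indicator (A i) (x i) :: ennreal)"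
      proof (cases "x \<in> Pi\<^sub>E {..<n} A")
        case False
        then obtain i where "i < n" "x i \<notin> A i" using x by (auto simp: space_PiM PiE_iff)
        then have "(\<Prod>i<n. indicator (A i) (x i) :: ennreal) = 0" by (intro prod_zero bexI[of _ i]) auto
        with False show ?thesis by simp
      qed (auto simp: PiE_iff)
      then show "(\<Prod>i<n. ennreal (p (x i))) * indicator (Pi\<^sub>E {..<n} A) x = (\<Prod>i<n. ennreal (p (x i)) * indicator (A i) (x i))"
        by (simp add: prod.distrib)
    qed
    also have "\<dots> = (\<Prod>i<n. \<integral>\<^sup>+z. ennreal (p z) * indicator (A i) z \<partial>lborel)"
      using A by (intro lborel_product.product_nn_integral_prod) auto
    also have "\<dots> = (\<Prod>i<n. emeasure \<mu> (A i))"
      unfolding prob_densityD(3)[OF d] using A by (intro prod.cong refl emeasure_density[symmetric]) auto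
    finally show "emeasure (density (\<Pi>\<^sub>M i\<in>{..<n}. lborel) (\<lambda>x. \<Prod>i<n. ennreal (p (x i)))) (Pi\<^sub>E {..<n} A) =
      (\<Prod>i<n. emeasure \<mu> (A i))" .
  qed simp
qed

lemma emeasure_unit_cube_reflect:
  fixes b :: "'a::euclidean_space"
  shows "(\<integral>\<^sup>+y. indicator (cbox 0 One) (b - y) \<partial>lborel) = 1"
proof -
  have "b - y \<in> cbox 0 One \<longleftrightarrow> y \<in> cbox (b - One) b" for y :: 'a
    by (auto simp: mem_box inner_diff_left algebra_simps)
  then have "(\<integral>\<^sup>+y. indicator (cbox 0 One) (b - y) \<partial>lborel) = (\<integral>\<^sup>+y. indicator (cbox (b - One) b) y \<partial>lborel)"
    by (intro nn_integral_cong) (simp add: indicator_def)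
  also have "\<dots> = 1" by (simp add: emeasure_lborel_cbox_eq inner_diff_left)
  finally show ?thesis .
qed

context confining_energy
begin

text \<open>With the scaling by \<open>1 / sqrt n\<close> in both places, a common shift of all
  particles moves the barycentre coordinate by exactly y.\<close>

lemma bary_shift:
  assumes "n > 0"
  shows "bary n (\<lambda>i\<in>{..<n}. x i + (1 / sqrt (real n)) *\<^sub>R y) = bary n x + y"
proof -
  have "bary n (\<lambda>i\<in>{..<n}. x i + (1 / sqrt (real n)) *\<^sub>R y) = (1 / sqrt (real n)) *\<^sub>R (\<Sum>i<n. x i + (1 / sqrt (real n)) *\<^sub>R y)"
    unfolding bary_def by simp
  also have "\<dots> = bary n x + (1 / sqrt (real n) * (real n * (1 / sqrt (real n)))) *\<^sub>R y"
    by (simp add: bary_def sum.distrib scaleR_add_right sum_constant_scaleR del: sum_constant)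
  also have "1 / sqrt (real n) * (real n * (1 / sqrt (real n))) = 1"
    using assms by (simp add: field_simps)
  finally show ?thesis by (simp only: scaleR_one)
qed

text \<open>A translation-invariant integrand does not see which weight is put on the barycentre:
  apply Tonelli to the weight \<open>g (bary n x + y) * indicator (cbox 0 One) (bary n x)\<close> in \<open>(x, y)\<close> and translate \<open>x\<close>.\<close>

lemma nn_integral_bary_weight:
  assumes n: "n > 0" and g[measurable]: "g \<in> borel_measurable borel"
    and h[measurable]: "h \<in> borel_measurable (configs n)"
    and hinv: "\<And>x y. h (\<lambda>i\<in>{..<n}. x i + y) = h x"
  shows "(\<integral>\<^sup>+x. g (bary n x) * h x \<partial>configs n) =
    (\<integral>\<^sup>+y. g y \<partial>lborel) * (\<integral>\<^sup>+x. indicator (cbox 0 One) (bary n x) * h x \<partial>configs n)"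
proof -
  interpret FP: finite_product_sigma_finite "\<lambda>_::nat. lborel :: 'a measure" "{..<n}" by standard simp
  interpret P: pair_sigma_finite "configs n" "lborel :: 'a measure" ..
  let ?q = "\<lambda>x. indicator (cbox 0 One) (bary n x) :: ennreal"
  have "(\<integral>\<^sup>+y. \<integral>\<^sup>+x. g (bary n x + y) * (?q x * h x) \<partial>configs n \<partial>lborel) =
    (\<integral>\<^sup>+x. \<integral>\<^sup>+y. g (bary n x + y) * (?q x * h x) \<partial>lborel \<partial>configs n)"
    by (rule P.Fubini'[of "\<lambda>x y. g (bary n x + y) * (?q x * h x)"]) measurable
  also have "\<dots> = (\<integral>\<^sup>+x. (\<integral>\<^sup>+y. g y \<partial>lborel) * (?q x * h x) \<partial>configs n)"
  proof (rule nn_integral_cong)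
    fix x
    have "(\<integral>\<^sup>+y. g (bary n x + y) * (?q x * h x) \<partial>lborel) = (\<integral>\<^sup>+y. g (bary n x + y) \<partial>lborel) * (?q x * h x)"
      by (rule nn_integral_multc) measurable
    then show "(\<integral>\<^sup>+y. g (bary n x + y) * (?q x * h x) \<partial>lborel) = (\<integral>\<^sup>+y. g y \<partial>lborel) * (?q x * h x)"
      using nn_integral_lborel_shift[of g "bary n x"] by (simp add: add.commute)
  qed
  also have "\<dots> = (\<integral>\<^sup>+y. g y \<partial>lborel) * (\<integral>\<^sup>+x. ?q x * h x \<partial>configs n)"
    by (rule nn_integral_cmult) measurable
  finally have 1: "(\<integral>\<^sup>+y. \<integral>\<^sup>+x. g (bary n x + y) * (?q x * h x) \<partial>configs n \<partial>lborel) =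
    (\<integral>\<^sup>+y. g y \<partial>lborel) * (\<integral>\<^sup>+x. ?q x * h x \<partial>configs n)" .
  have "(\<integral>\<^sup>+y. \<integral>\<^sup>+x. g (bary n x + y) * (?q x * h x) \<partial>configs n \<partial>lborel) =
    (\<integral>\<^sup>+y. \<integral>\<^sup>+x. g (bary n x) * (indicator (cbox 0 One) (bary n x - y) * h x) \<partial>configs n \<partial>lborel)"
  proof (rule nn_integral_cong)
    fix y :: 'a
    let ?f = "\<lambda>x. g (bary n x) * (indicator (cbox 0 One) (bary n x - y) * h x)"
    have "(\<integral>\<^sup>+x. ?f x \<partial>configs n) = (\<integral>\<^sup>+x. ?f (\<lambda>i\<in>{..<n}. x i + (1 / sqrt (real n)) *\<^sub>R y) \<partial>configs n)"
      by (rule nn_integral_configs_shift[symmetric]) measurable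
    then show "(\<integral>\<^sup>+x. g (bary n x + y) * (?q x * h x) \<partial>configs n) = (\<integral>\<^sup>+x. ?f x \<partial>configs n)"
      by (simp add: bary_shift[OF n] hinv)
  qed
  also have "\<dots> = (\<integral>\<^sup>+x. \<integral>\<^sup>+y. g (bary n x) * (indicator (cbox 0 One) (bary n x - y) * h x) \<partial>lborel \<partial>configs n)"
    by (rule P.Fubini'[of "\<lambda>x y. g (bary n x) * (indicator (cbox 0 One) (bary n x - y) * h x)"]) measurable
  also have "\<dots> = (\<integral>\<^sup>+x. g (bary n x) * h x \<partial>configs n)"
  proof (rule nn_integral_cong)
    fix x
    have "(\<integral>\<^sup>+y. g (bary n x) * (indicator (cbox 0 One) (bary n x - y) * h x) \<partial>lborel) =
      (\<integral>\<^sup>+y. indicator (cbox 0 One) (bary n x - y) * (g (bary n x) * h x) \<partial>lborel)"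
      by (simp add: ac_simps)
    also have "\<dots> = (\<integral>\<^sup>+y. indicator (cbox 0 One) (bary n x - y) \<partial>lborel) * (g (bary n x) * h x)"
      by (rule nn_integral_multc) measurable
    finally show "(\<integral>\<^sup>+y. g (bary n x) * (indicator (cbox 0 One) (bary n x - y) * h x) \<partial>lborel) = g (bary n x) * h x"
      by (simp add: emeasure_unit_cube_reflect)
  qed
  finally show ?thesis using 1 by simp
qed

lemma mass_integrand_shift:
  assumes n: "n > 0" and A: "transl_inv A"
  shows "(indicator A (empirical n (\<lambda>i\<in>{..<n}. x i + y)) :: ennreal) * ennreal (exp (- (\<beta> * real n * E n (\<lambda>i\<in>{..<n}. x i + y)))) =
    indicator A (empirical n x) * ennreal (exp (- (\<beta> * real n * E n x)))"
proof -
  have e: "empirical n (\<lambda>i\<in>{..<n}. x i + y) = translate y (empirical n x)"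
    unfolding translate_empirical[OF n] by (rule empirical_cong) simp
  have "E n (\<lambda>i\<in>{..<n}. x i + y) = E n (\<lambda>i. x i + y)" by (rule E_cong) simp
  moreover have "translate y (empirical n x) \<in> A \<longleftrightarrow> empirical n x \<in> A"
    using A empirical_in_borel_probs[OF n, of x] unfolding transl_inv_def by blast
  ultimately show ?thesis by (simp add: e E_translate[OF n] indicator_def)
qed

text \<open>Used with the weight 1 to see that the partition function is positive, and with
  \<open>exp (- norm y)\<close> to compare masses with independent samples.\<close>

lemma nn_integral_weight_mass:
  assumes n: "n > 0" and A: "A \<in> sets (borel_of weak_topology)" "transl_inv A"
    and g: "g \<in> borel_measurable borel"
  shows "(\<integral>\<^sup>+x. g (bary n x) * (indicator A (empirical n x) * ennreal (exp (- (\<beta> * real n * E n x)))) \<partial>configs n) =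
    (\<integral>\<^sup>+y. g y \<partial>lborel) * mass n A"
  unfolding mass_def
proof (rule nn_integral_bary_weight[OF n g _ mass_integrand_shift[OF n A(2)]])
  note [measurable] = E_measurable[OF n] indicator_empirical_measurable[OF n A(1)]
  show "(\<lambda>x. indicator A (empirical n x) * ennreal (exp (- (\<beta> * real n * E n x)))) \<in> borel_measurable (configs n)"
    by measurable
qed

lemma partition_pos:
  assumes n: "n > 0"
  shows "mass n borel_probs > 0"
proof -
  note [measurable] = E_measurable[OF n]
  have "mass n borel_probs \<noteq> 0"
  proof
    \<comment> \<open>With weight 1 the factor in front of the mass is infinite, and infinity times
      0 is 0 in ennreal. So the integral without the cube would vanish too, although its integrand
      is positive.\<close>
    assume "mass n borel_probs = 0"
    then have "(\<integral>\<^sup>+x. ennreal (exp (- (\<beta> * real n * E n x))) \<partial>configs n) = 0"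
      using nn_integral_weight_mass[OF n borel_probs_sets transl_inv_borel_probs, of "\<lambda>_. 1"]
      by (simp add: empirical_in_borel_probs[OF n])
    then have "AE x in configs n. ennreal (exp (- (\<beta> * real n * E n x))) = 0"
      by (subst (asm) nn_integral_0_iff_AE) auto
    then have "AE x in configs n. False" by simp
    then have "emeasure (configs n) (space (configs n)) = 0"
      by (simp add: eventually_False ae_filter_eq_bot_iff)
    moreover have "emeasure (configs n) (space (configs n)) = (\<Prod>i<n. emeasure lborel (UNIV :: 'a set))"
      unfolding space_PiM by (subst lborel_product.emeasure_PiM) auto
    ultimately show False using n by (simp add: ennreal_top_eq_mult_iff power_0_left)
  qed
  then show ?thesis by (simp add: zero_less_iff_neq_zero)
qed

lemma partition_finite:
  assumes n: "n > 0"
  shows "mass n borel_probs < \<infinity>"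
proof -
  \<comment> \<open>Both conditions are void, so the set is all of
    \<open>borel_probs\<close>.\<close>
  have "mass n {\<mu> \<in> borel_probs. ereal (- 1) < enn2ereal (W \<mu>) \<and> (\<integral>x. (0::real) \<partial>\<mu>) > - 1} < \<infinity>"
    using mass_exp_bound[of "\<lambda>_. 0" "1/2" n "- 1" "- 1"] n by (simp add: le_less_trans)
  moreover have "ereal (- 1) < enn2ereal t" for t by (rule order_less_le_trans[of _ 0]) auto
  ultimately show ?thesis by simp
qed

lemma prob_space_gibbs_orbit:
  assumes n: "n > 0"
  shows "prob_space (gibbs_orbit W \<sigma>2 n)"
proof
  have sp: "space (gibbs_orbit W \<sigma>2 n) = orbit ` (borel_probs :: 'a measure set)"
    by (simp add: gibbs_orbit_def orbit_topology_def)
  have "lift_orbit (space (gibbs_orbit W \<sigma>2 n)) = borel_probs" by (auto simp: sp lift_orbit_def)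
  moreover have "space (gibbs_orbit W \<sigma>2 n) \<in> sets (borel_of orbit_topology)"
    using sets.top[of "borel_of orbit_topology"] by (simp add: sp orbit_topology_def)
  ultimately show "emeasure (gibbs_orbit W \<sigma>2 n) (space (gibbs_orbit W \<sigma>2 n)) = 1"
    using partition_pos[OF n] partition_finite[OF n]
    by (simp add: emeasure_gibbs_orbit[OF n] ennreal_divide_self)
qed

end

section \<open>Independent samples and the weak law of large numbers\<close>

locale iid_sequence =
  fixes \<mu> :: "'a::euclidean_space measure"
  assumes \<mu>: "\<mu> \<in> borel_probs"
begin

text \<open>The canonical space of sequences, of the type over which \<open>chaos_compatible\<close>
  quantifies its sample spaces; the coordinates are the sample.\<close>

abbreviation \<Omega> :: "(nat \<Rightarrow> 'a) measure" where "\<Omega> \<equiv> \<Pi>\<^sub>M i\<in>UNIV. \<mu>"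

lemma sets_\<mu> [measurable_cong, simp]: "sets \<mu> = sets borel" using \<mu> by (rule borel_probsD)

sublocale M: prob_space \<mu> using \<mu> by (rule borel_probsD)

sublocale O: prob_space \<Omega> by (intro prob_space_PiM M.prob_space_axioms)

sublocale PP: product_prob_space "\<lambda>_::nat. \<mu>" UNIV by standard

lemma sets_\<Omega>: "sets \<Omega> = sets (\<Pi>\<^sub>M i\<in>UNIV. borel)" by (intro sets_PiM_cong) auto

lemma distr_coordinate: "distr \<Omega> borel (\<lambda>\<omega>. \<omega> i) = \<mu>"
proof -
  have "distr \<Omega> borel (\<lambda>\<omega>. \<omega> i) = distr \<Omega> \<mu> (\<lambda>\<omega>. \<omega> i)" by (rule distr_cong) auto
  then show ?thesis using PP.PiM_component[of i] by simp
qed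

lemma coordinate_measurable [measurable]: "(\<lambda>\<omega>. \<omega> i) \<in> borel_measurable \<Omega>"
proof -
  have "(\<lambda>\<omega>. \<omega> i) \<in> measurable \<Omega> \<mu>" by (rule measurable_component_singleton) simp
  also have "measurable \<Omega> \<mu> = borel_measurable \<Omega>" by (rule measurable_cong_sets) auto
  finally show ?thesis .
qed

lemma integral_coordinate:
  fixes f :: "'a \<Rightarrow> real"
  shows "f \<in> borel_measurable borel \<Longrightarrow> (\<integral>\<omega>. f (\<omega> i) \<partial>\<Omega>) = (\<integral>x. f x \<partial>\<mu>)"
  using integral_distr[of "\<lambda>\<omega>. \<omega> i" \<Omega> borel f] by (simp add: distr_coordinate)

lemma integrable_coordinate:
  fixes f :: "'a \<Rightarrow> real"
  shows "f \<in> borel_measurable borel \<Longrightarrow> integrable \<Omega> (\<lambda>\<omega>. f (\<omega> i)) \<longleftrightarrow> integrable \<mu> f"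
  using integrable_distr_eq[of "\<lambda>\<omega>. \<omega> i" \<Omega> borel f] by (simp add: distr_coordinate)

lemma indep_coordinates: "O.indep_vars (\<lambda>_. borel) (\<lambda>i \<omega>. \<omega> i) UNIV"
proof (subst O.indep_vars_iff_distr_eq_PiM)
  have "distr \<Omega> (\<Pi>\<^sub>M i\<in>UNIV. borel) (\<lambda>\<omega>. \<lambda>i\<in>UNIV. \<omega> i) = \<Omega>"
    unfolding restrict_UNIV by (rule distr_id2) (simp add: sets_\<Omega>)
  then show "distr \<Omega> (\<Pi>\<^sub>M i\<in>UNIV. borel) (\<lambda>\<omega>. \<lambda>i\<in>UNIV. \<omega> i) = (\<Pi>\<^sub>M i\<in>UNIV. distr \<Omega> borel (\<lambda>\<omega>. \<omega> i))"
    by (simp add: distr_coordinate)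
qed auto

lemma measurable_restrict_\<Omega>: "(\<lambda>\<omega>. restrict \<omega> {..<n}) \<in> measurable \<Omega> (\<Pi>\<^sub>M i\<in>{..<n}. borel)"
  by (rule measurable_restrict) auto

lemma measurable_finite_coordinates:
  assumes "f \<in> measurable (\<Pi>\<^sub>M i\<in>{..<n}. borel) N" "\<And>\<omega>. f (restrict \<omega> {..<n}) = f \<omega>"
  shows "f \<in> measurable \<Omega> N"
  using measurable_comp[OF measurable_restrict_\<Omega> assms(1)] by (simp add: comp_def assms(2))

lemma nn_integral_finite_coordinates:
  assumes f: "f \<in> borel_measurable (\<Pi>\<^sub>M i\<in>{..<n}. borel)" and r: "\<And>\<omega>. f (restrict \<omega> {..<n}) = f \<omega>"
  shows "(\<integral>\<^sup>+x. f x \<partial>(\<Pi>\<^sub>M i\<in>{..<n}. \<mu>)) = (\<integral>\<^sup>+\<omega>. f \<omega> \<partial>\<Omega>)"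
proof -
  have s: "sets (\<Pi>\<^sub>M i\<in>{..<n}. \<mu>) = sets (\<Pi>\<^sub>M i\<in>{..<n}. borel)" by (intro sets_PiM_cong) auto
  have f': "f \<in> borel_measurable (\<Pi>\<^sub>M i\<in>{..<n}. \<mu>)" using f unfolding measurable_cong_sets[OF s refl] .
  have "(\<integral>\<^sup>+x. f x \<partial>(\<Pi>\<^sub>M i\<in>{..<n}. \<mu>)) = (\<integral>\<^sup>+x. f x \<partial>distr \<Omega> (\<Pi>\<^sub>M i\<in>{..<n}. \<mu>) (\<lambda>\<omega>. restrict \<omega> {..<n}))"
    using PP.distr_PiM_restrict_finite[of "{..<n}"] by simp
  also have "\<dots> = (\<integral>\<^sup>+\<omega>. f (restrict \<omega> {..<n}) \<partial>\<Omega>)"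
    by (rule nn_integral_distr) (auto simp: f' intro!: measurable_restrict)
  finally show ?thesis by (simp add: r)
qed

lemma empirical_restrict: "empirical n (restrict \<omega> {..<n}) = empirical n \<omega>"
  by (rule empirical_cong) simp

lemma empirical_event:
  assumes "n > 0" "A \<in> sets (borel_of weak_topology)"
  shows "{\<omega> \<in> space \<Omega>. empirical n \<omega> \<in> A} \<in> sets \<Omega>"
proof -
  have "empirical n \<in> measurable \<Omega> (borel_of weak_topology)"
    by (rule measurable_finite_coordinates[OF measurable_empirical[OF assms(1) refl] empirical_restrict])
  from measurable_sets[OF this assms(2)] show ?thesis by (simp add: vimage_def Int_def conj_commute)
qed

text \<open>Chebyshev's inequality; the centred variables are pairwise orthogonal, so only the n
  diagonal terms of the second moment survive.\<close>

lemma weak_law_bounded: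
  fixes f :: "'a \<Rightarrow> real"
  assumes f[measurable]: "f \<in> borel_measurable borel" and bf: "bounded (range f)" and \<delta>: "\<delta> > 0"
  shows "(\<lambda>n. O.prob {\<omega> \<in> space \<Omega>. \<bar>(\<Sum>i<n. f (\<omega> i)) / real n - (\<integral>x. f x \<partial>\<mu>)\<bar> \<ge> \<delta>}) \<longlonglongrightarrow> 0"
proof -
  define m where "m = (\<integral>x. f x \<partial>\<mu>)"
  define Z where "Z i \<omega> = f (\<omega> i) - m" for i and \<omega> :: "nat \<Rightarrow> 'a"
  obtain B where B: "\<And>x. \<bar>f x\<bar> \<le> B" "B > 0" using bf unfolding bounded_pos by auto
  have intf: "integrable \<mu> f" using \<mu> bf by (intro borel_probs_integrable_bounded) auto
  have "\<bar>m\<bar> \<le> (\<integral>x. \<bar>f x\<bar> \<partial>\<mu>)" unfolding m_def by (rule integral_abs_bound)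
  also have "\<dots> \<le> (\<integral>x. B \<partial>\<mu>)" using intf B by (intro integral_mono) auto
  finally have mB: "\<bar>m\<bar> \<le> B" by (simp add: M.prob_space)
  have ZB: "\<bar>Z i \<omega>\<bar> \<le> 2 * B" for i \<omega>
    using B(1)[of "\<omega> i"] mB unfolding Z_def by linarith
  have [measurable]: "Z i \<in> borel_measurable \<Omega>" for i unfolding Z_def by measurable
  have ZZB: "\<bar>Z i \<omega> * Z j \<omega>\<bar> \<le> (2 * B) * (2 * B)" for i j \<omega>
    unfolding abs_mult using ZB B(2) by (intro mult_mono) auto
  have intZ: "integrable \<Omega> (Z i)" for i
    by (rule O.integrable_const_bound[of _ "2 * B"]) (use ZB in auto)
  have intZZ: "integrable \<Omega> (\<lambda>\<omega>. Z i \<omega> * Z j \<omega>)" for i j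
    by (rule O.integrable_const_bound[of _ "(2 * B) * (2 * B)"]) (use ZZB in auto)
  have EZ: "(\<integral>\<omega>. Z i \<omega> \<partial>\<Omega>) = 0" for i
  proof -
    have "integrable \<Omega> (\<lambda>\<omega>. f (\<omega> i))" using intf by (simp add: integrable_coordinate)
    then show ?thesis unfolding Z_def by (simp add: integral_coordinate O.prob_space m_def)
  qed
  have indZ: "O.indep_vars (\<lambda>_. borel) Z UNIV"
    using O.indep_vars_compose2[OF indep_coordinates, of "\<lambda>_ x. f x - m" "\<lambda>_. borel"]
    by (simp add: Z_def[abs_def])
  have EZZ: "(\<integral>\<omega>. Z i \<omega> * Z j \<omega> \<partial>\<Omega>) = 0" if "i \<noteq> j" for i j
  proof -
    have "(\<integral>\<omega>. (\<Prod>k\<in>{i, j}. Z k \<omega>) \<partial>\<Omega>) = (\<Prod>k\<in>{i, j}. \<integral>\<omega>. Z k \<omega> \<partial>\<Omega>)"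
      by (rule O.indep_vars_lebesgue_integral) (auto intro: O.indep_vars_subset[OF indZ] intZ)
    then show ?thesis using that by (simp add: EZ)
  qed
  have bound: "O.prob {\<omega> \<in> space \<Omega>. \<bar>(\<Sum>i<n. f (\<omega> i)) / real n - m\<bar> \<ge> \<delta>} \<le> (2 * B) * (2 * B) / \<delta>\<^sup>2 / real n" if n: "n > 0" for n
  proof -
    define F where "F \<omega> = (\<Sum>i<n. Z i \<omega>) / real n" for \<omega>
    have Feq: "F \<omega> = (\<Sum>i<n. f (\<omega> i)) / real n - m" for \<omega>
      using n by (simp add: F_def Z_def sum_subtractf diff_divide_distrib)
    have [measurable]: "F \<in> borel_measurable \<Omega>" unfolding F_def by measurable
    have F2: "(F \<omega>)\<^sup>2 = (\<Sum>i<n. \<Sum>j<n. Z i \<omega> * Z j \<omega>) / (real n)\<^sup>2" for \<omega>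
      by (simp add: F_def power_divide power2_eq_square sum_product)
    have intF2: "integrable \<Omega> (\<lambda>\<omega>. (F \<omega>)\<^sup>2)"
      unfolding F2 by (intro integrable_divide Bochner_Integration.integrable_sum intZZ)
    have EF: "(\<integral>\<omega>. F \<omega> \<partial>\<Omega>) = 0"
      unfolding F_def by (simp add: intZ EZ)
    have "(\<integral>\<omega>. (F \<omega>)\<^sup>2 \<partial>\<Omega>) = (\<Sum>i<n. \<Sum>j<n. \<integral>\<omega>. Z i \<omega> * Z j \<omega> \<partial>\<Omega>) / (real n)\<^sup>2"
      unfolding F2 by (simp add: intZZ)
    also have "(\<Sum>i<n. \<Sum>j<n. \<integral>\<omega>. Z i \<omega> * Z j \<omega> \<partial>\<Omega>) = (\<Sum>i<n. \<integral>\<omega>. Z i \<omega> * Z i \<omega> \<partial>\<Omega>)"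
    proof (intro sum.cong refl)
      fix i assume i: "i \<in> {..<n}"
      have "(\<Sum>j<n. \<integral>\<omega>. Z i \<omega> * Z j \<omega> \<partial>\<Omega>) = (\<Sum>j<n. if j = i then (\<integral>\<omega>. Z i \<omega> * Z i \<omega> \<partial>\<Omega>) else 0)"
        by (intro sum.cong) (auto simp: EZZ)
      then show "(\<Sum>j<n. \<integral>\<omega>. Z i \<omega> * Z j \<omega> \<partial>\<Omega>) = (\<integral>\<omega>. Z i \<omega> * Z i \<omega> \<partial>\<Omega>)" using i by simp
    qed
    also have "\<dots> \<le> (\<Sum>i<n. (2 * B) * (2 * B))"
    proof (intro sum_mono)
      fix i
      have "(\<integral>\<omega>. Z i \<omega> * Z i \<omega> \<partial>\<Omega>) \<le> (\<integral>\<omega>. (2 * B) * (2 * B) \<partial>\<Omega>)"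
        using ZZB[of i _ i] by (intro integral_mono intZZ) (auto simp: abs_le_iff)
      then show "(\<integral>\<omega>. Z i \<omega> * Z i \<omega> \<partial>\<Omega>) \<le> (2 * B) * (2 * B)" by (simp add: O.prob_space)
    qed
    finally have EF2: "(\<integral>\<omega>. (F \<omega>)\<^sup>2 \<partial>\<Omega>) \<le> (2 * B) * (2 * B) / real n"
      using n by (simp add: power2_eq_square field_simps)
    have "O.prob {\<omega> \<in> space \<Omega>. \<bar>F \<omega> - (\<integral>\<omega>. F \<omega> \<partial>\<Omega>)\<bar> \<ge> \<delta>} \<le> (\<integral>\<omega>. (F \<omega> - (\<integral>\<omega>. F \<omega> \<partial>\<Omega>))\<^sup>2 \<partial>\<Omega>) / \<delta>\<^sup>2"
      using intF2 \<delta> by (intro O.Chebyshev_inequality) auto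
    then have "O.prob {\<omega> \<in> space \<Omega>. \<bar>F \<omega>\<bar> \<ge> \<delta>} \<le> (\<integral>\<omega>. (F \<omega>)\<^sup>2 \<partial>\<Omega>) / \<delta>\<^sup>2" by (simp add: EF)
    also have "\<dots> \<le> ((2 * B) * (2 * B) / real n) / \<delta>\<^sup>2" using EF2 by (intro divide_right_mono) auto
    finally show ?thesis by (simp add: Feq mult.commute)
  qed
  show ?thesis
    unfolding m_def[symmetric]
  proof (rule tendsto_sandwich[OF _ _ tendsto_const lim_const_over_n])
    show "\<forall>\<^sub>F n in sequentially. O.prob {\<omega> \<in> space \<Omega>. \<bar>(\<Sum>i<n. f (\<omega> i)) / real n - m\<bar> \<ge> \<delta>} \<le> (2 * B) * (2 * B) / \<delta>\<^sup>2 / real n"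
      using eventually_gt_at_top[of 0] by eventually_elim (rule bound)
  qed auto
qed

text \<open>Induction on the generation of G from the subbasis: an intersection adds two
  probabilities, a union is represented by one member containing \<mu>, and a subbasic set reduces
  to the scalar law.\<close>

lemma weak_law_empirical:
  assumes "openin weak_topology G" "\<mu> \<in> G"
  shows "(\<lambda>n. O.prob {\<omega> \<in> space \<Omega>. empirical n \<omega> \<notin> G}) \<longlonglongrightarrow> 0"
proof -
  let ?S = "{{\<mu> \<in> borel_probs. (\<integral>x. f x \<partial>\<mu>) \<in> U} | (f :: 'a \<Rightarrow> real) U.
        continuous_on UNIV f \<and> bounded (range f) \<and> open U}"
  have gen: "generate_topology_on ?S H \<Longrightarrow> openin weak_topology H" for H
    by (simp add: weak_topology_def openin_topology_generated_by_iff)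
  have ev: "{\<omega> \<in> space \<Omega>. empirical n \<omega> \<notin> H} \<in> sets \<Omega>" if "openin weak_topology H" "n > 0" for H n
  proof -
    have "{\<omega> \<in> space \<Omega>. empirical n \<omega> \<notin> H} = space \<Omega> - {\<omega> \<in> space \<Omega>. empirical n \<omega> \<in> H}" by auto
    then show ?thesis using empirical_event[OF that(2) openin_sets_borel_of[OF that(1)]] by simp
  qed
  have "generate_topology_on ?S G" using assms(1) by (simp add: weak_topology_def openin_topology_generated_by_iff)
  then show ?thesis using assms(2)
  proof (induction rule: generate_topology_on.induct)
    case (Int a b)
    have lim: "(\<lambda>n. O.prob {\<omega> \<in> space \<Omega>. empirical n \<omega> \<notin> a} + O.prob {\<omega> \<in> space \<Omega>. empirical n \<omega> \<notin> b}) \<longlonglongrightarrow> 0"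
      using tendsto_add[OF Int.IH] Int.prems by simp
    show ?case
    proof (rule tendsto_sandwich[OF _ _ tendsto_const lim])
      show "\<forall>\<^sub>F n in sequentially. O.prob {\<omega> \<in> space \<Omega>. empirical n \<omega> \<notin> a \<inter> b} \<le>
        O.prob {\<omega> \<in> space \<Omega>. empirical n \<omega> \<notin> a} + O.prob {\<omega> \<in> space \<Omega>. empirical n \<omega> \<notin> b}"
        using eventually_gt_at_top[of 0]
      proof eventually_elim
        case (elim n)
        have "{\<omega> \<in> space \<Omega>. empirical n \<omega> \<notin> a \<inter> b} =
          {\<omega> \<in> space \<Omega>. empirical n \<omega> \<notin> a} \<union> {\<omega> \<in> space \<Omega>. empirical n \<omega> \<notin> b}" by auto
        then show ?case
          using measure_Un_le[OF ev[OF gen[OF Int.hyps(1)] elim] ev[OF gen[OF Int.hyps(2)] elim]] by simp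
      qed
    qed auto
  next
    case (UN K)
    then obtain k where k: "k \<in> K" "\<mu> \<in> k" by blast
    show ?case
    proof (rule tendsto_sandwich[OF _ _ tendsto_const UN.IH[OF k]])
      show "\<forall>\<^sub>F n in sequentially. O.prob {\<omega> \<in> space \<Omega>. empirical n \<omega> \<notin> \<Union> K} \<le> O.prob {\<omega> \<in> space \<Omega>. empirical n \<omega> \<notin> k}"
        using eventually_gt_at_top[of 0]
      proof eventually_elim
        case (elim n)
        then show ?case using k ev[OF gen[OF UN.hyps[OF k(1)]] elim] by (intro O.finite_measure_mono) auto
      qed
    qed auto
  next
    case (Basis s)
    then obtain f :: "'a \<Rightarrow> real" and V where s: "s = {\<mu> \<in> borel_probs. (\<integral>x. f x \<partial>\<mu>) \<in> V}"
      and f: "continuous_on UNIV f" and bf: "bounded (range f)" and V: "open V" by blast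
    have [measurable]: "f \<in> borel_measurable borel" using f by (rule borel_measurable_continuous_onI)
    have "(\<integral>x. f x \<partial>\<mu>) \<in> V" using Basis.prems by (simp add: s)
    then obtain \<delta> where \<delta>: "\<delta> > 0" "ball (\<integral>x. f x \<partial>\<mu>) \<delta> \<subseteq> V" using V open_contains_ball by blast
    show ?case
    proof (rule tendsto_sandwich[OF _ _ tendsto_const weak_law_bounded[OF _ bf \<delta>(1)]])
      show "\<forall>\<^sub>F n in sequentially. O.prob {\<omega> \<in> space \<Omega>. empirical n \<omega> \<notin> s} \<le>
        O.prob {\<omega> \<in> space \<Omega>. \<bar>(\<Sum>i<n. f (\<omega> i)) / real n - (\<integral>x. f x \<partial>\<mu>)\<bar> \<ge> \<delta>}"
        using eventually_gt_at_top[of 0]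
      proof eventually_elim
        case (elim n)
        have "\<bar>(\<Sum>i<n. f (\<omega> i)) / real n - (\<integral>x. f x \<partial>\<mu>)\<bar> \<ge> \<delta>" if "empirical n \<omega> \<notin> s" for \<omega>
        proof (rule ccontr)
          assume "\<not> \<bar>(\<Sum>i<n. f (\<omega> i)) / real n - (\<integral>x. f x \<partial>\<mu>)\<bar> \<ge> \<delta>"
          then have "(\<Sum>i<n. f (\<omega> i)) / real n \<in> ball (\<integral>x. f x \<partial>\<mu>) \<delta>" by (simp add: dist_real_def abs_minus_commute)
          then have "(\<Sum>i<n. f (\<omega> i)) / real n \<in> V" using \<delta>(2) by blast
          then have "empirical n \<omega> \<in> s"
            using elim by (simp add: s empirical_in_borel_probs integral_empirical divide_inverse mult.commute)
          with that show False by blast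
        qed
        then show ?case by (intro O.finite_measure_mono) auto
      qed
    qed auto
  qed simp
qed

end

section \<open>Change of measure and Jensen's inequality\<close>

context confining_energy
begin

text \<open>The density factors cancel against the sum of \<open>ln p\<close> in the exponent, and
  \<open>exp (- norm (bary n \<omega>))\<close> becomes the barycentre weight, with total integral
  \<open>tilt (\<lambda>_. 0) 1\<close>. Equality may fail where p vanishes: configurations visiting
  that set count on the right only.\<close>

lemma mass_ge_iid:
  assumes n: "n > 0" and A: "A \<in> sets (borel_of weak_topology)" "transl_inv A"
    and d: "prob_density \<mu> p"
  shows "(\<integral>\<^sup>+\<omega>. indicator A (empirical n \<omega>) *
      ennreal (exp (- ((\<Sum>i<n. ln (p (\<omega> i))) + norm (bary n \<omega>) + \<beta> * real n * E n \<omega>))) \<partial>(\<Pi>\<^sub>M i\<in>UNIV. \<mu>))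
    \<le> ennreal (tilt (\<lambda>_::'a. 0) 1) * mass n A"
proof -
  note [measurable] = prob_densityD(1)[OF d] E_measurable[OF n] indicator_empirical_measurable[OF n A(1)]
  let ?g = "\<lambda>y::'a. ennreal (exp (- norm y))"
  let ?k = "\<lambda>x. indicator A (empirical n x) *
      ennreal (exp (- ((\<Sum>i<n. ln (p (x i))) + norm (bary n x) + \<beta> * real n * E n x)))"
  have km: "?k \<in> borel_measurable (\<Pi>\<^sub>M i\<in>{..<n}. borel)" by measurable
  have km': "?k \<in> borel_measurable (configs n)" using km by (simp add: measurable_configs)
  have pm: "(\<lambda>x. \<Prod>i<n. ennreal (p (x i))) \<in> borel_measurable (configs n)" by measurable
  interpret iid_sequence \<mu> using prob_densityD(7)[OF d] by unfold_locales
  have kr: "?k (restrict \<omega> {..<n}) = ?k \<omega>" for \<omega>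
  proof -
    have "E n (restrict \<omega> {..<n}) = E n \<omega>" by (rule E_cong) simp
    moreover have "bary n (restrict \<omega> {..<n}) = bary n \<omega>" by (simp add: bary_def)
    ultimately show ?thesis by (simp add: empirical_restrict)
  qed
  have "(\<integral>\<^sup>+\<omega>. ?k \<omega> \<partial>\<Omega>) = (\<integral>\<^sup>+x. ?k x \<partial>(\<Pi>\<^sub>M i\<in>{..<n}. \<mu>))"
    by (rule nn_integral_finite_coordinates[OF km kr, symmetric])
  also have "\<dots> = (\<integral>\<^sup>+x. (\<Prod>i<n. ennreal (p (x i))) * ?k x \<partial>configs n)"
    unfolding PiM_density_lborel[OF d] using pm km' by (rule nn_integral_density)
  also have "\<dots> \<le> (\<integral>\<^sup>+x. ?g (bary n x) * (indicator A (empirical n x) * ennreal (exp (- (\<beta> * real n * E n x)))) \<partial>configs n)"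
  proof (rule nn_integral_mono)
    fix x
    show "(\<Prod>i<n. ennreal (p (x i))) * ?k x \<le> ?g (bary n x) * (indicator A (empirical n x) * ennreal (exp (- (\<beta> * real n * E n x))))"
    proof (cases "\<forall>i<n. p (x i) > 0")
      case True
      have "(\<Prod>i<n. p (x i)) = exp (\<Sum>i<n. ln (p (x i)))"
        using True by (simp add: exp_sum)
      then have "(\<Prod>i<n. p (x i)) * exp (- ((\<Sum>i<n. ln (p (x i))) + norm (bary n x) + \<beta> * real n * E n x)) =
        exp (- norm (bary n x)) * exp (- (\<beta> * real n * E n x))"
        by (simp flip: exp_add)
      then have "(\<Prod>i<n. ennreal (p (x i))) * ennreal (exp (- ((\<Sum>i<n. ln (p (x i))) + norm (bary n x) + \<beta> * real n * E n x))) =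
        ?g (bary n x) * ennreal (exp (- (\<beta> * real n * E n x)))"
        using prob_densityD(2)[OF d] by (simp add: prod_ennreal prod_nonneg flip: ennreal_mult)
      then show ?thesis by (simp add: mult.left_commute)
    next
      case False
      then obtain i where "i < n" "p (x i) \<le> 0" by (auto simp: not_less)
      then have "(\<Prod>i<n. ennreal (p (x i))) = 0" by (intro prod_zero bexI[of _ i]) (auto simp: ennreal_neg)
      then show ?thesis by (simp only: mult_zero_left zero_le)
    qed
  qed
  also have "\<dots> = (\<integral>\<^sup>+y. ?g y \<partial>lborel) * mass n A"
    by (rule nn_integral_weight_mass[OF n A]) measurable
  also have "(\<integral>\<^sup>+y. ?g y \<partial>lborel) = ennreal (tilt (\<lambda>_::'a. 0) 1)"
    unfolding tilt_def using integrable_exp_neg_norm[of 1, where 'a='a]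
    by (subst nn_integral_eq_integral) auto
  finally show ?thesis .
qed

end

text \<open>Controls what is lost when the integral of a function without sign is restricted to an
  event of probability close to 1.\<close>

lemma (in prob_space) integral_truncation_tendsto_0:
  fixes u :: "'a \<Rightarrow> real"
  assumes "integrable M u"
  shows "(\<lambda>k. \<integral>x. max 0 (\<bar>u x\<bar> - real k) \<partial>M) \<longlonglongrightarrow> 0"
proof -
  have [measurable]: "u \<in> borel_measurable M" using assms by simp
  have "(\<lambda>k. \<integral>x. max 0 (\<bar>u x\<bar> - real k) \<partial>M) \<longlonglongrightarrow> (\<integral>x. 0 \<partial>M)"
  proof (rule integral_dominated_convergence[where w="\<lambda>x. \<bar>u x\<bar>"])
    show "AE x in M. (\<lambda>k. max 0 (\<bar>u x\<bar> - real k)) \<longlonglongrightarrow> 0"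
    proof (rule AE_I2)
      fix x
      obtain k0 where "\<bar>u x\<bar> \<le> real k0" using real_arch_simple by blast
      then have "max 0 (\<bar>u x\<bar> - real k) = 0" if "k \<ge> k0" for k using that by auto
      then show "(\<lambda>k. max 0 (\<bar>u x\<bar> - real k)) \<longlonglongrightarrow> 0"
        by (intro tendsto_eventually) (auto simp: eventually_sequentially)
    qed
  qed (use assms in auto)
  then show ?thesis by simp
qed

lemma ennreal_integral_le_nn_integral:
  assumes "integrable M f"
  shows "ennreal (\<integral>x. f x \<partial>M) \<le> (\<integral>\<^sup>+x. ennreal (f x) \<partial>M)"
proof -
  have "ennreal (\<integral>x. f x \<partial>M) \<le> ennreal (\<integral>x. max 0 (f x) \<partial>M)"
    using assms by (intro ennreal_leI integral_mono) auto
  also have "\<dots> = (\<integral>\<^sup>+x. ennreal (max 0 (f x)) \<partial>M)"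
    using assms by (intro nn_integral_eq_integral[symmetric]) auto
  also have "\<dots> = (\<integral>\<^sup>+x. ennreal (f x) \<partial>M)"
    by (intro nn_integral_cong) (auto simp: max_def ennreal_neg)
  finally show ?thesis .
qed

context confining_energy
begin

theorem lower_bound:
  assumes G: "openin weak_topology G" "transl_inv G" and \<mu>G: "\<mu> \<in> G" and a: "free_energy W \<sigma>2 \<mu> < ereal a"
  shows "\<forall>\<^sub>F n in sequentially. ennreal (exp (- (real n * a))) \<le> mass n G"
proof -
  have \<mu>: "\<mu> \<in> borel_probs" using openin_subset[OF G(1)] \<mu>G by auto
  have W: "W \<mu> < \<infinity>" using a free_energy_W_infinite[of \<mu>] by (cases "W \<mu> = \<infinity>") (auto simp: less_top)
  have "entropy_fun \<mu> < \<infinity>"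
    using a unfolding free_energy_W_finite[OF W] by (cases "entropy_fun \<mu>") auto
  then obtain p where \<mu>1: "\<mu> \<in> probs_moment 1" and d: "prob_density \<mu> p"
    and intplnp: "integrable lborel (\<lambda>x. p x * ln (p x))" and S: "entropy_fun \<mu> = ereal (\<integral>x. p x * ln (p x) \<partial>lborel)"
    by (rule entropy_fun_finiteE)
  note [measurable] = prob_densityD(1)[OF d]
  interpret iid_sequence \<mu> using \<mu> by unfold_locales
  define u where "u x = ln (p x)" for x
  have [measurable]: "u \<in> borel_measurable borel" unfolding u_def by measurable
  have intu: "integrable \<mu> u" using intplnp by (subst integrable_prob_density_iff[OF d]) (auto simp: u_def)
  define s where "s = (\<integral>x. u x \<partial>\<mu>)"
  have s: "entropy_fun \<mu> = ereal s"
    unfolding s_def S using integrable_prob_density_iff(2)[OF d, of u] by (simp add: u_def[abs_def])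
  define w where "w = enn2real (W \<mu>)"
  have Ww: "W \<mu> = ennreal w" using W by (simp add: w_def less_top)
  have w0: "w \<ge> 0" by (simp add: w_def)
  define F where "F = s + \<beta> * w"
  have "F < a" using a unfolding free_energy_W_finite[OF W] s by (simp add: F_def w_def)
  \<comment> \<open>The budget has six parts: 2 g for restricting \<open>ln p\<close> to the event,
    g for the barycentre weight, g for the mean energy, g for the probability of the event, and g to
    absorb the constant 2 Z.\<close>
  define g where "g = (a - F) / 6"
  have "6 * g = a - F" by (simp add: g_def)
  then have g: "g > 0" "a = F + 6 * g" using \<open>F < a\<close> by linarith+
  define m1 where "m1 = (\<integral>x. norm x \<partial>\<mu>)"
  have intn: "integrable \<mu> norm" using integrable_norm_probs_moment_1[OF \<mu>1] by simp
  have Gm: "G \<in> sets (borel_of weak_topology)" using G(1) by (rule openin_sets_borel_of)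
  define P where "P n = O.prob {\<omega> \<in> space \<Omega>. empirical n \<omega> \<notin> G}" for n
  have P: "P \<longlonglongrightarrow> 0" unfolding P_def using G(1) \<mu>G by (rule weak_law_empirical)
  \<comment> \<open>The truncation level for \<open>ln p\<close> is fixed before n, so that
    \<open>real K * P n\<close> still tends to 0.\<close>
  obtain K where K: "(\<integral>x. max 0 (\<bar>u x\<bar> - real K) \<partial>\<mu>) < g"
    using order_tendstoD(2)[OF M.integral_truncation_tendsto_0[OF intu] g(1)] by (auto simp: eventually_sequentially)
  have chaos_lim: "(\<lambda>n. \<integral>\<^sup>+\<omega>. energy_n W n \<omega> \<partial>\<Omega>) \<longlonglongrightarrow> W \<mu>"
    using chaos[unfolded chaos_compatible_def, rule_format, OF \<mu>, of \<Omega> "\<lambda>i \<omega>. \<omega> i"]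
      indep_coordinates distr_coordinate O.prob_space_axioms by simp
  have W_lt: "W \<mu> < ennreal (w + g / \<beta>)" using g \<beta>_pos w0 by (simp add: Ww ennreal_less_iff)
  have tp: "tilt (\<lambda>_::'a. 0) 1 > 0" by (intro tilt_pos) auto
  define Z where "Z = tilt (\<lambda>_::'a. 0) 1"
  have ev: "\<forall>\<^sub>F n in sequentially. n > 0 \<and> real K * P n < g \<and> (\<integral>\<^sup>+\<omega>. energy_n W n \<omega> \<partial>\<Omega>) < ennreal (w + g / \<beta>) \<and>
    m1 / sqrt (real n) < g \<and> (1 - P n) * (F + 5 * g) > F + 4 * g \<and> P n < 1 / 2 \<and> 2 * Z < exp (real n * g)"
  proof (intro eventually_conj)
    show "\<forall>\<^sub>F n::nat in sequentially. n > 0" by (rule eventually_gt_at_top)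
    have "(\<lambda>n. real K * P n) \<longlonglongrightarrow> real K * 0" by (intro tendsto_intros P)
    then show "\<forall>\<^sub>F n in sequentially. real K * P n < g" using g(1) by (intro order_tendstoD(2)) auto
    show "\<forall>\<^sub>F n in sequentially. (\<integral>\<^sup>+\<omega>. energy_n W n \<omega> \<partial>\<Omega>) < ennreal (w + g / \<beta>)"
      using chaos_lim W_lt by (rule order_tendstoD(2))
    have "(\<lambda>n. m1 / sqrt (real n)) \<longlonglongrightarrow> 0"
      by (intro real_tendsto_divide_at_top[OF tendsto_const] filterlim_compose[OF sqrt_at_top filterlim_real_sequentially])
    then show "\<forall>\<^sub>F n in sequentially. m1 / sqrt (real n) < g" using g(1) by (rule order_tendstoD(2))
    have "(\<lambda>n. (1 - P n) * (F + 5 * g)) \<longlonglongrightarrow> (1 - 0) * (F + 5 * g)" by (intro tendsto_intros P)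
    then show "\<forall>\<^sub>F n in sequentially. (1 - P n) * (F + 5 * g) > F + 4 * g" using g(1) by (intro order_tendstoD(1)) auto
    show "\<forall>\<^sub>F n in sequentially. P n < 1 / 2" using P by (rule order_tendstoD(2)) simp
    have "filterlim (\<lambda>n. exp (real n * g)) at_top sequentially"
      by (rule filterlim_compose[OF exp_at_top filterlim_at_top_mult_tendsto_pos[OF tendsto_const g(1) filterlim_real_sequentially]])
    then show "\<forall>\<^sub>F n in sequentially. 2 * Z < exp (real n * g)" by (simp add: filterlim_at_top_dense)
  qed
  show ?thesis
    using ev
  proof eventually_elim
    case (elim n)
    then have n: "n > 0" and e1: "real K * P n < g" and e2: "(\<integral>\<^sup>+\<omega>. energy_n W n \<omega> \<partial>\<Omega>) < ennreal (w + g / \<beta>)"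
      and e3: "m1 / sqrt (real n) < g" and e4: "(1 - P n) * (F + 5 * g) > F + 4 * g" and e5: "P n < 1 / 2"
      and e6: "2 * Z < exp (real n * g)" by auto
    define B where "B = {\<omega> \<in> space \<Omega>. empirical n \<omega> \<in> G}"
    have B[measurable]: "B \<in> sets \<Omega>" unfolding B_def using n Gm by (rule empirical_event)
    define B' where "B' = space \<Omega> - B"
    have B'[measurable]: "B' \<in> sets \<Omega>" by (simp add: B'_def)
    have PB': "O.prob B' = P n" unfolding P_def B'_def B_def by (intro arg_cong[where f=O.prob]) auto
    have PB: "O.prob B = 1 - P n" using O.prob_compl[OF B] PB' by (simp add: B'_def)
    have Em[measurable]: "E n \<in> borel_measurable \<Omega>"
      by (rule measurable_finite_coordinates[OF E_measurable(1)[OF n]]) (rule E_cong, simp)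
    have bm[measurable]: "bary n \<in> borel_measurable \<Omega>" unfolding bary_def[abs_def] by measurable
    have EE: "(\<integral>\<^sup>+\<omega>. ennreal (E n \<omega>) \<partial>\<Omega>) < ennreal (w + g / \<beta>)" using e2 by (simp add: energy_eq[OF n])
    have intE: "integrable \<Omega> (E n)"
      by (rule integrableI_nonneg) (use EE E_nonneg in \<open>auto intro: less_trans\<close>)
    have EEr: "(\<integral>\<omega>. E n \<omega> \<partial>\<Omega>) \<le> w + g / \<beta>"
    proof -
      have "ennreal (\<integral>\<omega>. E n \<omega> \<partial>\<Omega>) \<le> ennreal (w + g / \<beta>)"
        using EE nn_integral_eq_integral[OF intE] E_nonneg by (simp add: order_less_imp_le)
      then show ?thesis using w0 g \<beta>_pos by (subst (asm) ennreal_le_iff) auto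
    qed
    have intuc: "integrable \<Omega> (\<lambda>\<omega>. u (\<omega> i))" for i using intu by (simp add: integrable_coordinate)
    have intnc: "integrable \<Omega> (\<lambda>\<omega>. norm (\<omega> i))" for i using intn by (simp add: integrable_coordinate)
    have ib: "integrable \<Omega> (bary n)" 
    proof -
      have "integrable \<Omega> (\<lambda>\<omega>. \<omega> i)" for i
        by (rule Bochner_Integration.integrable_bound[OF intnc[of i]]) auto
      then show ?thesis unfolding bary_def[abs_def] by (intro integrable_scaleR_right Bochner_Integration.integrable_sum) auto
    qed
    define \<phi> where "\<phi> \<omega> = (\<Sum>i<n. u (\<omega> i)) + norm (bary n \<omega>) + \<beta> * real n * E n \<omega>" for \<omega>
    have int\<phi>: "integrable \<Omega> \<phi>"
      unfolding \<phi>_def using ib intE intuc by (intro Bochner_Integration.integrable_add Bochner_Integration.integrable_sum integrable_mult_right) auto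
    have [measurable]: "\<phi> \<in> borel_measurable \<Omega>" using int\<phi> by simp
    have Eb: "(\<integral>\<omega>. norm (bary n \<omega>) \<partial>\<Omega>) \<le> real n * g"
    proof -
      have "(\<integral>\<omega>. norm (bary n \<omega>) \<partial>\<Omega>) \<le> (\<integral>\<omega>. (\<Sum>i<n. norm (\<omega> i)) / sqrt (real n) \<partial>\<Omega>)"
      proof (rule integral_mono)
        show "norm (bary n \<omega>) \<le> (\<Sum>i<n. norm (\<omega> i)) / sqrt (real n)" for \<omega>
          unfolding bary_def by (simp add: divide_right_mono norm_sum)
        show "integrable \<Omega> (\<lambda>\<omega>. (\<Sum>i<n. norm (\<omega> i)) / sqrt (real n))"
          by (intro integrable_divide Bochner_Integration.integrable_sum intnc)
      qed (use ib in auto)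
      also have "\<dots> = real n * (m1 / sqrt (real n))"
        using integral_coordinate[of norm] by (simp add: intnc m1_def)
      also have "\<dots> \<le> real n * g" using e3 by (intro mult_left_mono) auto
      finally show ?thesis .
    qed
    \<comment> \<open>Unlike the other two terms of \<open>\<phi>\<close>, which only decrease when
      restricted to B, \<open>ln p\<close> has no sign. Off B the bound uses that -u is at most K
      plus the excess of its absolute value over K.\<close>
    have Eu: "(\<integral>\<omega>. indicator B \<omega> * u (\<omega> i) \<partial>\<Omega>) \<le> s + 2 * g" for i
    proof -
      let ?T = "\<lambda>x. max 0 (\<bar>u x\<bar> - real K)"
      have intT: "integrable \<mu> ?T" using intu by auto
      have intTc: "integrable \<Omega> (\<lambda>\<omega>. ?T (\<omega> i))" using integrable_coordinate[of ?T i] intT by simp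
      have iB: "integrable \<Omega> (\<lambda>\<omega>. indicator B \<omega> * u (\<omega> i))"
        using integrable_mult_indicator[OF B intuc[of i]] by simp
      have "(\<integral>\<omega>. indicator B \<omega> * u (\<omega> i) \<partial>\<Omega>) \<le> (\<integral>\<omega>. u (\<omega> i) + (real K * indicator B' \<omega> + ?T (\<omega> i)) \<partial>\<Omega>)"
      proof (rule integral_mono)
        show "integrable \<Omega> (\<lambda>\<omega>. u (\<omega> i) + (real K * indicator B' \<omega> + ?T (\<omega> i)))"
          using intuc intTc by (intro Bochner_Integration.integrable_add integrable_mult_right) (auto simp: less_top[symmetric])
        fix \<omega> assume "\<omega> \<in> space \<Omega>"
        then show "indicator B \<omega> * u (\<omega> i) \<le> u (\<omega> i) + (real K * indicator B' \<omega> + ?T (\<omega> i))"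
          by (cases "\<omega> \<in> B") (auto simp: B'_def abs_if max_def)
      qed (rule iB)
      also have "\<dots> = (\<integral>\<omega>. u (\<omega> i) \<partial>\<Omega>) + (real K * O.prob B' + (\<integral>\<omega>. ?T (\<omega> i) \<partial>\<Omega>))"
        using intuc intTc by (subst Bochner_Integration.integral_add) (auto simp: less_top[symmetric])
      also have "\<dots> = s + (real K * P n + (\<integral>x. ?T x \<partial>\<mu>))"
        using integral_coordinate[of u i] integral_coordinate[of ?T i] by (simp add: PB' s_def)
      finally show ?thesis using e1 K by linarith
    qed
    have T: "(\<integral>\<omega>. indicator B \<omega> * \<phi> \<omega> \<partial>\<Omega>) \<le> real n * (F + 4 * g)"
    proof -
      have i1: "integrable \<Omega> (\<lambda>\<omega>. indicator B \<omega> * u (\<omega> i))" for i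
        using integrable_mult_indicator[OF B intuc[of i]] by simp
      have i2: "integrable \<Omega> (\<lambda>\<omega>. indicator B \<omega> * norm (bary n \<omega>))"
        using integrable_mult_indicator[OF B integrable_norm[OF ib]] by simp
      have i3: "integrable \<Omega> (\<lambda>\<omega>. indicator B \<omega> * E n \<omega>)"
        using integrable_mult_indicator[OF B intE] by simp
      have "(\<integral>\<omega>. indicator B \<omega> * \<phi> \<omega> \<partial>\<Omega>) =
        (\<integral>\<omega>. (\<Sum>i<n. indicator B \<omega> * u (\<omega> i)) + (indicator B \<omega> * norm (bary n \<omega>) + \<beta> * real n * (indicator B \<omega> * E n \<omega>)) \<partial>\<Omega>)"
        by (intro Bochner_Integration.integral_cong refl) (simp add: \<phi>_def algebra_simps sum_distrib_left)
      also have "\<dots> = (\<Sum>i<n. \<integral>\<omega>. indicator B \<omega> * u (\<omega> i) \<partial>\<Omega>) +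
          ((\<integral>\<omega>. indicator B \<omega> * norm (bary n \<omega>) \<partial>\<Omega>) + \<beta> * real n * (\<integral>\<omega>. indicator B \<omega> * E n \<omega> \<partial>\<Omega>))"
      proof -
        have ia: "integrable \<Omega> (\<lambda>\<omega>. \<Sum>i<n. indicator B \<omega> * u (\<omega> i))"
          by (intro Bochner_Integration.integrable_sum i1)
        have ic: "integrable \<Omega> (\<lambda>\<omega>. \<beta> * real n * (indicator B \<omega> * E n \<omega>))"
          by (intro integrable_mult_right i3)
        have "(\<integral>\<omega>. (\<Sum>i<n. indicator B \<omega> * u (\<omega> i)) \<partial>\<Omega>) = (\<Sum>i<n. \<integral>\<omega>. indicator B \<omega> * u (\<omega> i) \<partial>\<Omega>)"
          by (rule Bochner_Integration.integral_sum) (rule i1)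
        moreover have "(\<integral>\<omega>. \<beta> * real n * (indicator B \<omega> * E n \<omega>) \<partial>\<Omega>) = \<beta> * real n * (\<integral>\<omega>. indicator B \<omega> * E n \<omega> \<partial>\<Omega>)"
          by (rule integral_mult_right_zero)
        ultimately show ?thesis
          unfolding Bochner_Integration.integral_add[OF ia Bochner_Integration.integrable_add[OF i2 ic]]
            Bochner_Integration.integral_add[OF i2 ic] by (simp only:)
      qed
      also have "\<dots> \<le> (\<Sum>i<n. s + 2 * g) + ((\<integral>\<omega>. norm (bary n \<omega>) \<partial>\<Omega>) + \<beta> * real n * (\<integral>\<omega>. E n \<omega> \<partial>\<Omega>))"
        using ib intE i2 i3 \<beta>_pos E_nonneg
        by (intro add_mono sum_mono Eu mult_left_mono integral_mono) (auto simp: indicator_def)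
      also have "\<dots> \<le> real n * (s + 2 * g) + (real n * g + \<beta> * real n * (w + g / \<beta>))"
        using Eb EEr \<beta>_pos by (intro add_mono mult_left_mono) auto
      also have "\<dots> = real n * (F + 4 * g)" using \<beta>_pos by (simp add: F_def field_simps)
      finally show ?thesis .
    qed
    \<comment> \<open>Jensen's inequality in tangent form:
      \<open>exp (- \<phi>) \<ge> exp (- b) * (1 + b - \<phi>)\<close>, integrated over B without
      normalising by the probability of B.\<close>
    define b where "b = real n * (F + 5 * g)"
    have "exp (- b) * (1 / 2) \<le> exp (- b) * (O.prob B * (1 + b) - (\<integral>\<omega>. indicator B \<omega> * \<phi> \<omega> \<partial>\<Omega>))"
    proof (intro mult_left_mono)
      have "real n * (F + 4 * g) \<le> real n * ((1 - P n) * (F + 5 * g))" using e4 by (intro mult_left_mono) auto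
      then have "(\<integral>\<omega>. indicator B \<omega> * \<phi> \<omega> \<partial>\<Omega>) \<le> (1 - P n) * b" using T by (simp add: b_def mult.left_commute)
      then show "1 / 2 \<le> O.prob B * (1 + b) - (\<integral>\<omega>. indicator B \<omega> * \<phi> \<omega> \<partial>\<Omega>)"
        using e5 by (simp add: PB distrib_left)
    qed simp
    also have "\<dots> = (\<integral>\<omega>. exp (- b) * ((1 + b) * indicator B \<omega> - indicator B \<omega> * \<phi> \<omega>) \<partial>\<Omega>)"
      using integrable_mult_indicator[OF B int\<phi>] by (simp add: less_top[symmetric] mult.commute)
    finally have "ennreal (exp (- b) * (1 / 2)) \<le> ennreal (\<integral>\<omega>. exp (- b) * ((1 + b) * indicator B \<omega> - indicator B \<omega> * \<phi> \<omega>) \<partial>\<Omega>)"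
      by (rule ennreal_leI)
    also have "\<dots> \<le> (\<integral>\<^sup>+\<omega>. ennreal (exp (- b) * ((1 + b) * indicator B \<omega> - indicator B \<omega> * \<phi> \<omega>)) \<partial>\<Omega>)"
      using integrable_mult_indicator[OF B int\<phi>]
      by (intro ennreal_integral_le_nn_integral integrable_mult_right Bochner_Integration.integrable_diff) (auto simp: less_top[symmetric])
    also have "\<dots> \<le> (\<integral>\<^sup>+\<omega>. indicator G (empirical n \<omega>) * ennreal (exp (- \<phi> \<omega>)) \<partial>\<Omega>)"
    proof (rule nn_integral_mono)
      fix \<omega> assume \<omega>: "\<omega> \<in> space \<Omega>"
      show "ennreal (exp (- b) * ((1 + b) * indicator B \<omega> - indicator B \<omega> * \<phi> \<omega>)) \<le> indicator G (empirical n \<omega>) * ennreal (exp (- \<phi> \<omega>))"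
      proof (cases "\<omega> \<in> B")
        case True
        have "exp (- b) * (1 + (b - \<phi> \<omega>)) \<le> exp (- b) * exp (b - \<phi> \<omega>)"
          by (intro mult_left_mono exp_ge_add_one_self) auto
        then have "exp (- b) * ((1 + b) * indicator B \<omega> - indicator B \<omega> * \<phi> \<omega>) \<le> exp (- \<phi> \<omega>)"
          using True by (simp add: algebra_simps flip: exp_add)
        then show ?thesis using True by (simp add: B_def ennreal_leI)
      qed simp
    qed
    also have "\<dots> \<le> ennreal Z * mass n G"
      unfolding Z_def \<phi>_def u_def by (rule mass_ge_iid[OF n Gm G(2) d])
    finally have "ennreal (exp (- b) * (1 / 2)) \<le> ennreal Z * mass n G" .
    \<comment> \<open>Since b is n (a - g), the remaining g absorbs the factor 2 Z.\<close>
    moreover have "Z * exp (- (real n * a)) \<le> exp (- b) * (1 / 2)"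
    proof -
      have "2 * Z * exp (- (real n * a)) \<le> exp (real n * g) * exp (- (real n * a))"
        using e6 by (intro mult_right_mono) auto
      also have "\<dots> = exp (- b)" unfolding exp_add[symmetric] b_def g(2) by (simp add: algebra_simps)
      finally show ?thesis by simp
    qed
    then have "ennreal Z * ennreal (exp (- (real n * a))) \<le> ennreal (exp (- b) * (1 / 2))"
      using tp by (simp add: Z_def ennreal_leI flip: ennreal_mult)
    ultimately have "ennreal Z * ennreal (exp (- (real n * a))) \<le> ennreal Z * mass n G" by (rule order_trans[rotated])
    then show "ennreal (exp (- (real n * a))) \<le> mass n G"
      using tp by (simp add: Z_def ennreal_mult_le_mult_iff)
  qed
qed

end

section \<open>The large deviation principle\<close>

lemma compact_measure_support:
  fixes \<mu> :: "'a::euclidean_space measure"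
  assumes B: "closed B" "bounded B" and null: "emeasure \<mu> (- B) = 0"
  shows "compact (measure_support \<mu>)"
proof -
  have "- measure_support \<mu> = \<Union>{U. open U \<and> emeasure \<mu> U = 0}"
    by (auto simp: measure_support_def)
  then have "open (- measure_support \<mu>)" by (simp add: open_Union)
  then have "closed (measure_support \<mu>)" by (simp add: closed_def)
  moreover have "measure_support \<mu> \<subseteq> B"
  proof
    fix x assume "x \<in> measure_support \<mu>"
    then have "x \<in> - B \<Longrightarrow> emeasure \<mu> (- B) > 0" using B(1) by (auto simp: measure_support_def)
    then show "x \<in> B" using null by auto
  qed
  then have "bounded (measure_support \<mu>)" using B(2) bounded_subset by blast
  ultimately show ?thesis by (simp add: compact_eq_bounded_closed)
qed

section \<open>Coercivity, lower bound and finiteness of the free energy\<close>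

context confining_energy
begin

text \<open>Growth control contributes \<open>\<beta> * \<kappa>\<close> times the first moment.
  Half of it pays for the loss of r times the first moment in \<open>gibbs_variational_le\<close>,
  the other half remains.\<close>

lemma free_energy_coercive:
  assumes \<mu>: "\<mu> \<in> borel_probs" and W: "W \<mu> < \<infinity>"
  shows "ereal (\<beta> * \<kappa> / 2 * (\<integral>x. norm x \<partial>\<mu>) - \<beta> * \<kappa> * (norm (\<integral>x. x \<partial>\<mu>) + 1) - ln (tilt (\<lambda>_::'a. 0) (\<beta> * \<kappa> / 2)))
    \<le> free_energy W \<sigma>2 \<mu>"
proof -
  define r where "r = \<beta> * \<kappa> / 2"
  have r: "r > 0" using \<beta>_pos \<kappa> by (simp add: r_def)
  define w where "w = enn2real (W \<mu>)"
  have \<mu>1: "\<mu> \<in> probs_moment 1" using W_finite_imp_moment_1[OF \<mu> W] .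
  have "\<beta> * (\<kappa> * ((\<integral>x. norm x \<partial>\<mu>) - norm (\<integral>x. x \<partial>\<mu>) - 1)) \<le> \<beta> * w"
    using W_ge_first_moment[OF \<mu> W] \<beta>_pos by (simp add: w_def)
  then have "\<beta> * \<kappa> / 2 * (\<integral>x. norm x \<partial>\<mu>) - \<beta> * \<kappa> * (norm (\<integral>x. x \<partial>\<mu>) + 1) - ln (tilt (\<lambda>_::'a. 0) r) \<le>
    ((\<integral>x. 0 \<partial>\<mu>) - r * (\<integral>x. norm x \<partial>\<mu>) - ln (tilt (\<lambda>_::'a. 0) r)) + \<beta> * w"
    by (simp add: r_def algebra_simps)
  then have "ereal (\<beta> * \<kappa> / 2 * (\<integral>x. norm x \<partial>\<mu>) - \<beta> * \<kappa> * (norm (\<integral>x. x \<partial>\<mu>) + 1) - ln (tilt (\<lambda>_::'a. 0) r)) \<le>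
    ereal ((\<integral>x. 0 \<partial>\<mu>) - r * (\<integral>x. norm x \<partial>\<mu>) - ln (tilt (\<lambda>_::'a. 0) r)) + ereal (\<beta> * w)" by simp
  also have "\<dots> \<le> entropy_fun \<mu> + ereal (\<beta> * w)"
    by (intro add_right_mono gibbs_variational_le \<mu>1 r) auto
  finally show ?thesis by (simp add: free_energy_W_finite[OF W] w_def r_def)
qed

lemma centred_translate:
  assumes \<mu>: "\<mu> \<in> probs_moment 1"
  shows "(\<integral>x. x \<partial>translate (- (\<integral>x. x \<partial>\<mu>)) \<mu>) = 0"
proof -
  have \<mu>': "\<mu> \<in> borel_probs" using \<mu> by (simp add: probs_moment_1)
  interpret prob_space \<mu> using \<mu>' by (rule borel_probsD)
  have "(\<integral>x. x \<partial>translate (- (\<integral>x. x \<partial>\<mu>)) \<mu>) = (\<integral>x. x + (- (\<integral>x. x \<partial>\<mu>)) \<partial>\<mu>)"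
    using \<mu>' by (intro integral_translate) auto
  also have "\<dots> = 0" using integrable_norm_probs_moment_1(2)[OF \<mu>] prob_space by simp
  finally show ?thesis .
qed

text \<open>By translation invariance the mean may be taken to be 0, and then the coercive bound has
  no negative moment term.\<close>

lemma free_energy_bounded_below:
  assumes \<mu>: "\<mu> \<in> borel_probs"
  shows "ereal (- \<beta> * \<kappa> - ln (tilt (\<lambda>_::'a. 0) (\<beta> * \<kappa> / 2))) \<le> free_energy W \<sigma>2 \<mu>"
proof (cases "W \<mu> < \<infinity>")
  case True
  define \<nu> where "\<nu> = translate (- (\<integral>x. x \<partial>\<mu>)) \<mu>"
  have \<nu>: "\<nu> \<in> borel_probs" unfolding \<nu>_def using \<mu> by (rule translate_in_borel_probs)
  have W\<nu>: "W \<nu> < \<infinity>" using True W_translate[OF \<mu>] by (simp add: \<nu>_def)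
  have mean: "(\<integral>x. x \<partial>\<nu>) = 0"
    unfolding \<nu>_def by (rule centred_translate[OF W_finite_imp_moment_1[OF \<mu> True]])
  have "- \<beta> * \<kappa> \<le> \<beta> * \<kappa> / 2 * (\<integral>x. norm x \<partial>\<nu>) - \<beta> * \<kappa>" using \<beta>_pos \<kappa> by simp
  then have "ereal (- \<beta> * \<kappa> - ln (tilt (\<lambda>_::'a. 0) (\<beta> * \<kappa> / 2))) \<le>
    ereal (\<beta> * \<kappa> / 2 * (\<integral>x. norm x \<partial>\<nu>) - \<beta> * \<kappa> * (norm (\<integral>x. x \<partial>\<nu>) + 1) - ln (tilt (\<lambda>_::'a. 0) (\<beta> * \<kappa> / 2)))"
    by (simp add: mean)
  also have "\<dots> \<le> free_energy W \<sigma>2 \<nu>" by (rule free_energy_coercive[OF \<nu> W\<nu>])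
  also have "\<dots> = free_energy W \<sigma>2 \<mu>" unfolding \<nu>_def by (rule free_energy_translate[OF \<mu>])
  finally show ?thesis .
qed (simp add: free_energy_W_infinite less_top[symmetric])

text \<open>The witness is the uniform law on the unit cube: compact support makes its energy
  finite, and \<open>p * ln p\<close> vanishes for p in {0, 1}.\<close>

lemma free_energy_finite_somewhere: "\<exists>\<mu>\<in>borel_probs. free_energy W \<sigma>2 \<mu> < \<infinity>"
proof -
  let ?C = "cbox 0 One :: 'a set"
  define p :: "'a \<Rightarrow> real" where "p = indicator ?C"
  define \<mu> where "\<mu> = density lborel (\<lambda>x. ennreal (p x))"
  have [measurable]: "p \<in> borel_measurable borel" unfolding p_def by measurable
  have p: "ennreal (p x) = indicator ?C x" for x by (simp add: p_def indicator_def)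
  have em: "emeasure \<mu> A = emeasure lborel (?C \<inter> A)" if "A \<in> sets borel" for A
  proof -
    have "emeasure \<mu> A = (\<integral>\<^sup>+x. ennreal (p x) * indicator A x \<partial>lborel)"
      unfolding \<mu>_def using that by (intro emeasure_density) auto
    also have "\<dots> = (\<integral>\<^sup>+x. indicator (?C \<inter> A) x \<partial>lborel)"
      by (intro nn_integral_cong) (simp add: p indicator_def)
    finally show ?thesis using that by simp
  qed
  have "emeasure lborel ?C = 1" by (simp add: emeasure_lborel_cbox_eq)
  moreover have "space \<mu> = UNIV" by (simp add: \<mu>_def)
  ultimately have "prob_space \<mu>" by (intro prob_spaceI) (simp add: em)
  then have d: "prob_density \<mu> p" by (simp add: prob_density_def \<mu>_def p_def)
  then have \<mu>: "\<mu> \<in> borel_probs" by (rule prob_densityD)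
  interpret prob_space \<mu> by fact
  have "compact (measure_support \<mu>)"
  proof (rule compact_measure_support[of ?C])
    show "emeasure \<mu> (- ?C) = 0" by (subst em) auto
  qed (auto simp: bounded_cbox closed_cbox)
  then have W: "W \<mu> < \<infinity>" using sigma_fin \<mu> by (simp add: sigma_finite_energy_def)
  have \<mu>1: "\<mu> \<in> probs_moment 1" using W_finite_imp_moment_1[OF \<mu> W] .
  have pl: "p x * ln (p x) = 0" for x by (simp add: p_def indicator_def)
  have "entropy_fun \<mu> = 0" unfolding entropy_fun_prob_density[OF d \<mu>1] pl by simp
  then show ?thesis using \<mu> by (intro bexI[of _ \<mu>]) (simp_all add: free_energy_W_finite[OF W])
qed

lemma free_energy_inf_real:
  obtains Fs where "free_energy_inf W \<sigma>2 = ereal Fs"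
    "\<And>\<mu>. \<mu> \<in> borel_probs \<Longrightarrow> ereal Fs \<le> free_energy W \<sigma>2 \<mu>"
    "\<And>y. Fs < y \<Longrightarrow> \<exists>\<mu>\<in>borel_probs. free_energy W \<sigma>2 \<mu> < ereal y"
proof -
  have "ereal (- \<beta> * \<kappa> - ln (tilt (\<lambda>_::'a. 0) (\<beta> * \<kappa> / 2))) \<le> free_energy_inf W \<sigma>2"
    unfolding free_energy_inf_def by (intro INF_greatest free_energy_bounded_below)
  moreover have "free_energy_inf W \<sigma>2 < \<infinity>"
  proof -
    obtain \<mu> where \<mu>: "\<mu> \<in> borel_probs" "free_energy W \<sigma>2 \<mu> < \<infinity>" using free_energy_finite_somewhere by blast
    have "free_energy_inf W \<sigma>2 \<le> free_energy W \<sigma>2 \<mu>"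
      unfolding free_energy_inf_def using \<mu>(1) by (rule INF_lower)
    then show ?thesis using \<mu>(2) by (rule le_less_trans)
  qed
  ultimately obtain Fs where Fs: "free_energy_inf W \<sigma>2 = ereal Fs"
    by (cases "free_energy_inf W \<sigma>2") auto
  moreover have "ereal Fs \<le> free_energy W \<sigma>2 \<mu>" if "\<mu> \<in> borel_probs" for \<mu>
    unfolding Fs[symmetric] free_energy_inf_def using that by (rule INF_lower)
  moreover have "\<exists>\<mu>\<in>borel_probs. free_energy W \<sigma>2 \<mu> < ereal y" if "Fs < y" for y
  proof -
    have "free_energy_inf W \<sigma>2 < ereal y" using that by (simp add: Fs)
    then show ?thesis by (simp add: free_energy_inf_def INF_less_iff)
  qed
  ultimately show thesis using that by blast
qed

section \<open>The rate function on orbits\<close>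

lemma free_energy_orbit_orbit:
  assumes "\<mu> \<in> borel_probs"
  shows "free_energy_orbit W \<sigma>2 (orbit \<mu>) = free_energy W \<sigma>2 \<mu>"
proof -
  have "free_energy W \<sigma>2 ` orbit \<mu> = {free_energy W \<sigma>2 \<mu>}"
    by (simp add: orbit_def image_image free_energy_translate[OF assms])
  then show ?thesis by (simp add: free_energy_orbit_def)
qed

lemma topspace_orbit_topology: "topspace (orbit_topology :: 'a measure set topology) = orbit ` borel_probs"
  by (simp add: orbit_topology_def)

text \<open>Closedness is lower semicontinuity relative to the moment bound: near a measure with
  free energy above b, the second conclusion of \<open>local_bound\<close> keeps the free energy at
  least some a > b on measures of first moment at most R.\<close>

lemma compactin_free_energy_sublevel:
  assumes R: "R \<ge> 0"
  shows "compactin weak_topology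
    {\<mu> \<in> borel_probs. (\<integral>\<^sup>+x. ennreal (norm x) \<partial>\<mu>) \<le> ennreal R \<and> free_energy W \<sigma>2 \<mu> \<le> ereal b}" (is "compactin _ ?K")
proof -
  let ?KR = "{\<mu> \<in> borel_probs. (\<integral>\<^sup>+x. ennreal (norm (x::'a)) \<partial>\<mu>) \<le> ennreal R}"
  have KR: "openin weak_topology (borel_probs - ?KR)"
    using closedin_first_moment_le[of R, where 'a='a] by (simp add: closedin_def)
  have "openin weak_topology (borel_probs - ?K)"
  proof (subst openin_subopen, intro ballI)
    fix \<mu> assume \<mu>: "\<mu> \<in> borel_probs - ?K"
    show "\<exists>T. openin weak_topology T \<and> \<mu> \<in> T \<and> T \<subseteq> borel_probs - ?K"
    proof (cases "\<mu> \<in> ?KR")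
      case False
      then show ?thesis using \<mu> KR by (intro exI[of _ "borel_probs - ?KR"]) auto
    next
      case True
      then have "ereal b < free_energy W \<sigma>2 \<mu>" using \<mu> by auto
      then obtain a where a: "b < a" "ereal a < free_energy W \<sigma>2 \<mu>"
        using ereal_dense2 by (metis less_ereal.simps(1))
      have \<mu>': "\<mu> \<in> borel_probs" using \<mu> by auto
      obtain U where U: "openin weak_topology U" "\<mu> \<in> U"
        "\<And>\<nu>. \<nu> \<in> U \<Longrightarrow> (\<integral>\<^sup>+x. ennreal (norm x) \<partial>\<nu>) \<le> ennreal R \<Longrightarrow> ereal a \<le> free_energy W \<sigma>2 \<nu>"
        by (rule local_bound[OF \<mu>' a(2) R]) auto
      have "\<nu> \<notin> ?K" if "\<nu> \<in> U" for \<nu>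
      proof
        assume "\<nu> \<in> ?K"
        then have "ereal a \<le> ereal b" using U(3)[OF that] order_trans by blast
        then show False using a(1) by simp
      qed
      moreover have "U \<subseteq> borel_probs" using openin_subset[OF U(1)] by simp
      ultimately show ?thesis using U by blast
    qed
  qed
  then have "closedin weak_topology ?K" by (auto simp: closedin_def)
  then show ?thesis
    by (rule closed_compactin[OF compactin_first_moment_le[of R, where 'a='a], rotated]) auto
qed

lemma good_rate: "good_rate_function orbit_topology (rate_orbit W \<sigma>2)"
proof -
  obtain Fs where Fs: "free_energy_inf W \<sigma>2 = ereal Fs" by (rule free_energy_inf_real)
  have rate: "rate_orbit W \<sigma>2 (orbit \<mu>) = free_energy W \<sigma>2 \<mu> - ereal Fs" if "\<mu> \<in> borel_probs" for \<mu>
    using that by (simp add: rate_orbit_def free_energy_orbit_orbit Fs)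
  have 1: "rate_orbit W \<sigma>2 x \<noteq> - \<infinity>" if "x \<in> topspace orbit_topology" for x
  proof -
    obtain \<mu> where "\<mu> \<in> borel_probs" "x = orbit \<mu>" using \<open>x \<in> topspace orbit_topology\<close> by (auto simp: topspace_orbit_topology)
    then show ?thesis
      using free_energy_not_MInfty[of \<mu>] by (cases "free_energy W \<sigma>2 \<mu>") (simp_all add: rate)
  qed
  have 2: "\<exists>x\<in>topspace orbit_topology. rate_orbit W \<sigma>2 x \<noteq> \<infinity>"
  proof -
    obtain \<mu> where \<mu>: "\<mu> \<in> borel_probs" "free_energy W \<sigma>2 \<mu> < \<infinity>" using free_energy_finite_somewhere by blast
    have "rate_orbit W \<sigma>2 (orbit \<mu>) \<noteq> \<infinity>"
      using \<mu> by (cases "free_energy W \<sigma>2 \<mu>") (simp_all add: rate)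
    then show ?thesis using \<mu>(1) by (auto simp: topspace_orbit_topology)
  qed
  have 3: "compactin orbit_topology {x \<in> topspace orbit_topology. rate_orbit W \<sigma>2 x \<le> ereal a}" for a
  proof -
    define b where "b = Fs + a"
    \<comment> \<open>The bound that \<open>free_energy_coercive\<close> gives for the first moment
      of a centred measure with free energy at most b; \<open>max 0\<close> only secures
      nonnegativity.\<close>
    define R where "R = max 0 ((b + \<beta> * \<kappa> + ln (tilt (\<lambda>_::'a. 0) (\<beta> * \<kappa> / 2))) / (\<beta> * \<kappa> / 2))"
    let ?K = "{\<mu> \<in> borel_probs. (\<integral>\<^sup>+x. ennreal (norm x) \<partial>\<mu>) \<le> ennreal R \<and> free_energy W \<sigma>2 \<mu> \<le> ereal b}"
    have iff: "rate_orbit W \<sigma>2 (orbit \<mu>) \<le> ereal a \<longleftrightarrow> free_energy W \<sigma>2 \<mu> \<le> ereal b" if "\<mu> \<in> borel_probs" for \<mu>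
      by (cases "free_energy W \<sigma>2 \<mu>") (auto simp: rate[OF that] b_def)
    \<comment> \<open>First moments are unbounded along an orbit, so each orbit is represented by
      its centred member; the sublevel set is then the continuous image of a compact set.\<close>
    have "{x \<in> topspace orbit_topology. rate_orbit W \<sigma>2 x \<le> ereal a} = orbit ` ?K"
    proof (intro set_eqI iffI)
      fix x assume "x \<in> {x \<in> topspace orbit_topology. rate_orbit W \<sigma>2 x \<le> ereal a}"
      then obtain \<mu> where \<mu>: "\<mu> \<in> borel_probs" "x = orbit \<mu>" "free_energy W \<sigma>2 \<mu> \<le> ereal b"
        by (auto simp: topspace_orbit_topology iff)
      have W: "W \<mu> < \<infinity>" using \<mu>(3) free_energy_W_infinite[of \<mu>] by (cases "W \<mu> = \<infinity>") (auto simp: less_top)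
      define \<nu> where "\<nu> = translate (- (\<integral>x. x \<partial>\<mu>)) \<mu>"
      have \<nu>: "\<nu> \<in> borel_probs" unfolding \<nu>_def using \<mu>(1) by (rule translate_in_borel_probs)
      have W\<nu>: "W \<nu> < \<infinity>" using W W_translate[OF \<mu>(1)] by (simp add: \<nu>_def)
      have mean: "(\<integral>x. x \<partial>\<nu>) = 0"
        unfolding \<nu>_def by (rule centred_translate[OF W_finite_imp_moment_1[OF \<mu>(1) W]])
      have F\<nu>: "free_energy W \<sigma>2 \<nu> \<le> ereal b"
        unfolding \<nu>_def using \<mu>(3) by (simp add: free_energy_translate[OF \<mu>(1)])
      have "ereal (\<beta> * \<kappa> / 2 * (\<integral>x. norm x \<partial>\<nu>) - \<beta> * \<kappa> - ln (tilt (\<lambda>_::'a. 0) (\<beta> * \<kappa> / 2))) \<le> ereal b"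
        using order_trans[OF free_energy_coercive[OF \<nu> W\<nu>] F\<nu>] by (simp add: mean)
      then have "(\<integral>x. norm x \<partial>\<nu>) * (\<beta> * \<kappa> / 2) \<le> b + \<beta> * \<kappa> + ln (tilt (\<lambda>_::'a. 0) (\<beta> * \<kappa> / 2))"
        by (simp add: mult.commute)
      then have "(\<integral>x. norm x \<partial>\<nu>) \<le> (b + \<beta> * \<kappa> + ln (tilt (\<lambda>_::'a. 0) (\<beta> * \<kappa> / 2))) / (\<beta> * \<kappa> / 2)"
        using \<beta>_pos \<kappa> by (subst pos_le_divide_eq) auto
      then have "(\<integral>x. norm x \<partial>\<nu>) \<le> R" by (simp add: R_def)
      then have "(\<integral>\<^sup>+x. ennreal (norm x) \<partial>\<nu>) \<le> ennreal R"
        by (subst nn_integral_eq_integral[OF integrable_norm_probs_moment_1(1)[OF W_finite_imp_moment_1[OF \<nu> W\<nu>]]])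
           (auto intro: ennreal_leI)
      then have "\<nu> \<in> ?K" using \<nu> F\<nu> by simp
      moreover have "x = orbit \<nu>" using \<mu>(1,2) by (simp add: \<nu>_def translate_orbit)
      ultimately show "x \<in> orbit ` ?K" by blast
    qed (auto simp: topspace_orbit_topology iff)
    moreover have "compactin orbit_topology (orbit ` ?K)"
      by (rule image_compactin[OF compactin_free_energy_sublevel continuous_map_orbit]) (simp add: R_def)
    ultimately show ?thesis by simp
  qed
  show ?thesis unfolding good_rate_function_def using 1 2 3 by blast
qed

section \<open>From masses to probabilities on the orbit space\<close>

lemma eventually_mass_upper:
  assumes C: "closedin weak_topology C" and a: "\<And>\<mu>. \<mu> \<in> C \<Longrightarrow> ereal a < free_energy W \<sigma>2 \<mu>" and ba: "b < a"
  shows "\<forall>\<^sub>F n in sequentially. mass n C \<le> ennreal (exp (- (real n * b)))"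
proof -
  obtain M :: nat where M: "\<And>n. n > 0 \<Longrightarrow> mass n C \<le> of_nat M * ennreal (exp (- (real n * a)))"
    using upper_bound[OF C a] by blast
  \<comment> \<open>The gap between a and b absorbs the number M of covering sets.\<close>
  have "filterlim (\<lambda>n. exp (real n * (a - b))) at_top sequentially"
    by (rule filterlim_compose[OF exp_at_top filterlim_at_top_mult_tendsto_pos[OF tendsto_const _ filterlim_real_sequentially]])
       (use ba in simp)
  then have "\<forall>\<^sub>F n in sequentially. real M < exp (real n * (a - b))" by (simp add: filterlim_at_top_dense)
  then show ?thesis
    using eventually_gt_at_top[of 0]
  proof eventually_elim
    case (elim n)
    have "real M * exp (- (real n * a)) \<le> exp (real n * (a - b)) * exp (- (real n * a))"
      using elim by (intro mult_right_mono) auto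
    also have "\<dots> = exp (- (real n * b))" by (simp add: algebra_simps flip: exp_add)
    finally have "ennreal (real M * exp (- (real n * a))) \<le> ennreal (exp (- (real n * b)))" by (rule ennreal_leI)
    then have "of_nat M * ennreal (exp (- (real n * a))) \<le> ennreal (exp (- (real n * b)))"
      by (simp add: ennreal_mult ennreal_of_nat_eq_real_of_nat)
    then show ?case using M[of n] elim order_trans by blast
  qed
qed

text \<open>The multiplied-out form lets bounds on the two masses be combined without division in
  ennreal.\<close>

lemma measure_gibbs_orbit:
  assumes n: "n > 0" and U: "U \<in> sets (borel_of orbit_topology)"
  shows "ennreal (measure (gibbs_orbit W \<sigma>2 n) U) * mass n borel_probs = mass n (lift_orbit U)"
proof -
  interpret prob_space "gibbs_orbit W \<sigma>2 n" using n by (rule prob_space_gibbs_orbit)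
  show ?thesis
    using partition_pos[OF n] partition_finite[OF n]
    unfolding emeasure_eq_measure[symmetric] emeasure_gibbs_orbit[OF n U] ennreal_divide_times
    by (simp add: ennreal_divide_self)
qed

lemma scaled_log_prob_le:
  assumes "n > 0" "0 \<le> t" "t \<le> exp (- (real n * y))"
  shows "ereal (1 / real n) * log_prob t \<le> ereal (- y)"
proof (cases "t = 0")
  case False
  then have "ln t \<le> ln (exp (- (real n * y)))" using assms by (subst ln_le_cancel_iff) auto
  then have "ln t / real n \<le> - y" using assms(1) by (simp add: field_simps)
  then show ?thesis using False by (simp add: log_prob_def)
qed (use assms in \<open>simp add: log_prob_def\<close>)

lemma scaled_log_prob_ge:
  assumes "n > 0" "exp (- (real n * y)) \<le> t"
  shows "ereal (- y) \<le> ereal (1 / real n) * log_prob t"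
proof -
  have t: "t > 0" using assms(2) by (rule less_le_trans[OF exp_gt_zero])
  then have "ln (exp (- (real n * y))) \<le> ln t" using assms by (subst ln_le_cancel_iff) auto
  then have "- y \<le> ln t / real n" using assms(1) by (simp add: field_simps)
  then show ?thesis using t by (simp add: log_prob_def)
qed

lemma ldp_gibbs_orbit: "ldp orbit_topology (gibbs_orbit W \<sigma>2) (rate_orbit W \<sigma>2)"
proof -
  obtain Fs where Fs: "free_energy_inf W \<sigma>2 = ereal Fs"
    and Fs_le: "\<And>\<mu>. \<mu> \<in> borel_probs \<Longrightarrow> ereal Fs \<le> free_energy W \<sigma>2 \<mu>"
    and Fs_approx: "\<And>y. Fs < y \<Longrightarrow> \<exists>\<mu>\<in>borel_probs. free_energy W \<sigma>2 \<mu> < ereal y"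
    by (rule free_energy_inf_real) blast
  have rate: "rate_orbit W \<sigma>2 (orbit \<mu>) = free_energy W \<sigma>2 \<mu> - ereal Fs" if "\<mu> \<in> borel_probs" for \<mu>
    using that by (simp add: rate_orbit_def free_energy_orbit_orbit Fs)
  have Zup: "\<forall>\<^sub>F n in sequentially. mass n borel_probs \<le> ennreal (exp (- (real n * (Fs - e))))" if "e > 0" for e
  proof (rule eventually_mass_upper)
    show "closedin weak_topology borel_probs" using closedin_topspace[of weak_topology] by simp
    show "ereal (Fs - e / 2) < free_energy W \<sigma>2 \<mu>" if "\<mu> \<in> borel_probs" for \<mu>
      by (rule less_le_trans[OF _ Fs_le[OF that]]) (use \<open>e > 0\<close> in simp)
  qed (use that in simp)
  have Zlow: "\<forall>\<^sub>F n in sequentially. ennreal (exp (- (real n * (Fs + e)))) \<le> mass n borel_probs" if "e > 0" for e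
  proof -
    obtain \<mu> where \<mu>: "\<mu> \<in> borel_probs" "free_energy W \<sigma>2 \<mu> < ereal (Fs + e)" using Fs_approx[of "Fs + e"] \<open>e > 0\<close> by auto
    show ?thesis
      by (rule lower_bound[OF _ transl_inv_borel_probs \<mu>])
         (metis openin_topspace topspace_weak_topology)
  qed
  have lower: "\<forall>\<^sub>F n in sequentially. exp (- (real n * y)) \<le> measure (gibbs_orbit W \<sigma>2 n) G"
    if G: "openin orbit_topology G" and \<mu>: "\<mu> \<in> lift_orbit G" and y: "free_energy W \<sigma>2 \<mu> < ereal (Fs + y)" for G \<mu> y
  proof -
    have Gs: "G \<in> sets (borel_of orbit_topology)" using G by (rule openin_sets_borel_of)
    have "openin weak_topology {\<mu> \<in> topspace weak_topology. orbit \<mu> \<in> G}"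
      by (rule openin_continuous_map_preimage[OF continuous_map_orbit G])
    then have Go: "openin weak_topology (lift_orbit G)" by (simp add: lift_orbit_def)
    obtain a where a: "free_energy W \<sigma>2 \<mu> < ereal a" "a < Fs + y"
      using ereal_dense2[OF y] by auto
    \<comment> \<open>The mass of G decays at rate at most a and the partition function at rate at
      least \<open>Fs - e\<close>; the difference of these rates is exactly y.\<close>
    define e where "e = Fs + y - a"
    have e: "e > 0" using a by (simp add: e_def)
    show ?thesis
      using lower_bound[OF Go transl_inv_lift_orbit \<mu> a(1)] Zup[OF e] eventually_gt_at_top[of 0]
    proof eventually_elim
      case (elim n)
      let ?m = "measure (gibbs_orbit W \<sigma>2 n) G"
      have "ennreal (exp (- (real n * a))) \<le> ennreal ?m * mass n borel_probs"
        using elim(1) measure_gibbs_orbit[OF elim(3) Gs] by simp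
      also have "\<dots> \<le> ennreal ?m * ennreal (exp (- (real n * (Fs - e))))"
        using elim(2) by (intro mult_left_mono) auto
      also have "\<dots> = ennreal (?m * exp (- (real n * (Fs - e))))" by (simp add: ennreal_mult)
      finally have "exp (- (real n * a)) \<le> ?m * exp (- (real n * (Fs - e)))"
        by (subst (asm) ennreal_le_iff) auto
      then have "exp (- (real n * a)) * exp (real n * (Fs - e)) \<le> ?m * exp (- (real n * (Fs - e))) * exp (real n * (Fs - e))"
        by (intro mult_right_mono) auto
      moreover have "exp (- (real n * a)) * exp (real n * (Fs - e)) = exp (- (real n * y))"
        by (simp add: e_def algebra_simps flip: exp_add)
      moreover have "?m * exp (- (real n * (Fs - e))) * exp (real n * (Fs - e)) = ?m"
        by (simp add: mult.assoc flip: exp_add)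
      ultimately show "exp (- (real n * y)) \<le> ?m" by simp
    qed
  qed
  have upper: "\<forall>\<^sub>F n in sequentially. measure (gibbs_orbit W \<sigma>2 n) C \<le> exp (- (real n * y))"
    if C: "closedin orbit_topology C" and y: "\<And>\<mu>. \<mu> \<in> lift_orbit C \<Longrightarrow> ereal (Fs + y') < free_energy W \<sigma>2 \<mu>" and yy: "y < y'" for C y y'
  proof -
    have Cs: "C \<in> sets (borel_of orbit_topology)" using C by (rule closedin_sets_borel_of)
    have "closedin weak_topology {\<mu> \<in> topspace weak_topology. orbit \<mu> \<in> C}"
      by (rule closedin_continuous_map_preimage[OF continuous_map_orbit C])
    then have Cc: "closedin weak_topology (lift_orbit C)" by (simp add: lift_orbit_def)
    \<comment> \<open>One half of the gap between y and y' goes to the rate for C, the other half to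
      the partition function.\<close>
    define e where "e = (y' - y) / 2"
    have e: "e > 0" using yy by (simp add: e_def)
    have e': "Fs + y + e < Fs + y'" using yy by (simp add: e_def field_simps)
    have "\<forall>\<^sub>F n in sequentially. mass n (lift_orbit C) \<le> ennreal (exp (- (real n * (Fs + y + e))))"
      by (rule eventually_mass_upper[OF Cc _ e']) (rule y)
    then show ?thesis
      using Zlow[OF e] eventually_gt_at_top[of 0]
    proof eventually_elim
      case (elim n)
      let ?m = "measure (gibbs_orbit W \<sigma>2 n) C"
      have "ennreal (?m * exp (- (real n * (Fs + e)))) = ennreal ?m * ennreal (exp (- (real n * (Fs + e))))"
        by (simp add: ennreal_mult)
      also have "\<dots> \<le> ennreal ?m * mass n borel_probs" using elim(2) by (intro mult_left_mono) auto
      also have "\<dots> \<le> ennreal (exp (- (real n * (Fs + y + e))))"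
        using elim(1) measure_gibbs_orbit[OF elim(3) Cs] by simp
      finally have "?m * exp (- (real n * (Fs + e))) \<le> exp (- (real n * (Fs + y + e)))"
        by (subst (asm) ennreal_le_iff) auto
      then have "?m * exp (- (real n * (Fs + e))) * exp (real n * (Fs + e)) \<le> exp (- (real n * (Fs + y + e))) * exp (real n * (Fs + e))"
        by (intro mult_right_mono) auto
      moreover have "exp (- (real n * (Fs + y + e))) * exp (real n * (Fs + e)) = exp (- (real n * y))"
        by (simp add: algebra_simps flip: exp_add)
      moreover have "?m * exp (- (real n * (Fs + e))) * exp (real n * (Fs + e)) = ?m"
        by (simp add: mult.assoc flip: exp_add)
      ultimately show "?m \<le> exp (- (real n * y))" by simp
    qed
  qed
  show ?thesis
    unfolding ldp_def
  proof (intro conjI allI impI)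
    fix G :: "'a measure set set" assume G: "openin orbit_topology G"
    let ?L = "liminf (\<lambda>n. ereal (1 / real n) * log_prob (measure (gibbs_orbit W \<sigma>2 n) G))"
    have "- ?L \<le> rate_orbit W \<sigma>2 x" if x: "x \<in> G" for x
    proof -
      have "x \<in> orbit ` borel_probs" using openin_subset[OF G] x by (auto simp: topspace_orbit_topology)
      then obtain \<mu> where \<mu>: "\<mu> \<in> borel_probs" "x = orbit \<mu>" by blast
      have \<mu>G: "\<mu> \<in> lift_orbit G" using \<mu> x by (simp add: lift_orbit_def)
      show ?thesis
      \<comment> \<open>Working with levels strictly above the rate leaves a real y in between and
        also covers an infinite rate, for which no such level exists.\<close>
      proof (rule dense_ge)
        fix z assume "rate_orbit W \<sigma>2 x < z"
        then obtain y where y: "rate_orbit W \<sigma>2 x < ereal y" "ereal y < z" using ereal_dense2 by blast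
        have "free_energy W \<sigma>2 \<mu> < ereal (Fs + y)"
          using y(1) unfolding \<mu>(2) rate[OF \<mu>(1)] by (cases "free_energy W \<sigma>2 \<mu>") auto
        from lower[OF G \<mu>G this] have "\<forall>\<^sub>F n in sequentially. ereal (- y) \<le> ereal (1 / real n) * log_prob (measure (gibbs_orbit W \<sigma>2 n) G)"
          using eventually_gt_at_top[of 0] by eventually_elim (rule scaled_log_prob_ge)
        then have "ereal (- y) \<le> ?L" by (rule Liminf_bounded)
        then have "- ?L \<le> ereal y" by (simp add: ereal_uminus_le_reorder)
        then show "- ?L \<le> z" using y(2) by order
      qed
    qed
    then have "- ?L \<le> (INF x\<in>G. rate_orbit W \<sigma>2 x)" by (rule INF_greatest)
    then show "- (INF x\<in>G. rate_orbit W \<sigma>2 x) \<le> ?L" by (simp add: ereal_uminus_le_reorder)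
  next
    fix C :: "'a measure set set" assume C: "closedin orbit_topology C"
    let ?L = "limsup (\<lambda>n. ereal (1 / real n) * log_prob (measure (gibbs_orbit W \<sigma>2 n) C))"
    have "(INF x\<in>C. rate_orbit W \<sigma>2 x) \<le> - ?L"
    \<comment> \<open>Levels below the infimum leave room for two real numbers y < y', as
      \<open>upper\<close> requires. An infinite infimum, as for empty C, is exhausted by such
      levels.\<close>
    proof (rule dense_le)
      fix z assume "z < (INF x\<in>C. rate_orbit W \<sigma>2 x)"
      then obtain y' where y': "z < ereal y'" "ereal y' < (INF x\<in>C. rate_orbit W \<sigma>2 x)" using ereal_dense2 by blast
      obtain y where y: "z < ereal y" "y < y'" using ereal_dense2[OF y'(1)] by auto
      have Fy: "ereal (Fs + y') < free_energy W \<sigma>2 \<mu>" if "\<mu> \<in> lift_orbit C" for \<mu>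
      proof -
        have \<mu>: "\<mu> \<in> borel_probs" "orbit \<mu> \<in> C" using that by (auto simp: lift_orbit_def)
        have "ereal y' < rate_orbit W \<sigma>2 (orbit \<mu>)" using y'(2) INF_lower[OF \<mu>(2), of "rate_orbit W \<sigma>2"] by order
        then show ?thesis unfolding rate[OF \<mu>(1)] by (cases "free_energy W \<sigma>2 \<mu>") auto
      qed
      have "\<forall>\<^sub>F n in sequentially. measure (gibbs_orbit W \<sigma>2 n) C \<le> exp (- (real n * y))"
        by (rule upper[OF C _ y(2)]) (rule Fy)
      then have "\<forall>\<^sub>F n in sequentially. ereal (1 / real n) * log_prob (measure (gibbs_orbit W \<sigma>2 n) C) \<le> ereal (- y)"
        using eventually_gt_at_top[of 0] by eventually_elim (rule scaled_log_prob_le; simp)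
      then have "?L \<le> ereal (- y)" by (rule Limsup_bounded)
      then have "- ereal (- y) \<le> - ?L" by (simp only: ereal_minus_le_minus)
      then have "ereal y \<le> - ?L" by simp
      then show "z \<le> - ?L" using y(1) by order
    qed
    then have "- (- ?L) \<le> - (INF x\<in>C. rate_orbit W \<sigma>2 x)" by (simp only: ereal_minus_le_minus)
    then show "?L \<le> - (INF x\<in>C. rate_orbit W \<sigma>2 x)" by simp
  qed
qed

end

text \<open>The first conjunct certifies that the definitions by \<open>density\<close> and
  \<open>distr\<close> are not degenerate: the maps are measurable and the partition function lies
  strictly between 0 and infinity.\<close>

theorem theorem2p16:
  fixes W :: "(real ^ 'd) measure \<Rightarrow> ennreal" and \<sigma>2 l :: real
  assumes "\<sigma>2 > 0"
    and "translation_invariant W"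
    and "sigma_finite_energy W"
    and "lsc_energy W"
    and "l \<ge> 1" and "growth_control W l"
    and "subhomogeneous W"
    and "chaos_compatible W"
  shows "(\<forall>n\<ge>2. prob_space (gibbs_orbit W \<sigma>2 n)) \<and>
    good_rate_function orbit_topology (rate_orbit W \<sigma>2) \<and>
    ldp orbit_topology (gibbs_orbit W \<sigma>2) (rate_orbit W \<sigma>2)"
proof -
  obtain \<kappa> :: real where "\<kappa> > 0" "\<forall>\<mu>\<in>borel_probs. \<mu> \<notin> probs_moment l \<longrightarrow> W \<mu> = \<infinity>"
    "\<forall>\<mu>\<in>centred_probs l. W \<mu> \<ge> ennreal \<kappa> * (\<integral>\<^sup>+x. ennreal (norm x powr l) \<partial>\<mu>)"
    using assms(6) unfolding growth_control_def by blast
  then interpret confining_energy W \<sigma>2 l \<kappa>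
    using assms by unfold_locales auto
  show ?thesis
    using prob_space_gibbs_orbit good_rate ldp_gibbs_orbit by simp
qed

end
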